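(* Let $M$ be a compact smooth connected manifold of dimension $m\ge1$, let $(N,g)$ be a connected Riemannian manifold of dimension $n>m$, and let $A>0$. For all $F_0,F_1\in B_i(M,N)=\operatorname{Imm}(M,N)/\operatorname{Diff}(M)$, $$\sqrt{\operatorname{Vol}^g(F_1)}-\sqrt{\operatorname{Vol}^g(F_0)}\le\frac1{2\sqrt A}\operatorname{dist}^{B_i}_{G^A}(F_0,F_1).$$
   Context: $\operatorname{Imm}(M,N)$ is the space of smooth immersions $M\to N$; $\operatorname{Diff}(M)$ acts from the right by composition, and $\pi:\operatorname{Imm}(M,N)\to B_i(M,N)$ is the quotient map. For an immersion $f$, $\operatorname{vol}(f^*g)$ is the volume density of $f^*g$ on $M$ and $\operatorname{Vol}^g(f)=\int_M\operatorname{vol}(f^*g)$; this is $\operatorname{Diff}(M)$-invariant, so $\operatorname{Vol}^g(F)$ is defined for $F\in B_i(M,N)$. $N(f)\subset f^*TN$ is the normal bundle, $S^f(X,Y)=\nabla^g_X(Tf.Y)-Tf.\nabla^{f^*g}_XY\in\Gamma(N(f))$ is the second fundamental form, and $\operatorname{Tr}^{f^*g}(S^f)\in\Gamma(N(f))$ is its trace with respect to $f^*g$ (the mean curvature). The metric $G^A$ on $\operatorname{Imm}(M,N)$ is $$G^A_f(h,k)=\int_M\bigl(1+A\|\operatorname{Tr}^{f^*g}(S^f)\|_g^2\bigr)g(h,k)\operatorname{vol}(f^*g)$$ for vector fields $h,k$ along $f$. For a smooth path $f:[0,1]\times M\to N$ of immersions, with $f_t^\bot$ the component of $f_t=\partial_tf$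 normal to the immersion $f(t,\cdot)$, put $L^{\mathrm{hor}}_{G^A}(f)=\int_0^1\sqrt{G^A_{f}(f_t^\bot,f_t^\bot)}\,dt$. $\operatorname{dist}^{B_i}_{G^A}(F_0,F_1)$ is the infimum of $L^{\mathrm{hor}}_{G^A}(f)$ over all smooth paths $f$ in $\operatorname{Imm}(M,N)$ with $\pi(f(0,\cdot))=F_0$ and $\pi(f(1,\cdot))=F_1$ (with $\inf\emptyset=+\infty$). *)

theory Defs
  imports "HOL-Analysis.Analysis"
begin

section \<open>Smooth functions on open sets\<close>

text \<open>The set \<open>S\<close> is always open where this is used; all derivatives are full derivatives.\<close>

primrec Ck_on :: "nat \<Rightarrow> 'a::real_normed_vector set \<Rightarrow> ('a \<Rightarrow> 'b::real_normed_vector) \<Rightarrow> bool" where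
  "Ck_on 0 S f \<longleftrightarrow> continuous_on S f"
| "Ck_on (Suc k) S f \<longleftrightarrow> (\<forall>x\<in>S. f differentiable (at x)) \<and>
     (\<forall>v. Ck_on k S (\<lambda>x. frechet_derivative f (at x) v))"

definition smooth_on :: "'a::real_normed_vector set \<Rightarrow> ('a \<Rightarrow> 'b::real_normed_vector) \<Rightarrow> bool" where
  "smooth_on S f \<longleftrightarrow> (\<forall>k. Ck_on k S f)"

section \<open>Smooth manifolds and maps\<close>

text \<open>
  A manifold is a topological space (a type; Hausdorff and second countable by its type classes)
  with a smooth atlas, not required to be maximal. A chart is its domain paired with its
  coordinate map; the values of the coordinate map off the domain are irrelevant.
  The dimension is \<open>CARD('d)\<close>.
\<close>

type_synonym ('a, 'd) chart = "'a set \<times> ('a \<Rightarrow> real ^ 'd)"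
type_synonym ('a, 'd) atlas = "('a, 'd) chart set"

abbreviation dom_of :: "('a, 'd) chart \<Rightarrow> 'a set" where
  "dom_of c \<equiv> fst c"

abbreviation coord :: "('a, 'd) chart \<Rightarrow> 'a \<Rightarrow> real ^ 'd" where
  "coord c \<equiv> snd c"

definition param :: "('a, 'd) chart \<Rightarrow> real ^ 'd \<Rightarrow> 'a" where
  "param c = inv_into (dom_of c) (coord c)"

definition smooth_atlas :: "('a::topological_space, 'd::finite) atlas \<Rightarrow> bool" where
  "smooth_atlas M \<longleftrightarrow>
     (\<Union>c\<in>M. dom_of c) = UNIV \<and>
     (\<forall>c\<in>M. open (dom_of c) \<and> open (coord c ` dom_of c) \<and>
        homeomorphism (dom_of c) (coord c ` dom_of c) (coord c) (param c)) \<and>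
     (\<forall>c\<in>M. \<forall>d\<in>M. smooth_on (coord c ` (dom_of c \<inter> dom_of d)) (coord d \<circ> param c))"

definition chart_at :: "('a, 'd) atlas \<Rightarrow> 'a \<Rightarrow> ('a, 'd) chart" where
  "chart_at M p = (SOME c. c \<in> M \<and> p \<in> dom_of c)"

definition loc_rep :: "('a, 'm) chart \<Rightarrow> ('b, 'n) chart \<Rightarrow> ('a \<Rightarrow> 'b) \<Rightarrow> real ^ 'm \<Rightarrow> real ^ 'n" where
  "loc_rep c d f = coord d \<circ> f \<circ> param c"

definition smooth_map ::
  "('a::topological_space, 'm::finite) atlas \<Rightarrow> ('b::topological_space, 'n::finite) atlas \<Rightarrow> ('a \<Rightarrow> 'b) \<Rightarrow> bool" where
  "smooth_map M N f \<longleftrightarrow> continuous_on UNIV f \<and>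
     (\<forall>c\<in>M. \<forall>d\<in>N. smooth_on (coord c ` (dom_of c \<inter> f -` dom_of d)) (loc_rep c d f))"

definition Imm ::
  "('a::topological_space, 'm::finite) atlas \<Rightarrow> ('b::topological_space, 'n::finite) atlas \<Rightarrow> ('a \<Rightarrow> 'b) set" where
  "Imm M N = {f. smooth_map M N f \<and>
     (\<forall>c\<in>M. \<forall>d\<in>N. \<forall>p\<in>dom_of c \<inter> f -` dom_of d.
        inj (frechet_derivative (loc_rep c d f) (at (coord c p))))}"

definition Diff :: "('a::topological_space, 'm::finite) atlas \<Rightarrow> ('a \<Rightarrow> 'a) set" where
  "Diff M = {\<phi>. bij \<phi> \<and> smooth_map M M \<phi> \<and> smooth_map M M (inv \<phi>)}"

definition reparam ::
  "('a::topological_space, 'm::finite) atlas \<Rightarrow> ('b::topological_space, 'n::finite) atlas \<Rightarrow> (('a \<Rightarrow> 'b) \<times> ('a \<Rightarrow> 'b)) set" where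
  "reparam M N = {(f, f \<circ> \<phi>) | f \<phi>. f \<in> Imm M N \<and> \<phi> \<in> Diff M}"

definition Bi ::
  "('a::topological_space, 'm::finite) atlas \<Rightarrow> ('b::topological_space, 'n::finite) atlas \<Rightarrow> ('a \<Rightarrow> 'b) set set" where
  "Bi M N = Imm M N // reparam M N"

definition Bi_proj ::
  "('a::topological_space, 'm::finite) atlas \<Rightarrow> ('b::topological_space, 'n::finite) atlas \<Rightarrow> ('a \<Rightarrow> 'b) \<Rightarrow> ('a \<Rightarrow> 'b) set" where
  "Bi_proj M N f = reparam M N `` {f}"

section \<open>Riemannian metrics\<close>

text \<open>
  A covariant 2-tensor field is given by its components: one matrix-valued function on
  \<open>coord c ` dom_of c\<close> for each chart \<open>c\<close> of the atlas, subject to the transformation law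
  of tensors. Likewise a vector field along a map \<open>f\<close> into \<open>N\<close> is given at \<open>p\<close> by its
  component vectors, one for each chart around \<open>f p\<close>.
\<close>

type_synonym ('a, 'd) tensor = "('a, 'd) chart \<Rightarrow> real ^ 'd \<Rightarrow> real ^ 'd ^ 'd"
type_synonym ('a, 'b, 'n) field_along = "'a \<Rightarrow> ('b, 'n) chart \<Rightarrow> real ^ 'n"

definition riemannian_metric :: "('a::topological_space, 'd::finite) atlas \<Rightarrow> ('a, 'd) tensor \<Rightarrow> bool" where
  "riemannian_metric M g \<longleftrightarrow>
     (\<forall>c\<in>M. smooth_on (coord c ` dom_of c) (g c) \<and>
        (\<forall>x\<in>coord c ` dom_of c. transpose (g c x) = g c x \<and> (\<forall>v. v \<noteq> 0 \<longrightarrow> 0 < v \<bullet> (g c x *v v)))) \<and>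
     (\<forall>c\<in>M. \<forall>d\<in>M. \<forall>p\<in>dom_of c \<inter> dom_of d.
        let J = jacobian (coord d \<circ> param c) (at (coord c p))
        in g c (coord c p) = transpose J ** g d (coord d p) ** J)"

text \<open>\<open>inner_along N g f h k p\<close> is $g(h,k)$ at \<open>p\<close>, for vector fields \<open>h\<close>, \<open>k\<close> along \<open>f\<close>.\<close>

definition inner_along ::
  "('b, 'n::finite) atlas \<Rightarrow> ('b, 'n) tensor \<Rightarrow> ('a \<Rightarrow> 'b) \<Rightarrow>
   ('a, 'b, 'n) field_along \<Rightarrow> ('a, 'b, 'n) field_along \<Rightarrow> 'a \<Rightarrow> real" where
  "inner_along N g f h k p =
     (let d = chart_at N (f p) in h p d \<bullet> (g d (coord d (f p)) *v k p d))"

definition pullback ::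
  "('b, 'n::finite) atlas \<Rightarrow> ('b, 'n) tensor \<Rightarrow> ('a \<Rightarrow> 'b) \<Rightarrow> ('a, 'm::finite) tensor" where
  "pullback N g f c x =
     (let d = chart_at N (f (param c x)); J = jacobian (loc_rep c d f) (at x)
      in transpose J ** g d (loc_rep c d f x) ** J)"

text \<open>
  The measure on \<open>M\<close> of the volume density of the metric \<open>h\<close>: in every chart it has Lebesgue
  density $\sqrt{\det h}$.
\<close>

definition vol_measure :: "('a::topological_space, 'm::finite) atlas \<Rightarrow> ('a, 'm) tensor \<Rightarrow> 'a measure" where
  "vol_measure M h = (THE \<mu>. sets \<mu> = sets borel \<and>
     (\<forall>c\<in>M. \<forall>E\<in>sets borel. E \<subseteq> dom_of c \<longrightarrow>
        emeasure \<mu> E = (\<integral>\<^sup>+x\<in>coord c ` E. ennreal (sqrt (det (h c x))) \<partial>lborel)))"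

definition Vol ::
  "('a::topological_space, 'm::finite) atlas \<Rightarrow> ('b, 'n::finite) atlas \<Rightarrow> ('b, 'n) tensor \<Rightarrow> ('a \<Rightarrow> 'b) \<Rightarrow> real" where
  "Vol M N g f = measure (vol_measure M (pullback N g f)) UNIV"

text \<open>The common value of \<open>Vol\<close> on an orbit.\<close>

definition Vol_Bi ::
  "('a::topological_space, 'm::finite) atlas \<Rightarrow> ('b, 'n::finite) atlas \<Rightarrow> ('b, 'n) tensor \<Rightarrow> ('a \<Rightarrow> 'b) set \<Rightarrow> real" where
  "Vol_Bi M N g F = the_elem (Vol M N g ` F)"

section \<open>Levi-Civita connection and second fundamental form\<close>

text \<open>
  In this block \<open>G\<close> and \<open>H\<close> are metrics on open subsets of coordinate spaces, \<open>\<phi>\<close> is a map between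
  such sets, and \<open>X\<close>, \<open>Y\<close> are vector fields in coordinates. \<open>christoffel G x v w\<close> is the vector with
  components $\Gamma^k_{ij} v^i w^j$.
\<close>

definition partial_deriv :: "'m::finite \<Rightarrow> (real ^ 'm \<Rightarrow> 'e::real_normed_vector) \<Rightarrow> real ^ 'm \<Rightarrow> 'e" where
  "partial_deriv i f x = frechet_derivative f (at x) (axis i 1)"

definition christoffel_symbol :: "(real ^ 'd \<Rightarrow> real ^ 'd ^ 'd) \<Rightarrow> real ^ 'd \<Rightarrow> 'd::finite \<Rightarrow> 'd \<Rightarrow> 'd \<Rightarrow> real" where
  "christoffel_symbol G x k i j = (1/2) * (\<Sum>l\<in>UNIV. matrix_inv (G x) $ k $ l *
     (partial_deriv i G x $ j $ l + partial_deriv j G x $ i $ l - partial_deriv l G x $ i $ j))"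

definition christoffel :: "(real ^ 'd \<Rightarrow> real ^ 'd ^ 'd) \<Rightarrow> real ^ 'd \<Rightarrow> real ^ 'd \<Rightarrow> real ^ 'd \<Rightarrow> real ^ 'd::finite" where
  "christoffel G x v w = (\<chi> k. \<Sum>i\<in>UNIV. \<Sum>j\<in>UNIV. christoffel_symbol G x k i j * v $ i * w $ j)"

text \<open>$\nabla^G_X h$ for a vector field \<open>h\<close> along \<open>\<phi>\<close>; for \<open>\<phi> = id\<close> this is the covariant derivative
  of a vector field.\<close>

definition cov_deriv_along ::
  "(real ^ 'n \<Rightarrow> real ^ 'n ^ 'n) \<Rightarrow> (real ^ 'm \<Rightarrow> real ^ 'n) \<Rightarrow>
   (real ^ 'm \<Rightarrow> real ^ 'm) \<Rightarrow> (real ^ 'm \<Rightarrow> real ^ 'n) \<Rightarrow> real ^ 'm::finite \<Rightarrow> real ^ 'n::finite" where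
  "cov_deriv_along G \<phi> X h x =
     frechet_derivative h (at x) (X x) +
     christoffel G (\<phi> x) (frechet_derivative \<phi> (at x) (X x)) (h x)"

definition cov_deriv ::
  "(real ^ 'm \<Rightarrow> real ^ 'm ^ 'm) \<Rightarrow> (real ^ 'm \<Rightarrow> real ^ 'm) \<Rightarrow> (real ^ 'm \<Rightarrow> real ^ 'm) \<Rightarrow>
   real ^ 'm::finite \<Rightarrow> real ^ 'm" where
  "cov_deriv H X Y x = cov_deriv_along H (\<lambda>y. y) X Y x"

definition second_ff ::
  "(real ^ 'm \<Rightarrow> real ^ 'm ^ 'm) \<Rightarrow> (real ^ 'n \<Rightarrow> real ^ 'n ^ 'n) \<Rightarrow> (real ^ 'm \<Rightarrow> real ^ 'n) \<Rightarrow>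
   (real ^ 'm \<Rightarrow> real ^ 'm) \<Rightarrow> (real ^ 'm \<Rightarrow> real ^ 'm) \<Rightarrow> real ^ 'm::finite \<Rightarrow> real ^ 'n::finite" where
  "second_ff H G \<phi> X Y x =
     cov_deriv_along G \<phi> X (\<lambda>y. frechet_derivative \<phi> (at y) (Y y)) x -
     frechet_derivative \<phi> (at x) (cov_deriv H X Y x)"

text \<open>
  $\mathrm{Tr}^{f^*g}(S^f) = \sum_{i,j} (f^*g)^{ij} S^f(\partial_i, \partial_j)$, computed in a chart
  of \<open>M\<close> around the point; it does not depend on that chart.
\<close>

definition mean_curvature ::
  "('a, 'm::finite) atlas \<Rightarrow> ('b, 'n::finite) atlas \<Rightarrow> ('b, 'n) tensor \<Rightarrow> ('a \<Rightarrow> 'b) \<Rightarrow>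
   ('a, 'b, 'n) field_along" where
  "mean_curvature M N g f p d =
     (let c = chart_at M p; x = coord c p; H = pullback N g f c
      in \<Sum>i\<in>UNIV. \<Sum>j\<in>UNIV. (matrix_inv (H x) $ i $ j) *\<^sub>R
           second_ff H (g d) (loc_rep c d f) (\<lambda>_. axis i 1) (\<lambda>_. axis j 1) x)"

text \<open>The component \<open>h\<^sup>\<bottom>\<close> in the decomposition \<open>h = Tf.X + h\<^sup>\<bottom>\<close> into tangential and
  \<open>g\<close>-orthogonal part.\<close>

definition normal_part ::
  "('a, 'm::finite) atlas \<Rightarrow> ('b, 'n::finite) tensor \<Rightarrow> ('a \<Rightarrow> 'b) \<Rightarrow>
   ('a, 'b, 'n) field_along \<Rightarrow> ('a, 'b, 'n) field_along" where
  "normal_part M g f h p d =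
     (let c = chart_at M p; T = frechet_derivative (loc_rep c d f) (at (coord c p))
      in THE w. (\<exists>X. h p d = T X + w) \<and> (\<forall>Y. w \<bullet> (g d (coord d (f p)) *v T Y) = 0))"

section \<open>The metric and the distance\<close>

definition GA ::
  "('a::topological_space, 'm::finite) atlas \<Rightarrow> ('b, 'n::finite) atlas \<Rightarrow> ('b, 'n) tensor \<Rightarrow> real \<Rightarrow>
   ('a \<Rightarrow> 'b) \<Rightarrow> ('a, 'b, 'n) field_along \<Rightarrow> ('a, 'b, 'n) field_along \<Rightarrow> real" where
  "GA M N g A f h k =
     (LINT p | vol_measure M (pullback N g f).
        (1 + A * inner_along N g f (mean_curvature M N g f) (mean_curvature M N g f) p) *
        inner_along N g f h k p)"

text \<open>
  Smooth paths $[0,1] \times M \to N$ of immersions. As usual on a manifold with boundary, smooth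
  means that near every point the coordinate representation is the restriction of a smooth function
  on an open set. Values at times outside \<open>{0..1}\<close> are irrelevant.
\<close>

definition smooth_path ::
  "('a::topological_space, 'm::finite) atlas \<Rightarrow> ('b::topological_space, 'n::finite) atlas \<Rightarrow>
   (real \<Rightarrow> 'a \<Rightarrow> 'b) \<Rightarrow> bool" where
  "smooth_path M N f \<longleftrightarrow>
     (\<forall>t\<in>{0..1}. f t \<in> Imm M N) \<and>
     (\<forall>t\<in>{0..1}. \<forall>c\<in>M. \<forall>d\<in>N. \<forall>p\<in>dom_of c \<inter> f t -` dom_of d.
        \<exists>W F. open W \<and> (t, coord c p) \<in> W \<and> smooth_on W F \<and>
          (\<forall>(s, x)\<in>W. s \<in> {0..1} \<longrightarrow> x \<in> coord c ` dom_of c \<and> f s (param c x) \<in> dom_of d \<and>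
             loc_rep c d (f s) x = F (s, x)))"

definition velocity :: "(real \<Rightarrow> 'a \<Rightarrow> 'b) \<Rightarrow> real \<Rightarrow> ('a, 'b, 'n::finite) field_along" where
  "velocity f t p d = vector_derivative (\<lambda>s. coord d (f s p)) (at t within {0..1})"

definition Lhor ::
  "('a::topological_space, 'm::finite) atlas \<Rightarrow> ('b, 'n::finite) atlas \<Rightarrow> ('b, 'n) tensor \<Rightarrow> real \<Rightarrow>
   (real \<Rightarrow> 'a \<Rightarrow> 'b) \<Rightarrow> real" where
  "Lhor M N g A f =
     integral {0..1} (\<lambda>t. sqrt (GA M N g A (f t)
       (normal_part M g (f t) (velocity f t)) (normal_part M g (f t) (velocity f t))))"

definition dist_Bi ::
  "('a::topological_space, 'm::finite) atlas \<Rightarrow> ('b::topological_space, 'n::finite) atlas \<Rightarrow>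
   ('b, 'n) tensor \<Rightarrow> real \<Rightarrow> ('a \<Rightarrow> 'b) set \<Rightarrow> ('a \<Rightarrow> 'b) set \<Rightarrow> ereal" where
  "dist_Bi M N g A F0 F1 =
     (INF f\<in>{f. smooth_path M N f \<and> Bi_proj M N (f 0) = F0 \<and> Bi_proj M N (f 1) = F1}.
        ereal (Lhor M N g A f))"

end

(*
  Along a path of immersions the volume changes at the rate - \<integral> g(Tr S, f_t^\<bottom>) vol: the
  tangential part of f_t only contributes a divergence. By Cauchy-Schwarz the square of this rate is at
  most Vol(f) * \<integral> |Tr S|^2 |f_t^\<bottom>|^2 vol \<le> Vol(f) * G^A(f_t^\<bottom>, f_t^\<bottom>) / A, so sqrt(Vol(f)) grows at most
  at the rate sqrt(G^A(f_t^\<bottom>, f_t^\<bottom>)) / (2 sqrt A); integrate over [0,1].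
*)
theory Submission
  imports Defs
begin

text \<open>Tensors are given chart by chart and charts are picked by \<open>chart_at\<close>, so
  neither regularity nor chart independence can be read off the definitions; most of the work
  rewrites each quantity in one fixed chart. The second fundamental form is written with the
  Christoffel symbols of the pulled back metric. The volume measure is given by a description
  operator; its existence, uniqueness and finiteness come from compactness through finite covers. A
  path is smooth only through local extensions \<open>F\<close> past the time interval, so the
  variation formula is proved for \<open>F\<close> on open sets of space-time and then restricted,
  with one-sided time derivatives at the ends. The divergence is removed by a C1 partition of unity:
  each piece has compact support in a coordinate box, and the derivatives of the cutoffs add up to
  the derivative of 1.\<close>

abbreviation fd :: "('a::real_normed_vector \<Rightarrow> 'b::real_normed_vector) \<Rightarrow> 'a \<Rightarrow> 'a \<Rightarrow> 'b" where
  "fd f x \<equiv> frechet_derivative f (at x)"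

lemma has_derivative_fd: "f differentiable at x \<Longrightarrow> (f has_derivative fd f x) (at x)"
  using frechet_derivative_works by blast

lemma fd_eqI: "(f has_derivative f') (at x) \<Longrightarrow> fd f x = f'"
  using frechet_derivative_at by metis

lemma linear_fd: "f differentiable at x \<Longrightarrow> linear (fd f x)"
  by (rule linear_frechet_derivative)

lemma has_derivative_cong_open:
  assumes "open S" "x \<in> S" "\<And>y. y \<in> S \<Longrightarrow> f y = h y"
  shows "(f has_derivative f') (at x) \<longleftrightarrow> (h has_derivative f') (at x)"
  using assms by (metis has_derivative_transform_within_open)

text \<open>\<open>frechet_derivative\<close> chooses among all derivatives at the point, and being
  a derivative is a local property; the two choices coincide even where no derivative
  exists.\<close>

lemma fd_cong_open:
  assumes "open S" "x \<in> S" "\<And>y. y \<in> S \<Longrightarrow> f y = h y"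
  shows "fd f x = fd h x"
  unfolding frechet_derivative_def using has_derivative_cong_open[OF assms] by presburger

lemma fd_compose:
  assumes "f differentiable at x" "h differentiable at (f x)"
  shows "fd (\<lambda>y. h (f y)) x v = fd h (f x) (fd f x v)"
  using fd_eqI[OF has_derivative_compose[OF has_derivative_fd has_derivative_fd, OF assms]] by simp

lemma linear_euclidean_expand:
  fixes L :: "'a::euclidean_space \<Rightarrow> 'b::real_normed_vector"
  assumes "linear L"
  shows "L v = (\<Sum>b\<in>Basis. (v \<bullet> b) *\<^sub>R L b)"
proof -
  have "L v = L (\<Sum>b\<in>Basis. (v \<bullet> b) *\<^sub>R b)" by (simp add: euclidean_representation)
  also have "\<dots> = (\<Sum>b\<in>Basis. (v \<bullet> b) *\<^sub>R L b)"
    by (simp add: linear_sum[OF assms] linear_cmul[OF assms])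
  finally show ?thesis .
qed

lemma linear_vec_expand:
  fixes L :: "real ^ 'm::finite \<Rightarrow> 'b::real_normed_vector"
  assumes "linear L"
  shows "L v = (\<Sum>i\<in>UNIV. (v $ i) *\<^sub>R L (axis i 1))"
proof -
  have "L v = L (\<Sum>i\<in>UNIV. (v $ i) *\<^sub>R axis i 1)"
    using basis_expansion[of v] by (simp add: scalar_mult_eq_scaleR)
  also have "\<dots> = (\<Sum>i\<in>UNIV. (v $ i) *\<^sub>R L (axis i 1))"
    by (simp add: linear_sum[OF assms] linear_cmul[OF assms])
  finally show ?thesis .
qed

section \<open>Continuously differentiable functions\<close>

text \<open>Volume density, tangential coordinates and cutoffs are differentiated only once, so
  closure under products, inverses, square roots and linear solving is established for this class
  and not for every order.\<close>

abbreviation C1_on :: "'a::real_normed_vector set \<Rightarrow> ('a \<Rightarrow> 'b::real_normed_vector) \<Rightarrow> bool" where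
  "C1_on \<equiv> Ck_on (Suc 0)"

lemma C1_onI:
  assumes "\<And>x. x \<in> S \<Longrightarrow> (f has_derivative f' x) (at x)" "\<And>v. continuous_on S (\<lambda>x. f' x v)"
  shows "C1_on S f"
proof -
  have "fd f x = f' x" if "x \<in> S" for x using fd_eqI assms(1) that by blast
  then have "continuous_on S (\<lambda>x. fd f x v)" for v
    using continuous_on_cong[of S S "\<lambda>x. fd f x v" "\<lambda>x. f' x v"] assms(2)[of v] by auto
  then show ?thesis using assms(1) by (auto simp: differentiable_def)
qed

lemma C1_on_differentiable: "C1_on S f \<Longrightarrow> x \<in> S \<Longrightarrow> f differentiable at x"
  by simp

lemma C1_on_fd: "C1_on S f \<Longrightarrow> x \<in> S \<Longrightarrow> (f has_derivative fd f x) (at x)"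
  by (simp add: has_derivative_fd)

lemma C1_on_continuous_fd: "C1_on S f \<Longrightarrow> continuous_on S (\<lambda>x. fd f x v)"
  by simp

lemma C1_on_continuous: "C1_on S f \<Longrightarrow> continuous_on S f"
  by (simp add: continuous_at_imp_continuous_on differentiable_imp_continuous_within)

lemma C1_on_cong_open:
  assumes "open S" "\<And>y. y \<in> S \<Longrightarrow> f y = h y" "C1_on S f"
  shows "C1_on S h"
proof (rule C1_onI)
  show "(h has_derivative fd f x) (at x)" if "x \<in> S" for x
    using has_derivative_cong_open[OF assms(1) that, of f h] assms(2) C1_on_fd[OF assms(3) that] by blast
qed (use C1_on_continuous_fd[OF assms(3)] in auto)

lemma C1_on_const: "C1_on S (\<lambda>x. k)"
  by (rule C1_onI[where f'="\<lambda>x v. 0"]) auto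

lemma C1_on_bilinear:
  assumes P: "bounded_bilinear P" and f: "C1_on S f" and h: "C1_on S h"
  shows "C1_on S (\<lambda>x. P (f x) (h x))"
proof (rule C1_onI)
  show "((\<lambda>x. P (f x) (h x)) has_derivative (\<lambda>v. P (f x) (fd h x v) + P (fd f x v) (h x))) (at x)"
    if "x \<in> S" for x
    by (rule bounded_bilinear.FDERIV[OF P C1_on_fd[OF f that] C1_on_fd[OF h that]])
  show "continuous_on S (\<lambda>x. P (f x) (fd h x v) + P (fd f x v) (h x))" for v
    using C1_on_continuous[OF f] C1_on_continuous[OF h] C1_on_continuous_fd[OF f] C1_on_continuous_fd[OF h]
    by (intro continuous_on_add bounded_bilinear.continuous_on[OF P]) auto
qed

lemma C1_on_linear_compose:
  assumes L: "bounded_linear L" and f: "C1_on S f"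
  shows "C1_on S (\<lambda>x. L (f x))"
proof (rule C1_onI)
  show "((\<lambda>x. L (f x)) has_derivative (\<lambda>v. L (fd f x v))) (at x)" if "x \<in> S" for x
    by (rule bounded_linear.has_derivative[OF L C1_on_fd[OF f that]])
  show "continuous_on S (\<lambda>x. L (fd f x v))" for v
    by (rule bounded_linear.continuous_on[OF L C1_on_continuous_fd[OF f]])
qed

lemma C1_on_add:
  assumes "C1_on S f" "C1_on S h" shows "C1_on S (\<lambda>x. f x + h x)"
proof (rule C1_onI)
  show "((\<lambda>x. f x + h x) has_derivative (\<lambda>v. fd f x v + fd h x v)) (at x)" if "x \<in> S" for x
    using C1_on_fd[OF assms(1) that] C1_on_fd[OF assms(2) that] by (rule has_derivative_add)
qed (intro continuous_on_add C1_on_continuous_fd assms)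

lemma C1_on_sum:
  "(\<And>i. i \<in> I \<Longrightarrow> C1_on S (f i)) \<Longrightarrow> C1_on S (\<lambda>x. \<Sum>i\<in>I. f i x)"
proof (induction I rule: infinite_finite_induct)
  case (insert i I)
  show ?case
    unfolding sum.insert[OF insert(1,2)] by (rule C1_on_add) (use insert in \<open>auto simp del: Ck_on.simps\<close>)
qed (simp_all add: C1_on_const del: Ck_on.simps)

lemma C1_on_mult:
  fixes f h :: "'a::real_normed_vector \<Rightarrow> real"
  shows "C1_on S f \<Longrightarrow> C1_on S h \<Longrightarrow> C1_on S (\<lambda>x. f x * h x)"
  by (rule C1_on_bilinear[OF bounded_bilinear_mult])

lemma C1_on_inner: "C1_on S f \<Longrightarrow> C1_on S h \<Longrightarrow> C1_on S (\<lambda>x. f x \<bullet> h x)"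
  by (rule C1_on_bilinear[OF bounded_bilinear_inner])

lemma C1_on_prod:
  fixes f :: "'i \<Rightarrow> 'a::real_normed_vector \<Rightarrow> real"
  shows "(\<And>i. i \<in> I \<Longrightarrow> C1_on S (f i)) \<Longrightarrow> C1_on S (\<lambda>x. \<Prod>i\<in>I. f i x)"
proof (induction I rule: infinite_finite_induct)
  case (insert i I)
  show ?case
    unfolding prod.insert[OF insert(1,2)] by (rule C1_on_mult) (use insert in \<open>auto simp del: Ck_on.simps\<close>)
qed (simp_all add: C1_on_const del: Ck_on.simps)

lemma C1_on_nth: "C1_on S f \<Longrightarrow> C1_on S (\<lambda>x. f x $ i)"
  by (rule C1_on_linear_compose[OF bounded_linear_vec_nth])

lemma C1_on_vec:
  fixes f :: "'a::real_normed_vector \<Rightarrow> 'b::euclidean_space ^ 'm::finite"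
  assumes "\<And>i. C1_on S (\<lambda>x. f x $ i)"
  shows "C1_on S f"
proof -
  have bl: "bounded_linear (\<lambda>y::'b. axis i y :: 'b ^ 'm)" for i
    by (rule linear_conv_bounded_linear[THEN iffD1]) (auto intro!: linearI simp: axis_def vec_eq_iff)
  have "C1_on S (\<lambda>x. \<Sum>i\<in>UNIV. (axis i (f x $ i) :: 'b ^ 'm))"
    by (intro C1_on_sum C1_on_linear_compose[OF bl] assms)
  moreover have "(\<Sum>i\<in>UNIV. (axis i (f x $ i) :: 'b ^ 'm)) = f x" for x
    by (simp add: vec_eq_iff axis_def if_distrib sum.delta' cong: if_cong)
  ultimately show ?thesis by (simp del: Ck_on.simps)
qed

text \<open>\<open>C1_on\<close> controls the derivative for each fixed direction; expanding a
  varying direction in the finite basis gives joint continuity.\<close>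

lemma continuous_on_fd_joint:
  fixes f :: "'a::euclidean_space \<Rightarrow> 'b::real_normed_vector"
  assumes f: "C1_on S f" and "continuous_on T p" "p ` T \<subseteq> S" "continuous_on T v"
  shows "continuous_on T (\<lambda>x. fd f (p x) (v x))"
proof -
  have "continuous_on T (\<lambda>x. fd f (p x) b)" for b
    using continuous_on_compose2[OF C1_on_continuous_fd[OF f] assms(2,3)] .
  then have "continuous_on T (\<lambda>x. \<Sum>b\<in>Basis. (v x \<bullet> b) *\<^sub>R fd f (p x) b)"
    by (intro continuous_intros assms)
  moreover have "fd f (p x) (v x) = (\<Sum>b\<in>Basis. (v x \<bullet> b) *\<^sub>R fd f (p x) b)" if "x \<in> T" for x
    using assms(3) that by (intro linear_euclidean_expand linear_fd C1_on_differentiable[OF f]) auto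
  ultimately show ?thesis by (simp cong: continuous_on_cong)
qed

lemma C1_on_compose:
  fixes h :: "'b::euclidean_space \<Rightarrow> 'c::real_normed_vector"
  assumes f: "C1_on S f" and h: "C1_on T h" and "f ` S \<subseteq> T"
  shows "C1_on S (\<lambda>x. h (f x))"
proof (rule C1_onI)
  show "((\<lambda>x. h (f x)) has_derivative (\<lambda>v. fd h (f x) (fd f x v))) (at x)" if "x \<in> S" for x
    using C1_on_fd[OF f that] C1_on_fd[OF h] assms(3) that by (metis has_derivative_compose image_subset_iff)
  show "continuous_on S (\<lambda>x. fd h (f x) (fd f x v))" for v
    by (rule continuous_on_fd_joint[OF h C1_on_continuous[OF f] assms(3) C1_on_continuous_fd[OF f]])
qed

lemma C1_on_inverse:
  fixes f :: "'a::real_normed_vector \<Rightarrow> real"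
  assumes f: "C1_on S f" and "\<And>x. x \<in> S \<Longrightarrow> f x \<noteq> 0"
  shows "C1_on S (\<lambda>x. inverse (f x))"
proof (rule C1_onI)
  show "((\<lambda>x. inverse (f x)) has_derivative (\<lambda>v. - (inverse (f x) * fd f x v * inverse (f x)))) (at x)"
    if "x \<in> S" for x
    by (rule Deriv.has_derivative_inverse[OF assms(2)[OF that] C1_on_fd[OF f that]])
  show "continuous_on S (\<lambda>x. - (inverse (f x) * fd f x v * inverse (f x)))" for v
    using assms(2) by (intro continuous_intros C1_on_continuous[OF f] C1_on_continuous_fd[OF f]) auto
qed

lemma C1_on_sqrt:
  fixes f :: "'a::real_normed_vector \<Rightarrow> real"
  assumes f: "C1_on S f" and "\<And>x. x \<in> S \<Longrightarrow> f x > 0"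
  shows "C1_on S (\<lambda>x. sqrt (f x))"
proof (rule C1_onI)
  show "((\<lambda>x. sqrt (f x)) has_derivative (\<lambda>v. fd f x v * (inverse (sqrt (f x)) / 2))) (at x)"
    if "x \<in> S" for x
    using has_derivative_real_sqrt[OF assms(2)[OF that] C1_on_fd[OF f that]] by (simp add: field_simps)
  show "continuous_on S (\<lambda>x. fd f x v * (inverse (sqrt (f x)) / 2))" for v
    using assms(2) by (intro continuous_intros C1_on_continuous[OF f] C1_on_continuous_fd[OF f])
      (auto simp: less_imp_neq[THEN not_sym])
qed

lemma C1_on_det:
  fixes H :: "'a::real_normed_vector \<Rightarrow> real ^ 'm ^ 'm::finite"
  assumes "C1_on S H"
  shows "C1_on S (\<lambda>x. det (H x))"
  unfolding det_def by (intro C1_on_sum C1_on_mult C1_on_const C1_on_prod C1_on_nth assms)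

lemma bounded_bilinear_matrix_vector_mult:
  "bounded_bilinear (\<lambda>(A::real ^ 'm ^ 'n) (x::real ^ 'm). A *v x)"
proof -
  have "bilinear (\<lambda>(A::real ^ 'm ^ 'n) (x::real ^ 'm). A *v x)"
    unfolding bilinear_def
    by (intro conjI allI linearI)
      (simp_all add: vec_eq_iff matrix_vector_mult_def sum.distrib sum_distrib_left algebra_simps)
  then show ?thesis by (simp add: bilinear_conv_bounded_bilinear)
qed

lemmas C1_on_matrix_vector_mult = C1_on_bilinear[OF bounded_bilinear_matrix_vector_mult]

lemma matrix_inv_left_right:
  fixes A :: "real ^ 'm ^ 'm::finite"
  assumes "det A \<noteq> 0"
  shows "matrix_inv A ** A = mat 1" "A ** matrix_inv A = mat 1"
proof -
  have "\<exists>B. A ** B = mat 1 \<and> B ** A = mat 1"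
    using assms by (simp add: invertible_det_nz[symmetric] invertible_def)
  then have "A ** matrix_inv A = mat 1 \<and> matrix_inv A ** A = mat 1"
    unfolding matrix_inv_def by (rule someI_ex)
  then show "matrix_inv A ** A = mat 1" "A ** matrix_inv A = mat 1" by auto
qed

lemma matrix_inv_mult_eq_iff:
  fixes A :: "real ^ 'm ^ 'm::finite"
  assumes "det A \<noteq> 0"
  shows "matrix_inv A *v b = x \<longleftrightarrow> A *v x = b"
  by (metis assms matrix_inv_left_right matrix_vector_mul_assoc matrix_vector_mul_lid)

text \<open>Cramer's rule writes the solution as quotients of determinants of C1 matrices, so no
  derivative of the inverse matrix is needed. It serves the tangential coordinates of the
  velocity.\<close>

lemma C1_on_solve:
  fixes H :: "'a::real_normed_vector \<Rightarrow> real ^ 'm ^ 'm::finite"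
  assumes H: "C1_on S H" and b: "C1_on S b" and nz: "\<And>x. x \<in> S \<Longrightarrow> det (H x) \<noteq> 0" and S: "open S"
  shows "C1_on S (\<lambda>x. matrix_inv (H x) *v b x)"
proof -
  define h where "h x = (\<chi> k. det (\<chi> i j. if j = k then b x $ i else H x $ i $ j) * inverse (det (H x)))" for x
  have "C1_on S (\<lambda>x. (\<chi> i j. if j = k then b x $ i else H x $ i $ j))" for k
  proof (intro C1_on_vec)
    fix i j
    show "C1_on S (\<lambda>x. (\<chi> i j. if j = k then b x $ i else H x $ i $ j) $ i $ j)"
      by (cases "j = k") (simp_all add: C1_on_nth H b del: Ck_on.simps)
  qed
  then have hC: "C1_on S h"
    unfolding h_def
    by (intro C1_on_vec) (simp add: C1_on_mult C1_on_inverse C1_on_det H nz del: Ck_on.simps)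
  have "matrix_inv (H x) *v b x = h x" if "x \<in> S" for x
    unfolding  matrix_inv_mult_eq_iff[OF nz[OF that]] cramer[OF nz[OF that]] h_def by (simp add: divide_inverse)
  then have "h x = matrix_inv (H x) *v b x" if "x \<in> S" for x
    using that by simp
  then show ?thesis by (rule C1_on_cong_open[OF S _ hC])
qed

text \<open>Column \<open>l\<close> of the inverse solves the system with right-hand side
  \<open>axis l 1\<close>, so Cramer's rule gives its entries as quotients of determinants.\<close>

lemma continuous_on_matrix_inv:
  fixes H :: "'a::topological_space \<Rightarrow> real ^ 'm ^ 'm::finite"
  assumes H: "continuous_on S H" and nz: "\<And>x. x \<in> S \<Longrightarrow> det (H x) \<noteq> 0"
  shows "continuous_on S (\<lambda>x. matrix_inv (H x))"
proof -
  define h :: "'a \<Rightarrow> real ^ 'm ^ 'm" where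
    "h x = (\<chi> k l. det (\<chi> i j. if j = k then (if i = l then 1 else 0) else H x $ i $ j) / det (H x))" for x
  have c: "continuous_on S (\<lambda>x. H x $ i $ j)" for i j
    by (intro continuous_on_component H)
  have "continuous_on S (\<lambda>x. det (\<chi> i j. if j = k then (if i = l then 1 else 0) else H x $ i $ j))" for k l
    unfolding det_def
  proof (intro continuous_on_sum continuous_on_mult continuous_on_const continuous_on_prod)
    fix p i
    show "continuous_on S (\<lambda>x. (\<chi> i j. if j = k then if i = l then 1 else 0 else H x $ i $ j) $ i $ p i)"
      by (cases "p i = k") (simp_all add: c)
  qed
  moreover have "continuous_on S (\<lambda>x. det (H x))"
    unfolding det_def by (intro continuous_on_sum continuous_on_mult continuous_on_const continuous_on_prod c)
  ultimately have "continuous_on S h"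
    unfolding h_def by (intro continuous_on_vec_lambda continuous_intros) (use nz in auto)
  moreover have "matrix_inv (H x) = h x" if "x \<in> S" for x
  proof -
    have "matrix_inv (H x) $ k $ l = h x $ k $ l" for k l
    proof -
      have "matrix_inv (H x) *v axis l 1 = (\<chi> k. h x $ k $ l)"
        unfolding matrix_inv_mult_eq_iff[OF nz[OF that]] cramer[OF nz[OF that]] h_def
        by (simp add: axis_def vec_eq_iff if_distrib eq_commute cong: if_cong)
      moreover have "(matrix_inv (H x) *v axis l 1) $ k = matrix_inv (H x) $ k $ l"
        by (simp add: matrix_vector_mult_basis column_def)
      ultimately show ?thesis by simp
    qed
    then show ?thesis by (simp add: vec_eq_iff)
  qed
  ultimately show ?thesis by (simp cong: continuous_on_cong)
qed

section \<open>Jacobi's formula\<close>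

text \<open>Row \<open>k\<close> of \<open>B\<close> is the combination of the rows of
  \<open>A\<close> with coefficients \<open>x\<close>, the row \<open>k\<close> of
  \<open>B ** matrix_inv A\<close>. Cramer's lemma for the transpose then multiplies the determinant
  by \<open>x $ k\<close>.\<close>

lemma det_replace_row:
  fixes A B :: "real ^ 'm ^ 'm::finite"
  assumes "det A \<noteq> 0"
  shows "det (\<chi> i j. if i = k then B $ k $ j else A $ i $ j) = det A * (\<Sum>j\<in>UNIV. B $ k $ j * matrix_inv A $ j $ k)"
proof -
  define x where "x = (B ** matrix_inv A) $ k"
  have tr: "transpose A *v x = B $ k"
  proof -
    have "(B ** matrix_inv A) ** A = B"
      by (simp add: matrix_mul_assoc[symmetric] matrix_inv_left_right[OF assms])
    then have "((B ** matrix_inv A) ** A) $ k = B $ k" by simp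
    moreover have "(C ** A) $ k = transpose A *v (C $ k)" for C
      by (simp add: vec_eq_iff matrix_vector_mult_def transpose_def matrix_matrix_mult_def mult.commute)
    ultimately show ?thesis by (simp add: x_def)
  qed
  have "det (\<chi> i j. if i = k then B $ k $ j else A $ i $ j)
      = det (transpose (\<chi> i j. if i = k then B $ k $ j else A $ i $ j))" by (simp add: det_transpose)
  also have "transpose (\<chi> i j. if i = k then B $ k $ j else A $ i $ j)
      = (\<chi> i j. if j = k then (transpose A *v x) $ i else transpose A $ i $ j)"
    unfolding tr by (simp add: transpose_def vec_eq_iff)
  also have "det \<dots> = x $ k * det (transpose A)" by (rule cramer_lemma)
  finally show ?thesis
    by (simp add: det_transpose x_def matrix_matrix_mult_def)
qed

text \<open>The product rule in the Leibniz expansion yields a sum of determinants with one row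
  replaced by its derivative, and \<open>det_replace_row\<close> evaluates each of them.\<close>

lemma has_derivative_det:
  fixes H :: "'a::real_normed_vector \<Rightarrow> real ^ 'm ^ 'm::finite"
  assumes H: "(H has_derivative H') (at z)" and nz: "det (H z) \<noteq> 0"
  shows "((\<lambda>y. det (H y)) has_derivative
    (\<lambda>v. det (H z) * (\<Sum>i\<in>UNIV. \<Sum>j\<in>UNIV. matrix_inv (H z) $ i $ j * H' v $ j $ i))) (at z)"
proof -
  let ?P = "{p. p permutes (UNIV::'m set)}"
  have comp: "((\<lambda>y. H y $ i $ j) has_derivative (\<lambda>v. H' v $ i $ j)) (at z)" for i j
    by (intro bounded_linear.has_derivative[OF bounded_linear_vec_nth] H)
  have "((\<lambda>y. det (H y)) has_derivative
     (\<lambda>v. \<Sum>p\<in>?P. of_int (sign p) * (\<Sum>i\<in>UNIV. H' v $ i $ p i * (\<Prod>j\<in>UNIV - {i}. H z $ j $ p j)))) (at z)"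
    unfolding det_def
    by (rule has_derivative_sum has_derivative_mult_right has_derivative_prod comp)+
  moreover have "(\<Sum>p\<in>?P. of_int (sign p) * (\<Sum>i\<in>UNIV. H' v $ i $ p i * (\<Prod>j\<in>UNIV - {i}. H z $ j $ p j)))
     = det (H z) * (\<Sum>i\<in>UNIV. \<Sum>j\<in>UNIV. matrix_inv (H z) $ i $ j * H' v $ j $ i)" for v
  proof -
    have row: "H' v $ i $ p i * (\<Prod>j\<in>UNIV - {i}. H z $ j $ p j)
      = (\<Prod>j\<in>UNIV. (\<chi> k l. if k = i then H' v $ i $ l else H z $ k $ l) $ j $ p j)" for i p
      by (subst prod.remove[of UNIV i]) (auto intro!: prod.cong)
    have "(\<Sum>p\<in>?P. of_int (sign p) * (\<Sum>i\<in>UNIV. H' v $ i $ p i * (\<Prod>j\<in>UNIV - {i}. H z $ j $ p j)))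
       = (\<Sum>i\<in>UNIV. det (\<chi> k l. if k = i then H' v $ i $ l else H z $ k $ l))"
      unfolding row det_def sum_distrib_left by (rule sum.swap)
    also have "\<dots> = det (H z) * (\<Sum>i\<in>UNIV. \<Sum>j\<in>UNIV. H' v $ i $ j * matrix_inv (H z) $ j $ i)"
      by (simp add: det_replace_row[OF nz] sum_distrib_left)
    also have "(\<Sum>i\<in>UNIV. \<Sum>j\<in>UNIV. H' v $ i $ j * matrix_inv (H z) $ j $ i)
       = (\<Sum>i\<in>UNIV. \<Sum>j\<in>UNIV. matrix_inv (H z) $ i $ j * H' v $ j $ i)"
      by (subst sum.swap) (simp add: mult.commute)
    finally show ?thesis .
  qed
  ultimately show ?thesis by simp
qed

section \<open>Smooth functions\<close>

lemma smooth_on_C1: "smooth_on S f \<Longrightarrow> C1_on S f"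
  unfolding smooth_on_def by blast

lemma smooth_on_fd: "smooth_on S f \<Longrightarrow> smooth_on S (\<lambda>x. fd f x v)"
  unfolding smooth_on_def by (metis Ck_on.simps(2))

lemma Ck_on_subset: "Ck_on k S f \<Longrightarrow> T \<subseteq> S \<Longrightarrow> Ck_on k T f"
  by (induction k arbitrary: f) (auto intro: continuous_on_subset)

lemma smooth_on_subset: "smooth_on S f \<Longrightarrow> T \<subseteq> S \<Longrightarrow> smooth_on T f"
  unfolding smooth_on_def using Ck_on_subset by blast

lemma smooth_on_differentiable: "smooth_on S f \<Longrightarrow> x \<in> S \<Longrightarrow> f differentiable at x"
  by (meson C1_on_differentiable smooth_on_C1)

lemma smooth_on_continuous: "smooth_on S f \<Longrightarrow> continuous_on S f"
  by (meson C1_on_continuous smooth_on_C1)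

section \<open>Symmetry of second derivatives\<close>

text \<open>The mean value theorem is applied in direction \<open>v\<close> to a difference in
  direction \<open>w\<close>, then in direction \<open>w\<close>. The second difference itself does
  not change when \<open>v\<close> and \<open>w\<close> are exchanged.\<close>

lemma second_difference_MVT:
  fixes f :: "'a::real_normed_vector \<Rightarrow> real"
  assumes f: "C1_on S f" and fv: "C1_on S (\<lambda>y. fd f y v)"
    and S: "\<And>a b. 0 \<le> a \<Longrightarrow> a \<le> h \<Longrightarrow> 0 \<le> b \<Longrightarrow> b \<le> h \<Longrightarrow> x + a *\<^sub>R v + b *\<^sub>R w \<in> S" and h: "h > 0"
  obtains a b where "0 \<le> a" "a \<le> h" "0 \<le> b" "b \<le> h"
    "f (x + h *\<^sub>R v + h *\<^sub>R w) - f (x + h *\<^sub>R v) - f (x + h *\<^sub>R w) + f x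
       = h * (h * fd (\<lambda>y. fd f y v) (x + a *\<^sub>R v + b *\<^sub>R w) w)"
proof -
  have d1: "((\<lambda>a. f (x + a *\<^sub>R v + b *\<^sub>R w)) has_real_derivative fd f (x + a *\<^sub>R v + b *\<^sub>R w) v) (at a)"
    if "0 \<le> a" "a \<le> h" "0 \<le> b" "b \<le> h" for a b
  proof -
    have "((\<lambda>a. x + a *\<^sub>R v + b *\<^sub>R w) has_derivative (\<lambda>k. k *\<^sub>R v)) (at a)"
      by (auto intro!: derivative_eq_intros)
    note der = has_derivative_compose[OF this C1_on_fd[OF f S[OF that]]]
    have "(\<lambda>k. fd f (x + a *\<^sub>R v + b *\<^sub>R w) (k *\<^sub>R v)) = (*) (fd f (x + a *\<^sub>R v + b *\<^sub>R w) v)"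
      using linear_cmul[OF linear_fd[OF C1_on_differentiable[OF f S[OF that]]]]
      by (intro ext) (simp add: mult.commute)
    then show ?thesis using der unfolding has_field_derivative_def by metis
  qed
  have d2: "((\<lambda>b. fd f (x + a *\<^sub>R v + b *\<^sub>R w) v) has_real_derivative
      fd (\<lambda>y. fd f y v) (x + a *\<^sub>R v + b *\<^sub>R w) w) (at b)"
    if "0 \<le> a" "a \<le> h" "0 \<le> b" "b \<le> h" for a b
  proof -
    have "((\<lambda>b. x + a *\<^sub>R v + b *\<^sub>R w) has_derivative (\<lambda>k. k *\<^sub>R w)) (at b)"
      by (auto intro!: derivative_eq_intros)
    note der = has_derivative_compose[OF this C1_on_fd[OF fv S[OF that]]]
    have "(\<lambda>k. fd (\<lambda>y. fd f y v) (x + a *\<^sub>R v + b *\<^sub>R w) (k *\<^sub>R w)) = (*) (fd (\<lambda>y. fd f y v) (x + a *\<^sub>R v + b *\<^sub>R w) w)"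
      using linear_cmul[OF linear_fd[OF C1_on_differentiable[OF fv S[OF that]]]]
      by (intro ext) (simp add: mult.commute)
    then show ?thesis using der unfolding has_field_derivative_def by metis
  qed
  define q where "q a = f (x + a *\<^sub>R v + h *\<^sub>R w) - f (x + a *\<^sub>R v)" for a
  have "\<exists>a. 0 < a \<and> a < h \<and> q h - q 0 = (h - 0) * (fd f (x + a *\<^sub>R v + h *\<^sub>R w) v - fd f (x + a *\<^sub>R v) v)"
    unfolding q_def
  proof (rule MVT2[OF h])
    fix a assume a: "0 \<le> a" "a \<le> h"
    show "((\<lambda>a. f (x + a *\<^sub>R v + h *\<^sub>R w) - f (x + a *\<^sub>R v)) has_real_derivative
        fd f (x + a *\<^sub>R v + h *\<^sub>R w) v - fd f (x + a *\<^sub>R v) v) (at a)"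
      using DERIV_diff[OF d1[OF a, of h] d1[OF a, of 0]] h by simp
  qed
  then obtain a where a: "0 < a" "a < h" "q h - q 0 = h * (fd f (x + a *\<^sub>R v + h *\<^sub>R w) v - fd f (x + a *\<^sub>R v) v)"
    by auto
  have "\<exists>b. 0 < b \<and> b < h \<and> fd f (x + a *\<^sub>R v + h *\<^sub>R w) v - fd f (x + a *\<^sub>R v + 0 *\<^sub>R w) v
     = (h - 0) * fd (\<lambda>y. fd f y v) (x + a *\<^sub>R v + b *\<^sub>R w) w"
    by (rule MVT2[OF h]) (use d2 a in auto)
  then obtain b where b: "0 < b" "b < h"
    "fd f (x + a *\<^sub>R v + h *\<^sub>R w) v - fd f (x + a *\<^sub>R v) v = h * fd (\<lambda>y. fd f y v) (x + a *\<^sub>R v + b *\<^sub>R w) w"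
    by auto
  show thesis
    by (rule that[of a b]) (use a b in \<open>auto simp: q_def\<close>)
qed

text \<open>Both mixed derivatives, taken at suitable points of a small parallelogram, equal the
  same second difference quotient. By continuity each stays within half the supposed gap of its
  value at \<open>x\<close>, which is impossible if the gap is positive.\<close>

lemma symmetric_second_derivative_real:
  fixes f :: "'a::real_normed_vector \<Rightarrow> real"
  assumes S: "open S" "x \<in> S" and f: "C1_on S f"
    and fv: "C1_on S (\<lambda>y. fd f y v)" and fw: "C1_on S (\<lambda>y. fd f y w)"
  shows "fd (\<lambda>y. fd f y v) x w = fd (\<lambda>y. fd f y w) x v"
proof (rule ccontr)
  define P where "P y = fd (\<lambda>y. fd f y v) y w" for y
  define Q where "Q y = fd (\<lambda>y. fd f y w) y v" for y
  assume "\<not> ?thesis"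
  then have e: "\<bar>P x - Q x\<bar> / 2 > 0" (is "?e > 0") by (simp add: P_def Q_def)
  have cP: "isCont P x" "isCont Q x"
    using C1_on_continuous_fd[OF fv] C1_on_continuous_fd[OF fw] S
    unfolding P_def[abs_def] Q_def[abs_def] by (simp_all add: continuous_on_eq_continuous_at)
  obtain d1 where d1: "d1 > 0" "\<And>y. dist y x < d1 \<Longrightarrow> \<bar>P y - P x\<bar> < ?e"
    using cP(1) e unfolding continuous_at_eps_delta dist_real_def by blast
  obtain d2 where d2: "d2 > 0" "\<And>y. dist y x < d2 \<Longrightarrow> \<bar>Q y - Q x\<bar> < ?e"
    using cP(2) e unfolding continuous_at_eps_delta dist_real_def by blast
  obtain d3 where d3: "d3 > 0" "ball x d3 \<subseteq> S" using S open_contains_ball by blast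
  define d where "d = min d1 (min d2 d3)"
  have d: "d > 0" using d1 d2 d3 by (simp add: d_def)
  \<comment> \<open>Small enough that the whole parallelogram with sides \<open>h v\<close> and
    \<open>h w\<close> lies within distance \<open>d\<close> of \<open>x\<close>; the summand 1
    keeps the denominator positive and the inequality strict.\<close>
  define h where "h = d / (1 + norm v + norm w)"
  have N: "1 + norm v + norm w > 0" by (smt (verit) norm_ge_zero)
  have h: "h > 0" using d N by (simp add: h_def)
  have near: "norm (a *\<^sub>R v + b *\<^sub>R w) < d" if "0 \<le> a" "a \<le> h" "0 \<le> b" "b \<le> h" for a b
  proof -
    have "norm (a *\<^sub>R v + b *\<^sub>R w) \<le> a * norm v + b * norm w"
      using that by (intro norm_triangle_le) simp
    also have "\<dots> \<le> h * norm v + h * norm w"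
      using that by (intro add_mono mult_right_mono) auto
    also have "\<dots> < h * (1 + norm v + norm w)" using h by (simp add: algebra_simps)
    also have "\<dots> = d" using N by (simp add: h_def)
    finally show ?thesis .
  qed
  have nearS: "x + a *\<^sub>R v + b *\<^sub>R w \<in> S" "x + b *\<^sub>R w + a *\<^sub>R v \<in> S" "\<bar>P (x + a *\<^sub>R v + b *\<^sub>R w) - P x\<bar> < ?e"
     "\<bar>Q (x + b *\<^sub>R w + a *\<^sub>R v) - Q x\<bar> < ?e"
    if "0 \<le> a" "a \<le> h" "0 \<le> b" "b \<le> h" for a b
  proof -
    have n: "dist (x + (a *\<^sub>R v + b *\<^sub>R w)) x < d" using near[OF that] by (simp add: dist_norm)
    then show "x + a *\<^sub>R v + b *\<^sub>R w \<in> S" using d3 by (auto simp: d_def ball_def dist_commute add.assoc)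
    then show "x + b *\<^sub>R w + a *\<^sub>R v \<in> S" by (simp add: add_ac)
    show "\<bar>P (x + a *\<^sub>R v + b *\<^sub>R w) - P x\<bar> < ?e" using d1(2) n by (simp add: d_def add.assoc)
    show "\<bar>Q (x + b *\<^sub>R w + a *\<^sub>R v) - Q x\<bar> < ?e" using d2(2) n by (simp add: d_def add_ac)
  qed
  obtain a b where 1: "0 \<le> a" "a \<le> h" "0 \<le> b" "b \<le> h"
    "f (x + h *\<^sub>R v + h *\<^sub>R w) - f (x + h *\<^sub>R v) - f (x + h *\<^sub>R w) + f x = h * (h * P (x + a *\<^sub>R v + b *\<^sub>R w))"
    using second_difference_MVT[OF f fv nearS(1) h, folded P_def] by blast
  have S2: "x + a *\<^sub>R w + b *\<^sub>R v \<in> S" if "0 \<le> a" "a \<le> h" "0 \<le> b" "b \<le> h" for a b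
    using nearS(2)[of b a] that by blast
  obtain a' b' where 2: "0 \<le> a'" "a' \<le> h" "0 \<le> b'" "b' \<le> h"
    "f (x + h *\<^sub>R w + h *\<^sub>R v) - f (x + h *\<^sub>R w) - f (x + h *\<^sub>R v) + f x = h * (h * Q (x + a' *\<^sub>R w + b' *\<^sub>R v))"
    using second_difference_MVT[OF f fw S2 h, folded Q_def] by blast
  have e: "x + h *\<^sub>R w + h *\<^sub>R v = x + h *\<^sub>R v + h *\<^sub>R w"
    by (simp only: add.assoc add.commute[of "h *\<^sub>R w"])
  have "h * (h * P (x + a *\<^sub>R v + b *\<^sub>R w)) = h * (h * Q (x + a' *\<^sub>R w + b' *\<^sub>R v))"
    using 1(5) 2(5)[unfolded e] by linarith
  then have "P (x + a *\<^sub>R v + b *\<^sub>R w) = Q (x + a' *\<^sub>R w + b' *\<^sub>R v)"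
    using h by (metis less_irrefl mult_cancel_left)
  moreover have "\<bar>P (x + a *\<^sub>R v + b *\<^sub>R w) - P x\<bar> < ?e" by (rule nearS(3)[OF 1(1-4)])
  moreover have "\<bar>Q (x + a' *\<^sub>R w + b' *\<^sub>R v) - Q x\<bar> < ?e" by (rule nearS(4)[OF 2(3,4,1,2)])
  ultimately show False by (smt (verit) field_sum_of_halves)
qed

lemma symmetric_second_derivative:
  fixes f :: "'a::real_normed_vector \<Rightarrow> 'b::euclidean_space"
  assumes S: "open S" "x \<in> S" and f: "smooth_on S f"
  shows "fd (\<lambda>y. fd f y v) x w = fd (\<lambda>y. fd f y w) x v"
proof (rule euclidean_eqI)
  fix b :: 'b assume "b \<in> Basis"
  have c: "C1_on S f" "C1_on S (\<lambda>y. fd f y u)" for u using f smooth_on_C1 smooth_on_fd by blast+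
  define fb where "fb y = f y \<bullet> b" for y
  have bl: "bounded_linear (\<lambda>z. z \<bullet> b)" by (rule bounded_linear_inner_left)
  have 1: "fd fb y u = fd f y u \<bullet> b" if "y \<in> S" for y u
    unfolding fb_def[abs_def]
    using fd_eqI[OF bounded_linear.has_derivative[OF bl C1_on_fd[OF c(1) that]]] by simp
  have c1: "C1_on S fb" unfolding fb_def[abs_def] by (rule C1_on_linear_compose[OF bl c(1)])
  have c2: "C1_on S (\<lambda>y. fd fb y u)" for u
    by (rule C1_on_cong_open[OF S(1) _ C1_on_linear_compose[OF bl c(2)[of u]]]) (simp add: 1)
  have 2: "fd (\<lambda>y. fd fb y u) x u' = fd (\<lambda>y. fd f y u) x u' \<bullet> b" for u u'
    using fd_cong_open[OF S, of "\<lambda>y. fd fb y u" "\<lambda>y. fd f y u \<bullet> b"] 1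
      fd_eqI[OF bounded_linear.has_derivative[OF bl C1_on_fd[OF c(2)[of u] S(2)]]] by simp
  show "fd (\<lambda>y. fd f y v) x w \<bullet> b = fd (\<lambda>y. fd f y w) x v \<bullet> b"
    using symmetric_second_derivative_real[OF S c1 c2 c2, of v w] by (simp add: 2)
qed

section \<open>Metrics in coordinates\<close>

text \<open>The bilinear form of a matrix, to which the positivity in
  \<open>riemannian_metric\<close> and the value of \<open>inner_along\<close> both unfold.\<close>

definition gip :: "real ^ 'n ^ 'n::finite \<Rightarrow> real ^ 'n \<Rightarrow> real ^ 'n \<Rightarrow> real" where
  "gip A v w = v \<bullet> (A *v w)"

lemma gip_linear_left: "linear (\<lambda>v. gip A v w)"
  unfolding gip_def by (intro linearI) (simp_all add: inner_add_left)

lemma gip_linear_right: "linear (\<lambda>w. gip A v w)"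
  unfolding gip_def
  by (intro linearI) (simp_all add: inner_add_right matrix_vector_right_distrib matrix_vector_mult_scaleR)

lemmas gip_add_left = linear_add[OF gip_linear_left]
  and gip_add_right = linear_add[OF gip_linear_right]
  and gip_diff_left = linear_diff[OF gip_linear_left]
  and gip_diff_right = linear_diff[OF gip_linear_right]
  and gip_scaleR_left = linear_cmul[OF gip_linear_left]
  and gip_scaleR_right = linear_cmul[OF gip_linear_right]
  and gip_sum_left = linear_sum[OF gip_linear_left]
  and gip_sum_right = linear_sum[OF gip_linear_right]
  and gip_zero_left = linear_0[OF gip_linear_left]
  and gip_zero_right = linear_0[OF gip_linear_right]

lemmas gip_simps = gip_add_left gip_add_right gip_diff_left gip_diff_right gip_scaleR_left gip_scaleR_right

lemma gip_axis: "gip A (axis i 1) (axis j 1) = A $ i $ j"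
  unfolding gip_def by (simp add: matrix_vector_mult_basis column_def inner_axis' )

lemma gip_expand: "gip A v w = (\<Sum>i\<in>UNIV. \<Sum>j\<in>UNIV. v $ i * w $ j * A $ i $ j)"
  unfolding gip_def by (simp add: inner_vec_def matrix_vector_mult_def sum_distrib_left algebra_simps)

lemma matrix_eq_gip: "(\<And>v w. gip A v w = gip B v w) \<Longrightarrow> A = B"
  by (metis gip_axis vec_eq_iff)

lemma gip_transpose: "gip (transpose A) v w = gip A w v"
  unfolding gip_expand transpose_def by (subst sum.swap) (simp add: mult_ac)

definition pos_sym :: "real ^ 'n ^ 'n::finite \<Rightarrow> bool" where
  "pos_sym A \<longleftrightarrow> transpose A = A \<and> (\<forall>v. v \<noteq> 0 \<longrightarrow> 0 < gip A v v)"

lemma pos_sym_nonneg: "pos_sym A \<Longrightarrow> 0 \<le> gip A v v"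
  by (cases "v = 0") (auto simp: pos_sym_def less_imp_le gip_zero_left)

lemma pos_sym_eq0: "pos_sym A \<Longrightarrow> gip A v v = 0 \<Longrightarrow> v = 0"
  by (auto simp: pos_sym_def)

lemma pos_sym_commute: "pos_sym A \<Longrightarrow> gip A v w = gip A w v"
  unfolding pos_sym_def by (metis gip_transpose)

lemma pos_sym_det_nz:
  assumes "pos_sym A" shows "det A \<noteq> 0"
proof
  assume "det A = 0"
  then obtain x where "x \<noteq> 0" "A *v x = 0"
    using matrix_left_invertible_ker[of A] invertible_left_inverse[of A] invertible_det_nz[of A] by blast
  then show False using pos_sym_eq0[OF assms, of x] by (simp add: gip_def)
qed

text \<open>The segment from the identity matrix to \<open>A\<close> consists of positive definite
  matrices, so the determinant has no zero on it and keeps the sign it has at the identity.\<close>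

lemma pos_sym_det_pos:
  assumes A: "pos_sym A" shows "det A > 0"
proof (rule ccontr)
  assume neg: "\<not> det A > 0"
  define B where "B t = (1 - t) *\<^sub>R mat 1 + t *\<^sub>R A" for t :: real
  have pB: "pos_sym (B t)" if "0 \<le> t" "t \<le> 1" for t
    unfolding pos_sym_def
  proof (intro conjI allI impI)
    show "transpose (B t) = B t"
      using A by (simp add: B_def pos_sym_def transpose_def vec_eq_iff mat_def)
    fix v :: "real ^ 'a" assume v: "v \<noteq> 0"
    have "gip (B t) v v = (1 - t) * (v \<bullet> v) + t * gip A v v"
      unfolding B_def gip_def
      by (simp add: matrix_vector_mult_add_rdistrib scaleR_matrix_vector_assoc[symmetric] inner_add_right)
    moreover have "v \<bullet> v > 0" "gip A v v > 0" using v A by (auto simp: pos_sym_def)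
    ultimately show "0 < gip (B t) v v"
      using that by (cases "t = 0") (auto intro!: add_nonneg_pos mult_nonneg_nonneg)
  qed
  have "continuous_on {0..1} (\<lambda>t. det (B t))"
    unfolding det_def B_def
    by (intro continuous_on_sum continuous_on_mult continuous_on_const continuous_on_prod)
      (simp, intro continuous_intros)
  moreover have "det (B 0) = 1" "det (B 1) = det A" by (simp_all add: B_def)
  ultimately obtain t where "0 \<le> t" "t \<le> 1" "det (B t) = 0"
    using IVT2'[of "\<lambda>t. det (B t)" 1 0 0] neg by auto
  then show False using pos_sym_det_nz[OF pB] by blast
qed

lemma pos_sym_inverse_symmetric:
  assumes "pos_sym A" shows "matrix_inv A $ i $ j = matrix_inv A $ j $ i"
proof -
  note inv = matrix_inv_left_right[OF pos_sym_det_nz[OF assms]]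
  have "transpose (matrix_inv A) ** A = mat 1"
    using arg_cong[OF inv(2), of transpose] assms by (simp add: matrix_transpose_mul pos_sym_def)
  then have "transpose (matrix_inv A) = matrix_inv A"
    using inv by (metis matrix_mul_assoc matrix_mul_lid matrix_mul_rid)
  then show ?thesis by (metis (no_types, lifting) transpose_def vec_lambda_beta)
qed

lemma Cauchy_Schwarz_gip:
  assumes A: "pos_sym A" shows "(gip A v w)\<^sup>2 \<le> gip A v v * gip A w w"
proof (cases "w = 0")
  case False
  then have w: "gip A w w > 0" using A by (simp add: pos_sym_def)
  define r where "r = gip A v w / gip A w w"
  have "0 \<le> gip A (v - r *\<^sub>R w) (v - r *\<^sub>R w)" by (rule pos_sym_nonneg[OF A])
  also have "\<dots> = gip A v v - (gip A v w)\<^sup>2 / gip A w w"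
    using w pos_sym_commute[OF A, of w v] by (simp add: gip_simps r_def field_simps power2_eq_square)
  finally show ?thesis using w by (simp add: field_simps)
qed (simp add: gip_zero_right gip_zero_left)

text \<open>Christoffel symbols involve one derivative of the metric, so C1 is the regularity
  carried for metrics in coordinates.\<close>

definition metric_on :: "(real ^ 'n::finite) set \<Rightarrow> (real ^ 'n \<Rightarrow> real ^ 'n ^ 'n) \<Rightarrow> bool" where
  "metric_on V G \<longleftrightarrow> open V \<and> C1_on V G \<and> (\<forall>y\<in>V. pos_sym (G y))"

lemma metric_onD:
  assumes "metric_on V G"
  shows "open V" "C1_on V G" "y \<in> V \<Longrightarrow> pos_sym (G y)" "y \<in> V \<Longrightarrow> G differentiable at y"
  using assms C1_on_differentiable unfolding metric_on_def by (blast, blast, blast, blast)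

text \<open>Transposition is linear and fixes \<open>G\<close> on \<open>V\<close>, so it fixes the
  derivative of \<open>G\<close>.\<close>

lemma metric_on_fd_symmetric:
  assumes G: "metric_on V G" and y: "y \<in> V"
  shows "gip (fd G y u) a b = gip (fd G y u) b a"
proof -
  note d = has_derivative_fd[OF metric_onD(4)[OF G y]]
  have bl: "bounded_linear (transpose :: real ^ 'a ^ 'a \<Rightarrow> real ^ 'a ^ 'a)"
    by (rule linear_conv_bounded_linear[THEN iffD1]) (auto intro!: linearI simp: transpose_def vec_eq_iff)
  have "fd (\<lambda>y. transpose (G y)) y u = transpose (fd G y u)"
    using fd_eqI[OF bounded_linear.has_derivative[OF bl d]] by simp
  moreover have "fd (\<lambda>y. transpose (G y)) y = fd G y"
    using G y by (intro fd_cong_open[of V]) (auto simp: metric_on_def pos_sym_def)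
  ultimately show ?thesis by (metis gip_transpose)
qed

lemma fd_gip:
  fixes G :: "'a::euclidean_space \<Rightarrow> real ^ 'n ^ 'n::finite"
  assumes "G differentiable at z" "Y1 differentiable at z" "Y2 differentiable at z"
  shows "fd (\<lambda>y. gip (G y) (Y1 y) (Y2 y)) z u =
    gip (fd G z u) (Y1 z) (Y2 z) + gip (G z) (fd Y1 z u) (Y2 z) + gip (G z) (Y1 z) (fd Y2 z u)"
proof -
  note d = assms[THEN has_derivative_fd]
  have "((\<lambda>y. Y1 y \<bullet> (G y *v Y2 y)) has_derivative
    (\<lambda>u. Y1 z \<bullet> (G z *v fd Y2 z u + fd G z u *v Y2 z) + fd Y1 z u \<bullet> (G z *v Y2 z))) (at z)"
    by (rule has_derivative_inner[OF d(2) bounded_bilinear.FDERIV[OF bounded_bilinear_matrix_vector_mult d(1,3)]])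
  from fd_eqI[OF this] show ?thesis by (simp add: gip_def inner_add_right)
qed

lemma C1_on_gip:
  "C1_on S G \<Longrightarrow> C1_on S Y1 \<Longrightarrow> C1_on S Y2 \<Longrightarrow> C1_on S (\<lambda>y. gip (G y) (Y1 y) (Y2 y))"
  unfolding gip_def by (intro C1_on_inner C1_on_matrix_vector_mult)

lemma continuous_on_gip:
  "continuous_on S G \<Longrightarrow> continuous_on S Y1 \<Longrightarrow> continuous_on S Y2 \<Longrightarrow>
    continuous_on S (\<lambda>y. gip (G y) (Y1 y) (Y2 y))"
  unfolding gip_def
  by (intro continuous_on_inner bounded_bilinear.continuous_on[OF bounded_bilinear_matrix_vector_mult])

section \<open>Christoffel symbols\<close>

lemma sum_rotate3:
  "(\<Sum>i\<in>A. \<Sum>j\<in>B. \<Sum>k\<in>C. f i j k) = (\<Sum>k\<in>C. \<Sum>i\<in>A. \<Sum>j\<in>B. f i j k)"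
proof -
  have "(\<Sum>i\<in>A. \<Sum>j\<in>B. \<Sum>k\<in>C. f i j k) = (\<Sum>i\<in>A. \<Sum>k\<in>C. \<Sum>j\<in>B. f i j k)"
    by (intro sum.cong refl sum.swap)
  also have "\<dots> = (\<Sum>k\<in>C. \<Sum>i\<in>A. \<Sum>j\<in>B. f i j k)" by (rule sum.swap)
  finally show ?thesis .
qed

text \<open>The Koszul formula in coordinates: lowering the index by \<open>G\<close> cancels the
  inverse matrix in the Christoffel symbols. Compatibility, symmetry and the description of the
  second fundamental form are all drawn from it.\<close>

lemma christoffel_inner:
  fixes G :: "real ^ 'n \<Rightarrow> real ^ 'n ^ 'n::finite"
  assumes dG: "G differentiable at y" and nz: "det (G y) \<noteq> 0"
  shows "gip (G y) b (christoffel G y u a) =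
    (gip (fd G y u) a b + gip (fd G y a) u b - gip (fd G y b) u a) / 2"
proof -
  define L where "L b = gip (fd G y u) a b + gip (fd G y a) u b - gip (fd G y b) u a" for b
  define E where "E i = fd G y (axis i 1)" for i
  \<comment> \<open>The symbols of the first kind contracted with \<open>u\<close> and
    \<open>a\<close>; they are the coefficients of the linear form \<open>L\<close>.\<close>
  define c where "c = (\<chi> l. \<Sum>i\<in>UNIV. \<Sum>j\<in>UNIV. (E i $ j $ l + E j $ i $ l - E l $ i $ j) * u $ i * a $ j)"
  have lin: "linear (fd G y)" using dG by (rule linear_fd)
  have fdE: "fd G y u $ j $ l = (\<Sum>i\<in>UNIV. u $ i * E i $ j $ l)" for u j l
    unfolding E_def by (subst linear_vec_expand[OF lin]) simp
  have gfd: "gip (fd G y u) a b = (\<Sum>i\<in>UNIV. \<Sum>j\<in>UNIV. \<Sum>l\<in>UNIV. u $ i * a $ j * b $ l * E i $ j $ l)" for u a b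
    unfolding gip_expand fdE sum_distrib_left by (subst sum_rotate3) (simp add: mult_ac)
  have linL: "linear L"
    unfolding L_def
    by (intro linearI) (simp_all add: gip_simps linear_add[OF lin] linear_cmul[OF lin] gip_def
        matrix_vector_mult_add_rdistrib scaleR_matrix_vector_assoc[symmetric] inner_add_right inner_scaleR_right algebra_simps)
  have cL: "c $ l = L (axis l 1)" for l
  proof -
    have d: "(\<Sum>l'\<in>UNIV. x l' * axis l (1::real) $ l' * z l') = x l * z l" for x z :: "'n \<Rightarrow> real"
      by (subst sum.remove[of UNIV l]) (auto simp: axis_def intro!: sum.neutral)
    have 1: "gip (fd G y u) a (axis l 1) = (\<Sum>i\<in>UNIV. \<Sum>j\<in>UNIV. u $ i * a $ j * E i $ j $ l)" for u a
      unfolding gfd d ..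
    have 2: "gip (fd G y (axis l 1)) u a = (\<Sum>i\<in>UNIV. \<Sum>j\<in>UNIV. u $ i * a $ j * E l $ i $ j)"
      unfolding gip_expand E_def ..
    have 3: "(\<Sum>i\<in>UNIV. \<Sum>j\<in>UNIV. a $ i * u $ j * E i $ j $ l) = (\<Sum>i\<in>UNIV. \<Sum>j\<in>UNIV. a $ j * u $ i * E j $ i $ l)"
      by (rule sum.swap)
    show ?thesis
      unfolding L_def 1 2 3 c_def by (simp add: sum.distrib sum_subtractf algebra_simps)
  qed
  have "christoffel G y u a = (1/2) *\<^sub>R (matrix_inv (G y) *v c)"
  proof -
    have "christoffel G y u a $ k = (1/2) * (\<Sum>l\<in>UNIV. matrix_inv (G y) $ k $ l * c $ l)" for k
    proof -
      have "christoffel G y u a $ k = (1/2) * (\<Sum>i\<in>UNIV. \<Sum>j\<in>UNIV. \<Sum>l\<in>UNIV. matrix_inv (G y) $ k $ l *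
           ((E i $ j $ l + E j $ i $ l - E l $ i $ j) * u $ i * a $ j))"
        unfolding christoffel_def christoffel_symbol_def partial_deriv_def E_def[symmetric]
        by (simp add: sum_distrib_left sum_distrib_right mult_ac)
      also have "\<dots> = (1/2) * (\<Sum>l\<in>UNIV. \<Sum>i\<in>UNIV. \<Sum>j\<in>UNIV. matrix_inv (G y) $ k $ l *
           ((E i $ j $ l + E j $ i $ l - E l $ i $ j) * u $ i * a $ j))"
        by (subst (2) sum.swap, subst sum.swap) simp
      finally show ?thesis by (simp add: c_def sum_distrib_left)
    qed
    then show ?thesis by (simp add: vec_eq_iff matrix_vector_mult_def)
  qed
  then have "G y *v christoffel G y u a = (1/2) *\<^sub>R c"
    by (simp add: matrix_vector_mult_scaleR matrix_vector_mul_assoc matrix_inv_left_right[OF nz])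
  then have "gip (G y) b (christoffel G y u a) = (1/2) * (b \<bullet> c)" by (simp add: gip_def)
  also have "b \<bullet> c = L b"
    by (subst linear_vec_expand[OF linL]) (simp add: inner_vec_def cL)
  finally show ?thesis by (simp add: L_def)
qed

lemma pos_sym_cancel: "pos_sym A \<Longrightarrow> (\<And>b. gip A b v = gip A b w) \<Longrightarrow> v = w"
  using pos_sym_eq0[of A "v - w"] by (simp add: gip_diff_right)

text \<open>Metric compatibility: in the sum of the Koszul formulas for (a, b) and (b, a) the
  derivatives in the directions \<open>a\<close> and \<open>b\<close> cancel.\<close>

lemma christoffel_compat:
  assumes G: "metric_on V G" and y: "y \<in> V"
  shows "gip (fd G y u) a b = gip (G y) (christoffel G y u a) b + gip (G y) a (christoffel G y u b)"
proof -
  note c = christoffel_inner[OF metric_onD(4)[OF G y] pos_sym_det_nz[OF metric_onD(3)[OF G y]]]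
  note s = metric_on_fd_symmetric[OF G y, of u b a]
  show ?thesis
    unfolding pos_sym_commute[OF metric_onD(3)[OF G y], of "christoffel G y u a" b] c s by (simp add: field_simps)
qed

text \<open>Torsion freeness: the Koszul expression is symmetric in \<open>u\<close> and
  \<open>a\<close>, and a positive definite form separates vectors.\<close>

lemma christoffel_commute:
  assumes G: "metric_on V G" and y: "y \<in> V"
  shows "christoffel G y u a = christoffel G y a u"
  by (rule pos_sym_cancel[OF metric_onD(3)[OF G y]])
    (simp add: christoffel_inner[OF metric_onD(4)[OF G y] pos_sym_det_nz[OF metric_onD(3)[OF G y]]]
      metric_on_fd_symmetric[OF G y, of _ u a])

lemma christoffel_linear_left: "linear (\<lambda>u. christoffel G y u a)"
  unfolding christoffel_def
  by (intro linearI) (simp_all add: vec_eq_iff sum.distrib sum_distrib_left algebra_simps)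

lemma continuous_on_christoffel:
  assumes G: "metric_on V G" and f: "continuous_on S f" "f ` S \<subseteq> V" and u: "continuous_on S u" "continuous_on S a"
  shows "continuous_on S (\<lambda>z. christoffel G (f z) (u z) (a z))"
proof -
  have "continuous_on S (\<lambda>z. matrix_inv (G (f z)))"
  proof (rule continuous_on_matrix_inv)
    show "continuous_on S (\<lambda>z. G (f z))"
      by (rule continuous_on_compose2[OF C1_on_continuous[OF metric_onD(2)[OF G]] f])
    show "det (G (f z)) \<noteq> 0" if "z \<in> S" for z
      using f(2) that by (intro pos_sym_det_nz metric_onD(3)[OF G]) auto
  qed
  moreover have "continuous_on S (\<lambda>z. fd G (f z) v)" for v
    using continuous_on_compose2[OF C1_on_continuous_fd[OF metric_onD(2)[OF G]] f] .
  ultimately show ?thesis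
    unfolding christoffel_def christoffel_symbol_def partial_deriv_def
    by (intro continuous_intros u)
qed

section \<open>The covariant Hessian of a map\<close>

text \<open>The coordinate expression of $\nabla_u (T\varphi.v)$ for constant \<open>u\<close> and \<open>v\<close>.\<close>

definition cov_hess ::
  "(real ^ 'n \<Rightarrow> real ^ 'n ^ 'n::finite) \<Rightarrow> ('z::real_normed_vector \<Rightarrow> real ^ 'n) \<Rightarrow> 'z \<Rightarrow> 'z \<Rightarrow> 'z \<Rightarrow> real ^ 'n" where
  "cov_hess G \<phi> u v z = fd (\<lambda>y. fd \<phi> y v) z u + christoffel G (\<phi> z) (fd \<phi> z u) (fd \<phi> z v)"

text \<open>The Leibniz rule of the connection along a map: compatibility splits the derivative of
  the metric coefficients into the two Christoffel terms.\<close>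

lemma fd_gip_along:
  fixes \<phi> :: "'z::euclidean_space \<Rightarrow> real ^ 'n::finite"
  assumes G: "metric_on V G" and z: "\<phi> z \<in> V" and d: "\<phi> differentiable at z" "Y1 differentiable at z" "Y2 differentiable at z"
  shows "fd (\<lambda>y. gip (G (\<phi> y)) (Y1 y) (Y2 y)) z u =
     gip (G (\<phi> z)) (fd Y1 z u + christoffel G (\<phi> z) (fd \<phi> z u) (Y1 z)) (Y2 z) +
     gip (G (\<phi> z)) (Y1 z) (fd Y2 z u + christoffel G (\<phi> z) (fd \<phi> z u) (Y2 z))"
proof -
  have dG: "(\<lambda>y. G (\<phi> y)) differentiable at z"
    using differentiable_compose[OF metric_onD(4)[OF G z] d(1)] by simp
  have "fd (\<lambda>y. G (\<phi> y)) z u = fd G (\<phi> z) (fd \<phi> z u)"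
    by (rule fd_compose[OF d(1) metric_onD(4)[OF G z]])
  then show ?thesis
    unfolding fd_gip[OF dG d(2,3)] christoffel_compat[OF G z] by (simp add: gip_simps)
      (metis christoffel_compat[OF G z])
qed

text \<open>The domain is an arbitrary Euclidean space, so the formula serves both a map on
  coordinate space and a path seen as one map on space-time.\<close>

lemma fd_metric_components:
  fixes \<phi> :: "'z::euclidean_space \<Rightarrow> real ^ 'n::finite"
  assumes G: "metric_on V G" and \<phi>: "smooth_on W \<phi>" and z: "z \<in> W" "\<phi> z \<in> V"
  shows "fd (\<lambda>y. gip (G (\<phi> y)) (fd \<phi> y a) (fd \<phi> y b)) z u =
     gip (G (\<phi> z)) (cov_hess G \<phi> u a z) (fd \<phi> z b) + gip (G (\<phi> z)) (fd \<phi> z a) (cov_hess G \<phi> u b z)"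
  unfolding cov_hess_def
  by (rule fd_gip_along[OF G z(2) smooth_on_differentiable[OF \<phi> z(1)]
        smooth_on_differentiable[OF smooth_on_fd[OF \<phi>] z(1)] smooth_on_differentiable[OF smooth_on_fd[OF \<phi>] z(1)]])

text \<open>Torsion freeness together with symmetry of second derivatives. With \<open>u\<close> the
  time direction it exchanges time and space derivatives in the first variation.\<close>

lemma cov_hess_commute:
  fixes \<phi> :: "'z::euclidean_space \<Rightarrow> real ^ 'n::finite"
  assumes G: "metric_on V G" and W: "open W" "smooth_on W \<phi>" and z: "z \<in> W" "\<phi> z \<in> V"
  shows "cov_hess G \<phi> u v z = cov_hess G \<phi> v u z"
  unfolding cov_hess_def
  using symmetric_second_derivative[OF W(1) z(1) W(2)] christoffel_commute[OF G z(2)] by simp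

lemma cov_hess_linear:
  fixes \<phi> :: "'z::euclidean_space \<Rightarrow> real ^ 'n::finite"
  assumes \<phi>: "smooth_on W \<phi>" and z: "z \<in> W"
  shows "linear (\<lambda>u. cov_hess G \<phi> u v z)"
proof -
  have 1: "linear (\<lambda>u. fd (\<lambda>y. fd \<phi> y v) z u)"
    by (rule linear_fd[OF smooth_on_differentiable[OF smooth_on_fd[OF \<phi>] z]])
  have 2: "linear (\<lambda>u. christoffel G (\<phi> z) (fd \<phi> z u) (fd \<phi> z v))"
    using linear_compose[OF linear_fd[OF smooth_on_differentiable[OF \<phi> z]] christoffel_linear_left]
    by (simp add: o_def)
  show ?thesis
    unfolding cov_hess_def by (rule linear_compose_add[OF 1 2])
qed

lemma second_derivative_expand:
  fixes f :: "'a::euclidean_space \<Rightarrow> 'b::real_normed_vector"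
  assumes S: "open S" "x \<in> S" and f: "smooth_on S f"
  shows "fd (\<lambda>y. fd f y w) x u = (\<Sum>b\<in>Basis. (w \<bullet> b) *\<^sub>R fd (\<lambda>y. fd f y b) x u)"
proof -
  have "fd (\<lambda>y. fd f y w) x = fd (\<lambda>y. \<Sum>b\<in>Basis. (w \<bullet> b) *\<^sub>R fd f y b) x"
    by (rule fd_cong_open[OF S])
      (rule linear_euclidean_expand[OF linear_fd[OF smooth_on_differentiable[OF f]]])
  also have "\<dots> = (\<lambda>u. \<Sum>b\<in>Basis. (w \<bullet> b) *\<^sub>R fd (\<lambda>y. fd f y b) x u)"
    by (intro fd_eqI has_derivative_sum has_derivative_scaleR_right has_derivative_fd
        smooth_on_differentiable[OF smooth_on_fd[OF f] S(2)])
  finally show ?thesis by simp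
qed

text \<open>The inner direction \<open>fd f y v\<close> moves with \<open>y\<close>; expanding it in
  the basis separates the derivative of that direction from the second derivative of
  \<open>h\<close>.\<close>

lemma second_derivative_compose:
  fixes f :: "'a::euclidean_space \<Rightarrow> 'b::euclidean_space" and h :: "'b \<Rightarrow> 'c::real_normed_vector"
  assumes S: "open S" "x \<in> S" and f: "smooth_on S f"
    and T: "open T" "f ` S \<subseteq> T" and h: "smooth_on T h"
  shows "fd (\<lambda>y. fd (\<lambda>y. h (f y)) y v) x u =
     fd (\<lambda>y. fd h y (fd f x v)) (f x) (fd f x u) + fd h (f x) (fd (\<lambda>y. fd f y v) x u)"
proof -
  have fT: "f y \<in> T" if "y \<in> S" for y using T(2) that by auto
  have eq: "fd (\<lambda>y. h (f y)) y v = (\<Sum>b\<in>Basis. (fd f y v \<bullet> b) *\<^sub>R fd h (f y) b)" if "y \<in> S" for y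
    unfolding fd_compose[OF smooth_on_differentiable[OF f that] smooth_on_differentiable[OF h fT[OF that]]]
    by (rule linear_euclidean_expand[OF linear_fd[OF smooth_on_differentiable[OF h fT[OF that]]]])
  have d1: "((\<lambda>y. fd f y v \<bullet> b) has_derivative (\<lambda>u. fd (\<lambda>y. fd f y v) x u \<bullet> b)) (at x)" for b
    by (intro has_derivative_inner_left has_derivative_fd smooth_on_differentiable[OF smooth_on_fd[OF f] S(2)])
  have d2: "((\<lambda>y. fd h (f y) b) has_derivative (\<lambda>u. fd (\<lambda>y. fd h y b) (f x) (fd f x u))) (at x)" for b
    by (rule has_derivative_compose[OF has_derivative_fd[OF smooth_on_differentiable[OF f S(2)]]
          has_derivative_fd[OF smooth_on_differentiable[OF smooth_on_fd[OF h] fT[OF S(2)]]]])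
  have "fd (\<lambda>y. fd (\<lambda>y. h (f y)) y v) x = fd (\<lambda>y. \<Sum>b\<in>Basis. (fd f y v \<bullet> b) *\<^sub>R fd h (f y) b) x"
    by (rule fd_cong_open[OF S eq])
  also have "\<dots> = (\<lambda>u. \<Sum>b\<in>Basis. (fd f x v \<bullet> b) *\<^sub>R fd (\<lambda>y. fd h y b) (f x) (fd f x u) +
        (fd (\<lambda>y. fd f y v) x u \<bullet> b) *\<^sub>R fd h (f x) b)"
    by (intro fd_eqI has_derivative_sum has_derivative_scaleR d1 d2)
  finally have "fd (\<lambda>y. fd (\<lambda>y. h (f y)) y v) x u = (\<Sum>b\<in>Basis. (fd f x v \<bullet> b) *\<^sub>R fd (\<lambda>y. fd h y b) (f x) (fd f x u) +
        (fd (\<lambda>y. fd f y v) x u \<bullet> b) *\<^sub>R fd h (f x) b)" by simp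
  also have "\<dots> = fd (\<lambda>y. fd h y (fd f x v)) (f x) (fd f x u) + fd h (f x) (fd (\<lambda>y. fd f y v) x u)"
    unfolding second_derivative_expand[OF T(1) fT[OF S(2)] h, of "fd f x v"]
    by (subst linear_euclidean_expand[OF linear_fd[OF smooth_on_differentiable[OF h fT[OF S(2)]]],
          of "fd (\<lambda>y. fd f y v) x u"]) (simp add: sum.distrib)
  finally show ?thesis .
qed

text \<open>The Christoffel term is tensorial, so only the plain second derivative sees the
  reparametrisation. The extra term is tangent to \<open>h\<close> and disappears under normal
  projection.\<close>

lemma cov_hess_precompose:
  fixes f :: "'a::euclidean_space \<Rightarrow> 'b::euclidean_space" and h :: "'b \<Rightarrow> real ^ 'n::finite"
  assumes S: "open S" "x \<in> S" and f: "smooth_on S f"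
    and T: "open T" "f ` S \<subseteq> T" and h: "smooth_on T h"
  shows "cov_hess G (\<lambda>y. h (f y)) u v x =
     cov_hess G h (fd f x u) (fd f x v) (f x) + fd h (f x) (fd (\<lambda>y. fd f y v) x u)"
proof -
  have "fd (\<lambda>y. h (f y)) x v = fd h (f x) (fd f x v)" for v
    using S T by (intro fd_compose smooth_on_differentiable[OF f] smooth_on_differentiable[OF h]) auto
  then show ?thesis unfolding cov_hess_def second_derivative_compose[OF assms] by simp
qed

section \<open>Pulled back inner products and normal projections\<close>

text \<open>Given by entries so that \<open>T\<close> can be a bare function such as a derivative;
  for linear \<open>T\<close> it is the congruence \<open>transpose J ** A ** J\<close> with
  \<open>J = matrix T\<close>.\<close>

definition pb :: "real ^ 'n ^ 'n::finite \<Rightarrow> (real ^ 'm::finite \<Rightarrow> real ^ 'n) \<Rightarrow> real ^ 'm ^ 'm" where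
  "pb A T = (\<chi> i j. gip A (T (axis i 1)) (T (axis j 1)))"

lemma pb_nth: "pb A T $ i $ j = gip A (T (axis i 1)) (T (axis j 1))"
  by (simp add: pb_def)

lemma gip_pb:
  assumes T: "linear T" shows "gip (pb A T) v w = gip A (T v) (T w)"
proof -
  have 1: "gip A (T v) u = (\<Sum>i\<in>UNIV. v $ i * gip A (T (axis i 1)) u)" for u
    by (subst linear_vec_expand[OF T]) (simp add: gip_sum_left gip_scaleR_left)
  have 2: "gip A u (T w) = (\<Sum>j\<in>UNIV. w $ j * gip A u (T (axis j 1)))" for u
    by (subst linear_vec_expand[OF T]) (simp add: gip_sum_right gip_scaleR_right)
  show ?thesis
    unfolding 1 2 gip_expand[of "pb A T"] pb_nth
    by (simp add: sum_distrib_left mult_ac) (rule sum.swap)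
qed

lemma pos_sym_pb:
  assumes A: "pos_sym A" and T: "linear T" "inj T" shows "pos_sym (pb A T)"
  unfolding pos_sym_def
proof (intro conjI allI impI)
  show "transpose (pb A T) = pb A T"
    by (rule matrix_eq_gip) (simp add: gip_transpose gip_pb[OF T(1)] pos_sym_commute[OF A])
  fix v :: "real ^ 'b" assume "v \<noteq> 0"
  then have "T v \<noteq> 0" using T linear_injective_0[OF T(1)] by blast
  then show "0 < gip (pb A T) v v" using A by (simp add: gip_pb[OF T(1)] pos_sym_def)
qed

text \<open>Expresses injectivity by a nonvanishing determinant, an open condition. This yields
  spatial injectivity of a local extension of the path at times outside the unit interval.\<close>

lemma pos_sym_pb_imp_inj:
  assumes "det (pb A T) \<noteq> 0" and T: "linear T" shows "inj T"
proof -
  have "v = 0" if "T v = 0" for v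
  proof -
    have "(pb A T *v v) $ i = 0" for i
    proof -
      have "(pb A T *v v) $ i = gip (pb A T) (axis i 1) v" by (simp add: gip_def inner_axis')
      then show ?thesis by (simp add: gip_pb[OF T] that gip_zero_right)
    qed
    then have "pb A T *v v = 0" by (simp add: vec_eq_iff)
    then show ?thesis by (metis assms(1) matrix_inv_mult_eq_iff matrix_vector_mult_0_right)
  qed
  then show ?thesis using T by (simp add: linear_injective_0)
qed

lemma matrix_apply: "linear T \<Longrightarrow> matrix T *v x = T x" for T :: "real ^ 'm::finite \<Rightarrow> real ^ 'n::finite"
  by (metis matrix_vector_mul(2))

lemma matrix_congruence_pb:
  assumes T: "linear T" shows "transpose (matrix T) ** A ** matrix T = pb A T"
proof (rule matrix_eq_gip)
  fix v w
  have tr: "v \<bullet> (transpose (matrix T) *v z) = (matrix T *v v) \<bullet> z" for z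
    by (metis dot_lmul_matrix inner_commute transpose_matrix_vector)
  have "gip (transpose (matrix T) ** A ** matrix T) v w = v \<bullet> (transpose (matrix T) *v (A *v (matrix T *v w)))"
    by (simp add: gip_def matrix_vector_mul_assoc[symmetric] del: transpose_matrix_vector)
  also have "\<dots> = gip A (T v) (T w)"
    unfolding tr gip_def matrix_apply[OF T] ..
  finally show "gip (transpose (matrix T) ** A ** matrix T) v w = gip (pb A T) v w"
    by (simp add: gip_pb[OF T])
qed

lemma pb_compose: "linear T \<Longrightarrow> linear L \<Longrightarrow> pb A (\<lambda>v. T (L v)) = pb (pb A T) L"
  unfolding pb_def[of _ L] pb_def[of _ "\<lambda>v. T (L v)"] by (simp add: gip_pb)

lemma det_pb:
  fixes L :: "real ^ 'm::finite \<Rightarrow> real ^ 'm"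
  assumes "linear L" shows "det (pb A L) = (det (matrix L))\<^sup>2 * det A"
  unfolding matrix_congruence_pb[OF assms, symmetric]
  by (simp add: det_mul det_transpose power2_eq_square)

text \<open>The condition under the description operator in \<open>normal_part\<close>, isolated for
  a single inner product and a single linear map.\<close>

definition is_nproj :: "real ^ 'n ^ 'n::finite \<Rightarrow> (real ^ 'm::finite \<Rightarrow> real ^ 'n) \<Rightarrow> real ^ 'n \<Rightarrow> real ^ 'n \<Rightarrow> bool" where
  "is_nproj A T h w \<longleftrightarrow> (\<exists>X. h = T X + w) \<and> (\<forall>Y. gip A w (T Y) = 0)"

text \<open>Solution of the normal equations with Gram matrix \<open>pb A T\<close>: the coordinates
  of the orthogonal projection of \<open>h\<close> onto the image of \<open>T\<close>.\<close>

definition tcoord :: "real ^ 'n ^ 'n::finite \<Rightarrow> (real ^ 'm::finite \<Rightarrow> real ^ 'n) \<Rightarrow> real ^ 'n \<Rightarrow> real ^ 'm" where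
  "tcoord A T h = matrix_inv (pb A T) *v (\<chi> i. gip A (T (axis i 1)) h)"

definition nproj :: "real ^ 'n ^ 'n::finite \<Rightarrow> (real ^ 'm::finite \<Rightarrow> real ^ 'n) \<Rightarrow> real ^ 'n \<Rightarrow> real ^ 'n" where
  "nproj A T h = h - T (tcoord A T h)"

text \<open>The difference of two candidates is both tangent and normal, hence orthogonal to
  itself.\<close>

lemma is_nproj_unique:
  assumes A: "pos_sym A" and T: "linear T" and w: "is_nproj A T h w" "is_nproj A T h w'"
  shows "w = w'"
proof -
  obtain X where X: "h = T X + w" using w(1) unfolding is_nproj_def by blast
  obtain X' where X': "h = T X' + w'" using w(2) unfolding is_nproj_def by blast
  have "w = h - T X" "w' = h - T X'" using X X' by (metis add_diff_cancel_left')+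
  then have "w - w' = T (X' - X)" by (simp add: linear_diff[OF T])
  then have "gip A (w - w') (w - w') = gip A (w - w') (T (X' - X))" by simp
  also have "\<dots> = 0" using w by (simp add: gip_diff_left is_nproj_def)
  finally show ?thesis using pos_sym_eq0[OF A] by (metis eq_iff_diff_eq_0)
qed

lemma is_nproj_nproj:
  assumes A: "pos_sym A" and T: "linear T" "inj T"
  shows "is_nproj A T h (nproj A T h)"
  unfolding is_nproj_def
proof (intro conjI allI exI)
  show "h = T (tcoord A T h) + nproj A T h" by (simp add: nproj_def)
  fix Y
  have "pb A T *v tcoord A T h = (\<chi> i. gip A (T (axis i 1)) h)"
    using matrix_inv_mult_eq_iff[OF pos_sym_det_nz[OF pos_sym_pb[OF A T]]] by (auto simp: tcoord_def)
  then have "gip (pb A T) Y (tcoord A T h) = Y \<bullet> (\<chi> i. gip A (T (axis i 1)) h)" by (simp add: gip_def)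
  also have "\<dots> = gip A (T Y) h"
    unfolding linear_vec_expand[OF T(1), of Y] by (simp add: inner_vec_def gip_sum_left gip_scaleR_left)
  finally show "gip A (nproj A T h) (T Y) = 0"
    by (simp add: nproj_def gip_simps gip_pb[OF T(1)] pos_sym_commute[OF A, of _ "T Y"])
qed

lemma is_nproj_iff:
  assumes A: "pos_sym A" and T: "linear T" "inj T"
  shows "is_nproj A T h w \<longleftrightarrow> w = nproj A T h"
  using is_nproj_nproj[OF assms] is_nproj_unique[OF A T(1)] by blast

lemma tcoord_eqI:
  assumes A: "pos_sym A" and T: "linear T" "inj T" and "T X = h - nproj A T h"
  shows "X = tcoord A T h"
  using assms(4) T(2) by (simp add: nproj_def inj_eq)

lemma nproj_linear:
  assumes A: "pos_sym A" and T: "linear T" "inj T"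
  shows "linear (nproj A T)"
proof (rule linearI)
  fix x y r
  show "nproj A T (x + y) = nproj A T x + nproj A T y"
  proof (rule is_nproj_iff[OF assms, THEN iffD1, symmetric])
    have "x + y = T (tcoord A T x + tcoord A T y) + (nproj A T x + nproj A T y)"
      by (simp add: nproj_def linear_add[OF T(1)])
    then show "is_nproj A T (x + y) (nproj A T x + nproj A T y)"
      using is_nproj_nproj[OF assms, of x] is_nproj_nproj[OF assms, of y]
      unfolding is_nproj_def gip_add_left by auto
  qed
  show "nproj A T (r *\<^sub>R x) = r *\<^sub>R nproj A T x"
  proof (rule is_nproj_iff[OF assms, THEN iffD1, symmetric])
    have "r *\<^sub>R x = T (r *\<^sub>R tcoord A T x) + r *\<^sub>R nproj A T x"
      by (simp add: nproj_def linear_cmul[OF T(1)] scaleR_diff_right)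
    then show "is_nproj A T (r *\<^sub>R x) (r *\<^sub>R nproj A T x)"
      using is_nproj_nproj[OF assms, of x] unfolding is_nproj_def gip_scaleR_left by auto
  qed
qed

lemma nproj_tangent:
  assumes A: "pos_sym A" and T: "linear T" "inj T"
  shows "nproj A T (T Y) = 0"
  by (rule is_nproj_iff[OF assms, THEN iffD1, symmetric]) (auto simp: is_nproj_def gip_zero_left)

text \<open>Composing with a bijection \<open>L\<close> leaves the image of \<open>T\<close>
  unchanged, and the normal part depends on that image only.\<close>

lemma nproj_reparam:
  assumes A: "pos_sym A" and T: "linear T" "inj T" and L: "linear L" "bij L"
  shows "nproj A (\<lambda>v. T (L v)) h = nproj A T h"
proof (rule is_nproj_iff[OF assms(1-3), THEN iffD1])
  have T': "linear (\<lambda>v. T (L v))" "inj (\<lambda>v. T (L v))"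
    using linear_compose[OF L(1) T(1)] inj_compose[OF T(2) bij_is_inj[OF L(2)]] by (simp_all add: o_def)
  have "\<exists>Z. Y = L Z" for Y using L(2) by (metis bij_pointE)
  then show "is_nproj A T h (nproj A (\<lambda>v. T (L v)) h)"
    using is_nproj_nproj[OF A T', of h] unfolding is_nproj_def by metis
qed

lemma tcoord_reparam:
  assumes A: "pos_sym A" and T: "linear T" "inj T" and L: "linear L" "bij L"
  shows "L (tcoord A (\<lambda>v. T (L v)) h) = tcoord A T h"
proof (rule tcoord_eqI[OF assms(1-3)])
  show "T (L (tcoord A (\<lambda>v. T (L v)) h)) = h - nproj A T h"
    unfolding nproj_reparam[OF assms, symmetric] by (simp add: nproj_def)
qed

text \<open>\<open>P\<close> is an isometry from \<open>A\<close> to \<open>A'\<close>, so it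
  carries tangent and normal parts to tangent and normal parts. It will be the derivative of a chart
  change of the target.\<close>

lemma nproj_pushforward:
  assumes A: "pos_sym A" "A = pb A' P" "pos_sym A'" and T: "linear T" "inj T" and P: "linear P" "inj P"
  shows "nproj A' (\<lambda>v. P (T v)) (P h) = P (nproj A T h)"
proof (rule is_nproj_iff[THEN iffD1, symmetric])
  show "linear (\<lambda>v. P (T v))" "inj (\<lambda>v. P (T v))"
    using linear_compose[OF T(1) P(1)] inj_compose[OF P(2) T(2)] by (simp_all add: o_def)
  have "P h = P (T (tcoord A T h)) + P (nproj A T h)"
    by (simp add: nproj_def linear_add[OF P(1), symmetric])
  then show "is_nproj A' (\<lambda>v. P (T v)) (P h) (P (nproj A T h))"
    using is_nproj_nproj[OF A(1) T, of h] unfolding is_nproj_def A(2) gip_pb[OF P(1)] by auto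
qed (rule A(3))

section \<open>The second fundamental form as a normal projection\<close>

text \<open>\<open>L\<close> selects the directions of differentiation: the identity for a map on
  coordinate space, \<open>\<lambda>v. (0, v)\<close> for the spatial directions of
  space-time.\<close>

lemma C1_on_pb:
  fixes \<phi> :: "'z::euclidean_space \<Rightarrow> real ^ 'n::finite" and L :: "real ^ 'm::finite \<Rightarrow> 'z"
  assumes G: "metric_on V G" and \<phi>: "smooth_on W \<phi>" "\<phi> ` W \<subseteq> V"
  shows "C1_on W (\<lambda>z. pb (G (\<phi> z)) (\<lambda>v. fd \<phi> z (L v)))"
proof -
  have "C1_on W (\<lambda>z. G (\<phi> z))"
    by (rule C1_on_compose[OF smooth_on_C1[OF \<phi>(1)] metric_onD(2)[OF G] \<phi>(2)])
  then show ?thesis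
    unfolding pb_def
    by (intro C1_on_vec) (simp add: C1_on_gip smooth_on_C1[OF smooth_on_fd[OF \<phi>(1)]] del: Ck_on.simps)
qed

lemma fd_component2:
  fixes H :: "'z::real_normed_vector \<Rightarrow> real ^ 'm ^ 'm::finite"
  assumes "H differentiable at z"
  shows "fd H z u $ i $ j = fd (\<lambda>y. H y $ i $ j) z u"
proof -
  have "((\<lambda>y. H y $ i $ j) has_derivative (\<lambda>u. fd H z u $ i $ j)) (at z)"
    by (intro bounded_linear.has_derivative[OF bounded_linear_vec_nth] has_derivative_fd assms)
  then show ?thesis by (simp add: fd_eqI)
qed

lemma fd_pb_component:
  fixes \<phi> :: "'z::euclidean_space \<Rightarrow> real ^ 'n::finite" and L :: "real ^ 'm::finite \<Rightarrow> 'z"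
  assumes G: "metric_on V G" and \<phi>: "smooth_on W \<phi>" "\<phi> ` W \<subseteq> V" and z: "z \<in> W"
  shows "fd (\<lambda>z. pb (G (\<phi> z)) (\<lambda>v. fd \<phi> z (L v))) z u $ i $ j =
    gip (G (\<phi> z)) (cov_hess G \<phi> u (L (axis i 1)) z) (fd \<phi> z (L (axis j 1))) +
    gip (G (\<phi> z)) (fd \<phi> z (L (axis i 1))) (cov_hess G \<phi> u (L (axis j 1)) z)"
proof -
  have "\<phi> z \<in> V" using \<phi>(2) z by auto
  then show ?thesis
    unfolding fd_component2[OF C1_on_differentiable[OF C1_on_pb[OF G \<phi>] z]]
    by (simp add: pb_def fd_metric_components[OF G \<phi>(1) z])
qed

lemma second_ff_const:
  "second_ff H G \<phi> (\<lambda>_. u) (\<lambda>_. v) x = cov_hess G \<phi> u v x - fd \<phi> x (christoffel H x u v)"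
proof -
  have "fd (\<lambda>y. y) x u = u" "fd (\<lambda>y. v) x u = 0"
    using fd_eqI[OF has_derivative_ident, of x] fd_eqI[OF has_derivative_const, of v x] by (simp_all add: fun_eq_iff)
  then show ?thesis
    unfolding second_ff_def cov_deriv_def cov_deriv_along_def cov_hess_def by simp
qed

text \<open>The Koszul formula for the pulled back metric shows that its Levi-Civita connection is the
  tangential part of $\nabla_u (T\varphi.v)$.\<close>

lemma second_ff_is_nproj:
  fixes \<phi> :: "real ^ 'm::finite \<Rightarrow> real ^ 'n::finite"
  assumes G: "metric_on V G" and U: "open U" and \<phi>: "smooth_on U \<phi>" "\<phi> ` U \<subseteq> V"
    and H: "\<And>y. y \<in> U \<Longrightarrow> H y = pb (G (\<phi> y)) (fd \<phi> y)"
    and x: "x \<in> U" and inj: "inj (fd \<phi> x)"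
  shows "is_nproj (G (\<phi> x)) (fd \<phi> x) (cov_hess G \<phi> u v x) (second_ff H G \<phi> (\<lambda>_. u) (\<lambda>_. v) x)"
  unfolding is_nproj_def
proof (intro conjI allI exI)
  show "cov_hess G \<phi> u v x = fd \<phi> x (christoffel H x u v) + second_ff H G \<phi> (\<lambda>_. u) (\<lambda>_. v) x"
    by (simp add: second_ff_const)
  fix w
  have xV: "\<phi> x \<in> V" using \<phi>(2) x by auto
  have A: "pos_sym (G (\<phi> x))" by (rule metric_onD(3)[OF G xV])
  have lin: "linear (fd \<phi> x)" by (rule linear_fd[OF smooth_on_differentiable[OF \<phi>(1) x]])
  have "C1_on U (\<lambda>y. pb (G (\<phi> y)) (\<lambda>v. fd \<phi> y v))"
    using C1_on_pb[OF G \<phi>, of "\<lambda>v. v"] by simp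
  then have "C1_on U H" by (rule C1_on_cong_open[OF U H[symmetric], rotated])
  then have dH: "H differentiable at x" using x C1_on_differentiable by blast
  have nz: "det (H x) \<noteq> 0"
    unfolding H[OF x] by (rule pos_sym_det_nz[OF pos_sym_pb[OF A lin inj]])
  have fdH: "gip (fd H x u) a b = gip (G (\<phi> x)) (cov_hess G \<phi> u a x) (fd \<phi> x b) +
      gip (G (\<phi> x)) (fd \<phi> x a) (cov_hess G \<phi> u b x)" for u a b
  proof -
    have d0: "(\<lambda>y. a) differentiable at x" for a :: "real ^ 'm" by simp
    have c0: "fd (\<lambda>y. a) x u = 0" for a :: "real ^ 'm"
      using fd_eqI[OF has_derivative_const, of a x] by (simp add: fun_eq_iff)
    have "gip (fd H x u) a b = fd (\<lambda>y. gip (H y) a b) x u"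
      unfolding fd_gip[OF dH d0 d0] c0 by (simp add: gip_zero_left gip_zero_right)
    also have "fd (\<lambda>y. gip (H y) a b) x = fd (\<lambda>y. gip (G (\<phi> y)) (fd \<phi> y a) (fd \<phi> y b)) x"
      by (rule fd_cong_open[OF U x])
        (simp add: H gip_pb[OF linear_fd[OF smooth_on_differentiable[OF \<phi>(1)]]])
    also have "\<dots> u = gip (G (\<phi> x)) (cov_hess G \<phi> u a x) (fd \<phi> x b) +
      gip (G (\<phi> x)) (fd \<phi> x a) (cov_hess G \<phi> u b x)"
      by (rule fd_metric_components[OF G \<phi>(1) x xV])
    finally show ?thesis .
  qed
  note comm = cov_hess_commute[OF G U \<phi>(1) x xV]
  have "gip (G (\<phi> x)) (fd \<phi> x w) (fd \<phi> x (christoffel H x u v)) = gip (H x) w (christoffel H x u v)"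
    unfolding H[OF x] gip_pb[OF lin] ..
  \<comment> \<open>Each of the three derivatives of \<open>H\<close> in the Koszul formula
    contributes two Hessian terms. By symmetry of the Hessian four of the six cancel, and the other
    two are equal, which absorbs the factor 1/2.\<close>
  also have "\<dots> = gip (G (\<phi> x)) (fd \<phi> x w) (cov_hess G \<phi> u v x)"
    unfolding christoffel_inner[OF dH nz] fdH
      comm[of v u] comm[of w u] comm[of w v] pos_sym_commute[OF A, of _ "fd \<phi> x w"]
      pos_sym_commute[OF A, of "fd \<phi> x v" "cov_hess G \<phi> u w x"]
    by (simp add: pos_sym_commute[OF A, of "fd \<phi> x u"])
  finally show "gip (G (\<phi> x)) (second_ff H G \<phi> (\<lambda>_. u) (\<lambda>_. v) x) (fd \<phi> x w) = 0"
    unfolding second_ff_const gip_diff_left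
    by (simp add: pos_sym_commute[OF A, of _ "fd \<phi> x w"])
qed

text \<open>Trace of the covariant Hessian without its tangential correction; Christoffel symbols of
  the pulled back metric do not occur. The mean curvature is its normal part.\<close>

definition trace_hess :: "(real ^ 'n \<Rightarrow> real ^ 'n ^ 'n::finite) \<Rightarrow> (real ^ 'm::finite \<Rightarrow> real ^ 'n) \<Rightarrow> real ^ 'm \<Rightarrow> real ^ 'n" where
  "trace_hess G \<phi> x = (\<Sum>i\<in>UNIV. \<Sum>j\<in>UNIV.
     matrix_inv (pb (G (\<phi> x)) (fd \<phi> x)) $ i $ j *\<^sub>R cov_hess G \<phi> (axis i 1) (axis j 1) x)"

text \<open>Normal projection is linear and therefore commutes with the trace.\<close>

lemma trace_second_ff:
  fixes \<phi> :: "real ^ 'm::finite \<Rightarrow> real ^ 'n::finite"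
  assumes G: "metric_on V G" and U: "open U" and \<phi>: "smooth_on U \<phi>" "\<phi> ` U \<subseteq> V"
    and H: "\<And>y. y \<in> U \<Longrightarrow> H y = pb (G (\<phi> y)) (fd \<phi> y)"
    and x: "x \<in> U" and inj: "inj (fd \<phi> x)"
  shows "(\<Sum>i\<in>UNIV. \<Sum>j\<in>UNIV. (matrix_inv (H x) $ i $ j) *\<^sub>R
           second_ff H G \<phi> (\<lambda>_. axis i 1) (\<lambda>_. axis j 1) x) = nproj (G (\<phi> x)) (fd \<phi> x) (trace_hess G \<phi> x)"
proof -
  have xV: "\<phi> x \<in> V" using \<phi>(2) x by auto
  have A: "pos_sym (G (\<phi> x))" by (rule metric_onD(3)[OF G xV])
  have lin: "linear (fd \<phi> x)" by (rule linear_fd[OF smooth_on_differentiable[OF \<phi>(1) x]])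
  note nl = nproj_linear[OF A lin inj]
  have "second_ff H G \<phi> (\<lambda>_. u) (\<lambda>_. v) x = nproj (G (\<phi> x)) (fd \<phi> x) (cov_hess G \<phi> u v x)" for u v
    using second_ff_is_nproj[OF assms] is_nproj_iff[OF A lin inj] by blast
  then show ?thesis by (simp add: trace_hess_def linear_sum[OF nl] linear_cmul[OF nl] H[OF x])
qed

text \<open>With \<open>J = matrix L\<close> and \<open>K\<close> the inverse of
  \<open>transpose J ** A ** J\<close>, the product \<open>J ** K ** transpose J\<close> is the
  inverse of \<open>A\<close>: the trace with respect to a metric does not depend on the
  basis.\<close>

lemma trace_reparam:
  fixes L :: "real ^ 'm::finite \<Rightarrow> real ^ 'm" and \<beta> :: "real ^ 'm \<Rightarrow> real ^ 'm \<Rightarrow> 'e::real_normed_vector"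
  assumes L: "linear L" and \<beta>: "\<And>v. linear (\<lambda>u. \<beta> u v)" "\<And>u. linear (\<beta> u)"
    and nz: "det (pb A L) \<noteq> 0"
  shows "(\<Sum>i\<in>UNIV. \<Sum>j\<in>UNIV. matrix_inv (pb A L) $ i $ j *\<^sub>R \<beta> (L (axis i 1)) (L (axis j 1))) =
    (\<Sum>k\<in>UNIV. \<Sum>l\<in>UNIV. matrix_inv A $ k $ l *\<^sub>R \<beta> (axis k 1) (axis l 1))"
proof -
  define J where "J = matrix L"
  define K where "K = matrix_inv (pb A L)"
  have H: "pb A L = transpose J ** A ** J" unfolding J_def by (rule matrix_congruence_pb[OF L, symmetric])
  have nzA: "det A \<noteq> 0" "det J \<noteq> 0" using nz unfolding H det_mul det_transpose by auto
  have "J ** K ** transpose J ** A ** J = J ** (K ** pb A L)"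
    unfolding H by (simp add: matrix_mul_assoc)
  also have "\<dots> = J" unfolding K_def matrix_inv_left_right[OF nz] by simp
  finally have "J ** K ** transpose J ** A = mat 1"
    using matrix_inv_left_right(2)[OF nzA(2)] by (metis matrix_mul_assoc matrix_mul_rid)
  then have JKJ: "J ** K ** transpose J = matrix_inv A"
    using matrix_inv_left_right[OF nzA(1)] by (metis matrix_mul_assoc matrix_mul_lid matrix_mul_rid)
  have "L (axis i 1) $ k = J $ k $ i" for i k
    unfolding J_def matrix_def by simp
  then have \<beta>L: "\<beta> (L (axis i 1)) (L (axis j 1)) = (\<Sum>k\<in>UNIV. \<Sum>l\<in>UNIV. (J $ k $ i * J $ l $ j) *\<^sub>R \<beta> (axis k 1) (axis l 1))" for i j
    unfolding linear_vec_expand[OF \<beta>(1), of "L (axis i 1)"] linear_vec_expand[OF \<beta>(2), of _ "L (axis j 1)"]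
    by (simp add: scaleR_sum_right) (subst sum.swap, simp add: mult.commute)
  have "(\<Sum>i\<in>UNIV. \<Sum>j\<in>UNIV. K $ i $ j *\<^sub>R \<beta> (L (axis i 1)) (L (axis j 1)))
      = (\<Sum>i\<in>UNIV. \<Sum>j\<in>UNIV. \<Sum>k\<in>UNIV. \<Sum>l\<in>UNIV. (J $ k $ i * K $ i $ j * J $ l $ j) *\<^sub>R \<beta> (axis k 1) (axis l 1))"
    unfolding \<beta>L by (simp add: scaleR_sum_right mult_ac)
  also have "\<dots> = (\<Sum>k\<in>UNIV. \<Sum>i\<in>UNIV. \<Sum>j\<in>UNIV. \<Sum>l\<in>UNIV. (J $ k $ i * K $ i $ j * J $ l $ j) *\<^sub>R \<beta> (axis k 1) (axis l 1))"
    by (rule sum_rotate3)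
  also have "\<dots> = (\<Sum>k\<in>UNIV. \<Sum>l\<in>UNIV. \<Sum>i\<in>UNIV. \<Sum>j\<in>UNIV. (J $ k $ i * K $ i $ j * J $ l $ j) *\<^sub>R \<beta> (axis k 1) (axis l 1))"
    by (intro sum.cong refl sum_rotate3)
  also have "\<dots> = (\<Sum>k\<in>UNIV. \<Sum>l\<in>UNIV. (J ** K ** transpose J) $ k $ l *\<^sub>R \<beta> (axis k 1) (axis l 1))"
  proof (intro sum.cong refl)
    fix k l
    have "(J ** K ** transpose J) $ k $ l = (\<Sum>j\<in>UNIV. \<Sum>i\<in>UNIV. J $ k $ i * K $ i $ j * J $ l $ j)"
      by (simp add: matrix_matrix_mult_def transpose_def sum_distrib_right)
    also have "\<dots> = (\<Sum>i\<in>UNIV. \<Sum>j\<in>UNIV. J $ k $ i * K $ i $ j * J $ l $ j)" by (rule sum.swap)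
    finally show "(\<Sum>i\<in>UNIV. \<Sum>j\<in>UNIV. (J $ k $ i * K $ i $ j * J $ l $ j) *\<^sub>R \<beta> (axis k 1) (axis l 1)) =
      (J ** K ** transpose J) $ k $ l *\<^sub>R \<beta> (axis k 1) (axis l 1)"
      by (simp add: scaleR_sum_left)
  qed
  finally show ?thesis unfolding JKJ unfolding K_def .
qed

lemma linear_inj_bij:
  fixes L :: "real ^ 'm::finite \<Rightarrow> real ^ 'm"
  shows "linear L \<Longrightarrow> inj L \<Longrightarrow> bij L"
  by (simp add: bij_def linear_injective_imp_surjective)

lemma cov_hess_linear_right:
  fixes \<phi> :: "'z::euclidean_space \<Rightarrow> real ^ 'n::finite"
  assumes G: "metric_on V G" and W: "open W" "smooth_on W \<phi>" and z: "z \<in> W" "\<phi> z \<in> V"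
  shows "linear (\<lambda>v. cov_hess G \<phi> u v z)"
  using cov_hess_linear[OF W(2) z(1)] unfolding cov_hess_commute[OF assms, of u] .

text \<open>The projection kills the tangent terms of \<open>cov_hess_precompose\<close>, and the
  rest is a trace in another basis.\<close>

lemma trace_hess_precompose:
  fixes \<theta> :: "real ^ 'm::finite \<Rightarrow> real ^ 'm" and \<phi> :: "real ^ 'm \<Rightarrow> real ^ 'n::finite"
  assumes G: "metric_on V G" and S: "open S" "x \<in> S" and \<theta>: "smooth_on S \<theta>"
    and T: "open T" "\<theta> ` S \<subseteq> T" and \<phi>: "smooth_on T \<phi>" and xV: "\<phi> (\<theta> x) \<in> V"
    and inj: "inj (fd \<theta> x)" "inj (fd \<phi> (\<theta> x))"
  shows "nproj (G (\<phi> (\<theta> x))) (fd \<phi> (\<theta> x)) (trace_hess G (\<lambda>y. \<phi> (\<theta> y)) x) =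
    nproj (G (\<phi> (\<theta> x))) (fd \<phi> (\<theta> x)) (trace_hess G \<phi> (\<theta> x))"
proof -
  have xT: "\<theta> x \<in> T" using S T by auto
  note d = smooth_on_differentiable[OF \<theta> S(2)] smooth_on_differentiable[OF \<phi> xT]
  note lin = d[THEN linear_fd]
  have A: "pos_sym (G (\<phi> (\<theta> x)))" by (rule metric_onD(3)[OF G xV])
  note nl = nproj_linear[OF A lin(2) inj(2)]
  have fd: "fd (\<lambda>y. \<phi> (\<theta> y)) x = (\<lambda>v. fd \<phi> (\<theta> x) (fd \<theta> x v))"
    by (intro ext fd_compose d)
  have pbL: "pb (G (\<phi> (\<theta> x))) (fd (\<lambda>y. \<phi> (\<theta> y)) x) = pb (pb (G (\<phi> (\<theta> x))) (fd \<phi> (\<theta> x))) (fd \<theta> x)"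
    unfolding fd by (rule pb_compose[OF lin(2) lin(1)])
  have nz: "det (pb (pb (G (\<phi> (\<theta> x))) (fd \<phi> (\<theta> x))) (fd \<theta> x)) \<noteq> 0"
    by (intro pos_sym_det_nz pos_sym_pb A lin inj)
  have np: "nproj (G (\<phi> (\<theta> x))) (fd \<phi> (\<theta> x)) (cov_hess G (\<lambda>y. \<phi> (\<theta> y)) u v x)
    = nproj (G (\<phi> (\<theta> x))) (fd \<phi> (\<theta> x)) (cov_hess G \<phi> (fd \<theta> x u) (fd \<theta> x v) (\<theta> x))" for u v
    unfolding cov_hess_precompose[OF S \<theta> T \<phi>] linear_add[OF nl] nproj_tangent[OF A lin(2) inj(2)] by simp
  have "(\<Sum>i\<in>UNIV. \<Sum>j\<in>UNIV. matrix_inv (pb (pb (G (\<phi> (\<theta> x))) (fd \<phi> (\<theta> x))) (fd \<theta> x)) $ i $ j *\<^sub>R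
         cov_hess G \<phi> (fd \<theta> x (axis i 1)) (fd \<theta> x (axis j 1)) (\<theta> x)) = trace_hess G \<phi> (\<theta> x)" (is "?t = _")
    unfolding trace_hess_def
    by (rule trace_reparam[OF lin(1) cov_hess_linear[OF \<phi> xT] cov_hess_linear_right[OF G T(1) \<phi> xT xV] nz])
  moreover have "nproj (G (\<phi> (\<theta> x))) (fd \<phi> (\<theta> x)) (trace_hess G (\<lambda>y. \<phi> (\<theta> y)) x) =
      nproj (G (\<phi> (\<theta> x))) (fd \<phi> (\<theta> x)) ?t"
    unfolding trace_hess_def[of G "\<lambda>y. \<phi> (\<theta> y)"] pbL linear_sum[OF nl] linear_cmul[OF nl] np ..
  ultimately show ?thesis by (simp only:)
qed

text \<open>The transformation law of the Christoffel symbols: an isometry between spaces of the same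
  dimension has vanishing second fundamental form.\<close>

lemma christoffel_isometry:
  fixes \<psi> :: "real ^ 'n::finite \<Rightarrow> real ^ 'n"
  assumes G': "metric_on V' G'" and V: "open V" and \<psi>: "smooth_on V \<psi>" "\<psi> ` V \<subseteq> V'"
    and iso: "\<And>y. y \<in> V \<Longrightarrow> G y = pb (G' (\<psi> y)) (fd \<psi> y)"
    and y: "y \<in> V" and inj: "inj (fd \<psi> y)"
  shows "cov_hess G' \<psi> u v y = fd \<psi> y (christoffel G y u v)"
proof -
  have yV: "\<psi> y \<in> V'" using \<psi>(2) y by auto
  define S where "S = second_ff G G' \<psi> (\<lambda>_. u) (\<lambda>_. v) y"
  have "is_nproj (G' (\<psi> y)) (fd \<psi> y) (cov_hess G' \<psi> u v y) S"
    unfolding S_def by (rule second_ff_is_nproj[OF G' V \<psi> iso y inj])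
  \<comment> \<open>Source and target have the same dimension, so the derivative is onto and every
    vector is tangent; the normal vector \<open>S\<close> is then orthogonal to itself.\<close>
  moreover obtain Y where "S = fd \<psi> y Y"
    using linear_inj_bij[OF linear_fd[OF smooth_on_differentiable[OF \<psi>(1) y]] inj] by (metis bij_pointE)
  ultimately have "gip (G' (\<psi> y)) S S = 0" unfolding is_nproj_def by metis
  then have "S = 0" using pos_sym_eq0[OF metric_onD(3)[OF G' yV]] by blast
  then show ?thesis unfolding S_def second_ff_const by simp
qed

text \<open>An isometry between spaces of equal dimension intertwines the connections, so the
  Hessian trace itself, and not only its normal part, transforms as a vector under chart changes of
  the target.\<close>

lemma trace_hess_isometry:
  fixes \<phi> :: "real ^ 'm::finite \<Rightarrow> real ^ 'n::finite" and \<psi> :: "real ^ 'n \<Rightarrow> real ^ 'n"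
  assumes G': "metric_on V' G'" and V: "open V" and \<psi>: "smooth_on V \<psi>" "\<psi> ` V \<subseteq> V'"
    and iso: "\<And>y. y \<in> V \<Longrightarrow> G y = pb (G' (\<psi> y)) (fd \<psi> y)"
    and inj: "inj (fd \<psi> (\<phi> x))"
    and S: "open S" "x \<in> S" and \<phi>: "smooth_on S \<phi>" "\<phi> ` S \<subseteq> V"
  shows "trace_hess G' (\<lambda>y. \<psi> (\<phi> y)) x = fd \<psi> (\<phi> x) (trace_hess G \<phi> x)"
proof -
  have xV: "\<phi> x \<in> V" using S \<phi> by auto
  note d = smooth_on_differentiable[OF \<phi>(1) S(2)] smooth_on_differentiable[OF \<psi>(1) xV]
  note lin = d[THEN linear_fd]
  have c: "cov_hess G' \<psi> a b (\<phi> x) = fd \<psi> (\<phi> x) (christoffel G (\<phi> x) a b)" for a b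
    by (rule christoffel_isometry[OF G' V \<psi> iso xV inj])
  have ch: "cov_hess G' (\<lambda>y. \<psi> (\<phi> y)) u v x = fd \<psi> (\<phi> x) (cov_hess G \<phi> u v x)" for u v
    unfolding cov_hess_precompose[OF S \<phi>(1) V \<phi>(2) \<psi>(1)]
      c cov_hess_def[of G] linear_add[OF lin(2)] by simp
  have "fd (\<lambda>y. \<psi> (\<phi> y)) x = (\<lambda>v. fd \<psi> (\<phi> x) (fd \<phi> x v))"
    by (intro ext fd_compose d)
  then have "pb (G' (\<psi> (\<phi> x))) (fd (\<lambda>y. \<psi> (\<phi> y)) x) = pb (G (\<phi> x)) (fd \<phi> x)"
    by (simp add: iso[OF xV] pb_compose[OF lin(2,1)])
  then show ?thesis
    unfolding trace_hess_def ch by (simp add: linear_sum[OF lin(2)] linear_cmul[OF lin(2)])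
qed

section \<open>The first variation of the volume density\<close>

lemma open_slice: "open W \<Longrightarrow> open {x. (s, x) \<in> W}"
  using open_vimage[of W "\<lambda>x. (s, x)"] by (simp add: vimage_def continuous_on_Pair)

lemma has_derivative_slice:
  fixes f :: "'s::real_normed_vector \<times> 'x::real_normed_vector \<Rightarrow> 'e::real_normed_vector"
  assumes "f differentiable at (s, x)"
  shows "((\<lambda>x. f (s, x)) has_derivative (\<lambda>v. fd f (s, x) (0, v))) (at x)"
proof -
  have "((\<lambda>x. (s, x)) has_derivative (\<lambda>v. (0, v))) (at x)"
    by (intro has_derivative_Pair has_derivative_const has_derivative_ident)
  from has_derivative_compose[OF this has_derivative_fd[OF assms]] show ?thesis .
qed

text \<open>A path in charts, extended to an open subset of space-time with time as first
  coordinate. Injectivity is demanded in the spatial directions only.\<close>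

locale coord_variation =
  fixes V :: "(real ^ 'n::finite) set" and G :: "real ^ 'n \<Rightarrow> real ^ 'n ^ 'n"
    and W :: "(real \<times> (real ^ 'm::finite)) set" and F :: "real \<times> (real ^ 'm) \<Rightarrow> real ^ 'n"
  assumes G: "metric_on V G" and W: "open W" and F: "smooth_on W F" "F ` W \<subseteq> V"
    and immersed: "\<And>z. z \<in> W \<Longrightarrow> inj (\<lambda>v. fd F z (0, v))"
begin

definition "sp z v = fd F z (0, v)"
definition "vel z = fd F z (1, 0)"
definition "gF z = G (F z)"
definition "H z = pb (gF z) (sp z)"
definition "lam z = sqrt (det (H z))"
definition "tang z = tcoord (gF z) (sp z) (vel z)"
definition "nvel z = nproj (gF z) (sp z) (vel z)"
text \<open>Spatial trace of the Hessian of the space-time map \<open>F\<close>, so that it can be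
  compared with mixed time-space Hessian terms; \<open>trace_hess_slice\<close> identifies it with
  the trace for a single time.\<close>

definition "trh z = (\<Sum>i\<in>UNIV. \<Sum>j\<in>UNIV. matrix_inv (H z) $ i $ j *\<^sub>R cov_hess G F (0, axis i 1) (0, axis j 1) z)"

lemma FV: "z \<in> W \<Longrightarrow> F z \<in> V"
  using F by auto

lemma linear_fdF: "z \<in> W \<Longrightarrow> linear (fd F z)"
  by (rule linear_fd[OF smooth_on_differentiable[OF F(1)]])

lemma linear_sp: assumes "z \<in> W" shows "linear (sp z)"
proof -
  have "linear (\<lambda>v. (0::real, v::real ^ 'm))" by (intro linearI) auto
  from linear_compose[OF this linear_fdF[OF assms]] show ?thesis by (simp add: sp_def[abs_def] o_def)
qed

lemma inj_sp: "z \<in> W \<Longrightarrow> inj (sp z)"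
  unfolding sp_def by (rule immersed)

lemma pos_gF: "z \<in> W \<Longrightarrow> pos_sym (gF z)"
  unfolding gF_def by (rule metric_onD(3)[OF G FV])

lemma pos_H: "z \<in> W \<Longrightarrow> pos_sym (H z)"
  unfolding H_def by (intro pos_sym_pb pos_gF linear_sp inj_sp)

lemma lam_pos: "z \<in> W \<Longrightarrow> lam z > 0"
  by (simp add: lam_def pos_sym_det_pos pos_H)

lemma C1_gF: "C1_on W gF"
  unfolding gF_def[abs_def] by (rule C1_on_compose[OF smooth_on_C1[OF F(1)] metric_onD(2)[OF G] F(2)])

lemma C1_fdF: "C1_on W (\<lambda>z. fd F z v)"
  by (rule smooth_on_C1[OF smooth_on_fd[OF F(1)]])

lemma C1_H: "C1_on W H"
  unfolding H_def[abs_def] gF_def sp_def by (rule C1_on_pb[OF G F])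

lemma C1_lam: "C1_on W lam"
  unfolding lam_def[abs_def] by (intro C1_on_sqrt C1_on_det C1_H pos_sym_det_pos pos_H)

lemma C1_tang: "C1_on W tang"
  unfolding tang_def[abs_def] tcoord_def H_def[symmetric]
proof (rule C1_on_solve[OF C1_H])
  show "C1_on W (\<lambda>z. \<chi> i. gip (gF z) (sp z (axis i 1)) (vel z))"
    by (rule C1_on_vec) (simp add: C1_on_gip C1_gF sp_def vel_def C1_fdF del: Ck_on.simps)
qed (simp_all add: pos_sym_det_nz pos_H W)

lemma tang_eq: "z \<in> W \<Longrightarrow> vel z = sp z (tang z) + nvel z"
  by (simp add: nvel_def nproj_def tang_def)

text \<open>Jacobi's formula for the square root of the determinant. The factor 1/2 from the root
  cancels because both Hessian terms in the derivative of \<open>H\<close> have the same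
  trace.\<close>

lemma fd_lam:
  assumes z: "z \<in> W"
  shows "fd lam z u = lam z * (\<Sum>i\<in>UNIV. \<Sum>j\<in>UNIV. matrix_inv (H z) $ i $ j *
     gip (gF z) (cov_hess G F u (0, axis i 1) z) (sp z (axis j 1)))"
proof -
  have dp: "det (H z) > 0" by (rule pos_sym_det_pos[OF pos_H[OF z]])
  define S where "S = (\<Sum>i\<in>UNIV. \<Sum>j\<in>UNIV. matrix_inv (H z) $ i $ j *
     gip (gF z) (cov_hess G F u (0, axis i 1) z) (sp z (axis j 1)))"
  have comp: "fd H z u $ j $ i = gip (gF z) (cov_hess G F u (0, axis j 1) z) (sp z (axis i 1)) +
     gip (gF z) (cov_hess G F u (0, axis i 1) z) (sp z (axis j 1))" for i j
    unfolding H_def[abs_def] gF_def sp_def fd_pb_component[OF G F z]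
    by (simp add: pos_sym_commute[OF pos_gF[OF z, unfolded gF_def], of "fd F z (0, axis j 1)"])
  have sw: "(\<Sum>i\<in>UNIV. \<Sum>j\<in>UNIV. matrix_inv (H z) $ i $ j *
     gip (gF z) (cov_hess G F u (0, axis j 1) z) (sp z (axis i 1))) = S"
    unfolding S_def by (subst sum.swap) (simp add: pos_sym_inverse_symmetric[OF pos_H[OF z]])
  have "(\<Sum>i\<in>UNIV. \<Sum>j\<in>UNIV. matrix_inv (H z) $ i $ j * fd H z u $ j $ i) = 2 * S"
    unfolding comp distrib_left sum.distrib sw by (simp add: S_def)
  then have fdS: "det (H z) * (\<Sum>i\<in>UNIV. \<Sum>j\<in>UNIV. matrix_inv (H z) $ i $ j * fd H z u $ j $ i)
      * (inverse (sqrt (det (H z))) / 2) = det (H z) * (2 * S) * (inverse (lam z) / 2)"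
    by (simp only: lam_def)
  have der: "(lam has_derivative (\<lambda>u. det (H z) * (\<Sum>i\<in>UNIV. \<Sum>j\<in>UNIV. matrix_inv (H z) $ i $ j * fd H z u $ j $ i)
      * (inverse (sqrt (det (H z))) / 2))) (at z)"
    unfolding lam_def[abs_def]
    by (rule has_derivative_real_sqrt[OF dp has_derivative_det[OF C1_on_fd[OF C1_H z] pos_sym_det_nz[OF pos_H[OF z]]]])
  have dl: "det (H z) = lam z * lam z" using dp by (simp add: lam_def)
  have "fd lam z u = det (H z) * (2 * S) * (inverse (lam z) / 2)"
    unfolding fdS[symmetric] by (rule fun_cong[OF fd_eqI[OF der]])
  also have "\<dots> = lam z * S"
    unfolding dl using lam_pos[OF z] by simp
  finally show ?thesis by (simp add: S_def)
qed

text \<open>Exchanging time and space turns the time derivative of the density into a trace of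
  covariant derivatives of the velocity. That trace is found by differentiating the pairings
  \<open>al\<close> of the velocity with the coordinate vectors in two ways and comparing. The
  derivatives of \<open>tang\<close> and of \<open>lam\<close> combine into a divergence; what
  remains pairs \<open>trh\<close> with the normal velocity.\<close>

lemma first_variation:
  assumes z: "z \<in> W"
  shows "fd lam z (1, 0) = (\<Sum>k\<in>UNIV. fd (\<lambda>y. lam y * tang y $ k) z (0, axis k 1)) - lam z * gip (gF z) (trh z) (nvel z)"
proof -
  let ?e = "\<lambda>i. (0::real, axis i (1::real) :: real ^ 'm)"
  define C where "C i j = cov_hess G F (?e i) (?e j) z" for i j
  define D where "D i = sp z (axis i 1)" for i
  define K where "K = matrix_inv (H z)"
  define g where "g = gip (gF z)"
  define Ct where "Ct i = cov_hess G F (?e i) (1, 0) z" for i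
  define al where "al j y = gip (gF y) (vel y) (sp y (axis j 1))" for j y
  have zV: "F z \<in> V" by (rule FV[OF z])
  note comm = cov_hess_commute[OF G W F(1) z zV]
  have gs: "g v w = g w v" for v w unfolding g_def by (rule pos_sym_commute[OF pos_gF[OF z]])
  have Ks: "K $ i $ j = K $ j $ i" for i j unfolding K_def by (rule pos_sym_inverse_symmetric[OF pos_H[OF z]])
  have KH: "(\<Sum>j\<in>UNIV. K $ i $ j * H z $ j $ k) = (if i = k then 1 else 0)" for i k
  proof -
    have "(K ** H z) $ i $ k = (mat 1 :: real ^ 'm ^ 'm) $ i $ k"
      unfolding K_def matrix_inv_left_right(1)[OF pos_sym_det_nz[OF pos_H[OF z]]] ..
    then show ?thesis by (simp add: matrix_matrix_mult_def mat_def)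
  qed
  have dlam: "fd lam z (1, 0) = lam z * (\<Sum>i\<in>UNIV. \<Sum>j\<in>UNIV. K $ i $ j * g (Ct i) (D j))"
    unfolding fd_lam[OF z] K_def g_def Ct_def D_def comm[of "(1, 0)"] ..
  have dlamk: "fd lam z (?e k) = lam z * (\<Sum>i\<in>UNIV. \<Sum>j\<in>UNIV. K $ i $ j * g (C k i) (D j))" for k
    unfolding fd_lam[OF z] K_def g_def C_def D_def ..
  have dal: "fd (al j) z (?e i) = g (Ct i) (D j) + g (vel z) (C i j)" for i j
    unfolding al_def[abs_def] gF_def vel_def sp_def fd_metric_components[OF G F(1) z zV]
    by (simp add: g_def gF_def Ct_def C_def D_def sp_def)
  have dH: "fd H z (?e i) $ j $ k = g (C i j) (D k) + g (D j) (C i k)" for i j k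
    unfolding H_def[abs_def] gF_def sp_def fd_pb_component[OF G F z]
    by (simp add: g_def gF_def C_def D_def sp_def)
  \<comment> \<open>The normal equations that define \<open>tang\<close>.\<close>
  have al_H: "al j y = (\<Sum>k\<in>UNIV. H y $ j $ k * tang y $ k)" if "y \<in> W" for j y
  proof -
    have "H y *v tang y = (\<chi> i. gip (gF y) (sp y (axis i 1)) (vel y))"
      using matrix_inv_mult_eq_iff[OF pos_sym_det_nz[OF pos_H[OF that]]]
      unfolding tang_def tcoord_def H_def by blast
    then have "(H y *v tang y) $ j = gip (gF y) (sp y (axis j 1)) (vel y)" by simp
    then show ?thesis
      by (simp add: al_def matrix_vector_mult_def pos_sym_commute[OF pos_gF[OF that], of "vel y"])
  qed
  have dHt: "H differentiable at z" "tang differentiable at z" "lam differentiable at z"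
    using C1_on_differentiable z C1_H C1_tang C1_lam by blast+
  have dal2: "fd (al j) z u = (\<Sum>k\<in>UNIV. fd H z u $ j $ k * tang z $ k + H z $ j $ k * fd tang z u $ k)" for j u
  proof -
    have "fd (al j) z = fd (\<lambda>y. \<Sum>k\<in>UNIV. H y $ j $ k * tang y $ k) z"
      by (rule fd_cong_open[OF W z al_H])
    also have "\<dots> = (\<lambda>u. \<Sum>k\<in>UNIV. H z $ j $ k * fd tang z u $ k + fd H z u $ j $ k * tang z $ k)"
      by (intro fd_eqI has_derivative_sum has_derivative_mult bounded_linear.has_derivative[OF bounded_linear_vec_nth]
          has_derivative_fd dHt)
    finally show ?thesis by (simp add: add.commute)
  qed
  have tr1: "(\<Sum>i\<in>UNIV. \<Sum>j\<in>UNIV. K $ i $ j * (\<Sum>k\<in>UNIV. H z $ j $ k * fd tang z (?e i) $ k))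
      = (\<Sum>i\<in>UNIV. fd tang z (?e i) $ i)"
  proof (rule sum.cong[OF refl])
    fix i
    have "(\<Sum>j\<in>UNIV. K $ i $ j * (\<Sum>k\<in>UNIV. H z $ j $ k * fd tang z (?e i) $ k))
      = (\<Sum>k\<in>UNIV. (\<Sum>j\<in>UNIV. K $ i $ j * H z $ j $ k) * fd tang z (?e i) $ k)"
      unfolding sum_distrib_left sum_distrib_right by (subst sum.swap) (simp add: mult.assoc)
    also have "\<dots> = fd tang z (?e i) $ i"
      unfolding KH by (simp add: if_distrib[of "\<lambda>x. x * _"] cong: if_cong)
    finally show "(\<Sum>j\<in>UNIV. K $ i $ j * (\<Sum>k\<in>UNIV. H z $ j $ k * fd tang z (?e i) $ k)) = fd tang z (?e i) $ i" .
  qed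
  have spt: "sp z (tang z) = (\<Sum>k\<in>UNIV. tang z $ k *\<^sub>R D k)"
    unfolding D_def by (rule linear_vec_expand[OF linear_sp[OF z]])
  have g_trh: "g (trh z) w = (\<Sum>i\<in>UNIV. \<Sum>j\<in>UNIV. K $ i $ j * g (C i j) w)" for w
    unfolding g_def trh_def K_def C_def by (simp add: gip_sum_left gip_scaleR_left)
  have tr2: "(\<Sum>i\<in>UNIV. \<Sum>j\<in>UNIV. K $ i $ j * (\<Sum>k\<in>UNIV. g (C i j) (D k) * tang z $ k)) = g (trh z) (sp z (tang z))"
    unfolding g_trh spt by (simp add: g_def gip_sum_right gip_scaleR_right mult.commute)
  \<comment> \<open>One of the two Hessian terms in the derivative of \<open>H\<close> rebuilds the
    spatial derivative of the density by \<open>fd_lam\<close>, which supplies the second half of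
    the product rule in the divergence.\<close>
  have tr3: "lam z * (\<Sum>i\<in>UNIV. \<Sum>j\<in>UNIV. K $ i $ j * (\<Sum>k\<in>UNIV. g (D j) (C i k) * tang z $ k))
      = (\<Sum>k\<in>UNIV. fd lam z (?e k) * tang z $ k)"
  proof -
    have "(\<Sum>i\<in>UNIV. \<Sum>j\<in>UNIV. K $ i $ j * (\<Sum>k\<in>UNIV. g (D j) (C i k) * tang z $ k))
       = (\<Sum>k\<in>UNIV. \<Sum>i\<in>UNIV. \<Sum>j\<in>UNIV. K $ i $ j * (g (D j) (C i k) * tang z $ k))"
      unfolding sum_distrib_left by (rule sum_rotate3)
    also have "\<dots> = (\<Sum>k\<in>UNIV. (\<Sum>i\<in>UNIV. \<Sum>j\<in>UNIV. K $ i $ j * g (C k i) (D j)) * tang z $ k)"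
      using comm unfolding C_def by (simp add: sum_distrib_right gs[of "D _"] mult.assoc)
    finally show ?thesis by (simp add: dlamk sum_distrib_left mult_ac)
  qed
  \<comment> \<open>First evaluation, through \<open>al_H\<close>: derivative of \<open>H\<close>
    times \<open>tang\<close> plus \<open>H\<close> times derivative of \<open>tang\<close>.\<close>
  have S: "(\<Sum>i\<in>UNIV. \<Sum>j\<in>UNIV. K $ i $ j * fd (al j) z (?e i)) =
     (\<Sum>i\<in>UNIV. fd tang z (?e i) $ i) + g (trh z) (sp z (tang z)) +
     (\<Sum>i\<in>UNIV. \<Sum>j\<in>UNIV. K $ i $ j * (\<Sum>k\<in>UNIV. g (D j) (C i k) * tang z $ k))"
    unfolding dal2 dH sum.distrib distrib_left distrib_right tr1 tr2 by simp
  \<comment> \<open>Second evaluation, by the Leibniz rule of the connection; the mixed terms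
    \<open>Ct\<close> are those of the time derivative of the density.\<close>
  have S': "(\<Sum>i\<in>UNIV. \<Sum>j\<in>UNIV. K $ i $ j * fd (al j) z (?e i)) =
     (\<Sum>i\<in>UNIV. \<Sum>j\<in>UNIV. K $ i $ j * g (Ct i) (D j)) + g (trh z) (vel z)"
    unfolding dal distrib_left sum.distrib g_trh gs[of "vel z"] ..
  have nv: "g (trh z) (sp z (tang z)) - g (trh z) (vel z) = - g (trh z) (nvel z)"
    unfolding tang_eq[OF z] by (simp add: g_def gip_add_right)
  have e: "(\<Sum>i\<in>UNIV. \<Sum>j\<in>UNIV. K $ i $ j * g (Ct i) (D j)) = (\<Sum>i\<in>UNIV. fd tang z (?e i) $ i) - g (trh z) (nvel z) +
     (\<Sum>i\<in>UNIV. \<Sum>j\<in>UNIV. K $ i $ j * (\<Sum>k\<in>UNIV. g (D j) (C i k) * tang z $ k))"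
    using S S' nv by linarith
  have "fd lam z (1, 0) = lam z * (\<Sum>i\<in>UNIV. fd tang z (?e i) $ i) - lam z * g (trh z) (nvel z) + (\<Sum>k\<in>UNIV. fd lam z (?e k) * tang z $ k)"
    unfolding dlam e tr3[symmetric] by (simp only: distrib_left right_diff_distrib)
  also have "\<dots> = (\<Sum>k\<in>UNIV. fd (\<lambda>y. lam y * tang y $ k) z (?e k)) - lam z * g (trh z) (nvel z)"
  proof -
    have "fd (\<lambda>y. lam y * tang y $ k) z = (\<lambda>u. lam z * fd tang z u $ k + fd lam z u * tang z $ k)" for k
      by (intro fd_eqI has_derivative_mult bounded_linear.has_derivative[OF bounded_linear_vec_nth] has_derivative_fd dHt)
    then show ?thesis by (simp add: sum.distrib sum_distrib_left)
  qed
  finally show ?thesis by (simp add: g_def)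
qed

lemma continuous_gF: "continuous_on W gF"
  by (rule C1_on_continuous[OF C1_gF])

lemma continuous_fdF: "continuous_on W (\<lambda>z. fd F z v)"
  by (rule C1_on_continuous[OF C1_fdF])

lemma continuous_Hinv: "continuous_on W (\<lambda>z. matrix_inv (H z))"
  by (intro continuous_on_matrix_inv C1_on_continuous[OF C1_H] pos_sym_det_nz pos_H)

lemma continuous_trh: "continuous_on W trh"
  unfolding trh_def[abs_def] cov_hess_def
  by (intro continuous_intros continuous_Hinv C1_on_continuous_fd[OF C1_fdF] continuous_fdF
      continuous_on_christoffel[OF G smooth_on_continuous[OF F(1)] F(2)])

lemma continuous_nproj:
  assumes h: "continuous_on W h"
  shows "continuous_on W (\<lambda>z. nproj (gF z) (sp z) (h z))"
proof -
  have "continuous_on W (\<lambda>z. tcoord (gF z) (sp z) (h z))"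
    unfolding tcoord_def H_def[symmetric] sp_def
    by (intro bounded_bilinear.continuous_on[OF bounded_bilinear_matrix_vector_mult] continuous_Hinv
        continuous_on_vec_lambda continuous_on_gip continuous_gF continuous_fdF h)
  then have "continuous_on W (\<lambda>z. sp z (tcoord (gF z) (sp z) (h z)))"
    unfolding sp_def
    by (intro continuous_on_fd_joint[OF smooth_on_C1[OF F(1)]] continuous_intros) auto
  then show ?thesis unfolding nproj_def by (intro continuous_intros h)
qed

lemma continuous_nvel: "continuous_on W nvel"
  unfolding nvel_def[abs_def] vel_def by (intro continuous_nproj continuous_fdF)

subsection \<open>Time slices\<close>

lemma fd_slice_F:
  assumes "(s, x) \<in> W" shows "fd (\<lambda>x. F (s, x)) x = sp (s, x)"
  using fd_eqI[OF has_derivative_slice[OF smooth_on_differentiable[OF F(1) assms]]] by (simp add: sp_def[abs_def])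

lemma cov_hess_slice:
  assumes sx: "(s, x) \<in> W"
  shows "cov_hess G (\<lambda>x. F (s, x)) u v x = cov_hess G F (0, u) (0, v) (s, x)"
proof -
  have "fd (\<lambda>y. fd (\<lambda>x. F (s, x)) y v) x = fd (\<lambda>y. fd F (s, y) (0, v)) x"
    using sx by (intro fd_cong_open[OF open_slice[OF W, of s]]) (auto simp: fd_slice_F sp_def)
  also have "\<dots> = (\<lambda>u. fd (\<lambda>z. fd F z (0, v)) (s, x) (0, u))"
    by (rule fd_eqI[OF has_derivative_slice[OF C1_on_differentiable[OF C1_fdF sx]]])
  finally show ?thesis by (simp add: cov_hess_def fd_slice_F[OF sx] sp_def)
qed

lemma trace_hess_slice:
  assumes sx: "(s, x) \<in> W"
  shows "trace_hess G (\<lambda>x. F (s, x)) x = trh (s, x)"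
  unfolding trace_hess_def trh_def cov_hess_slice[OF sx] fd_slice_F[OF sx] H_def gF_def ..

end

section \<open>Change of variables for an arbitrary finite index type\<close>

text \<open>The library states the change of variables formula for index types of class
  \<^class>\<open>wellorder\<close>. Every finite type has a copy in that class.\<close>

typedef 'a ordered_copy = "UNIV :: 'a set" morphisms of_copy to_copy
  by simp

lemma bij_of_copy: "bij of_copy"
  by (metis UNIV_I bijI' of_copy_inject to_copy_inverse)

instance ordered_copy :: (finite) finite
proof
  show "finite (UNIV :: 'a ordered_copy set)"
    by (subst bij_betw_finite[OF bij_of_copy]) simp
qed

text \<open>Any injection into the naturals will do; the well-order is pulled back along it.\<close>

definition copy_index :: "'a::finite ordered_copy \<Rightarrow> nat" where
  "copy_index = (SOME f. inj f)"

lemma inj_copy_index: "inj (copy_index :: 'a::finite ordered_copy \<Rightarrow> nat)"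
proof -
  obtain f :: "'a ordered_copy \<Rightarrow> nat" where "inj f"
    using finite_imp_inj_to_nat_seg[of "UNIV :: 'a ordered_copy set"] by auto
  then show ?thesis unfolding copy_index_def by (rule someI[of inj])
qed

instantiation ordered_copy :: (finite) wellorder
begin

definition "x \<le> y \<longleftrightarrow> copy_index x \<le> copy_index y" for x y :: "'a ordered_copy"
definition "x < y \<longleftrightarrow> copy_index x < copy_index y" for x y :: "'a ordered_copy"

instance
proof
  fix x y z :: "'a ordered_copy" and P :: "'a ordered_copy \<Rightarrow> bool"
  show "x < y \<longleftrightarrow> x \<le> y \<and> \<not> y \<le> x" "x \<le> x" "x \<le> y \<or> y \<le> x"
    by (auto simp: less_eq_ordered_copy_def less_ordered_copy_def)
  show "x \<le> z" if "x \<le> y" "y \<le> z" using that by (auto simp: less_eq_ordered_copy_def)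
  show "x = y" if "x \<le> y" "y \<le> x"
    by (rule injD[OF inj_copy_index], rule le_antisym[OF that[unfolded less_eq_ordered_copy_def]])
  show "P x" if step: "\<And>x. (\<And>y. y < x \<Longrightarrow> P y) \<Longrightarrow> P x"
  proof -
    have "\<forall>x. copy_index x = n \<longrightarrow> P x" for n
    proof (induction n rule: nat_less_induct)
      case (1 n)
      show ?case
      proof (intro allI impI)
        fix x :: "'a ordered_copy" assume x: "copy_index x = n"
        show "P x"
        proof (rule step)
          fix y assume "y < x"
          then have "copy_index y < n" unfolding x[symmetric] by (rule less_ordered_copy_def[THEN iffD1])
          with 1 show "P y" by blast
        qed
      qed
    qed
    from this[of "copy_index x"] show ?thesis by blast
  qed
qed

end

section \<open>Renaming coordinates: Lebesgue measure and determinants\<close>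

lemma prod_Basis_vec: "(\<Prod>b\<in>(Basis :: (real ^ 'm::finite) set). f b) = (\<Prod>i\<in>UNIV. f (axis i 1))"
proof -
  have "bij_betw (\<lambda>i. axis i 1 :: real ^ 'm) UNIV Basis"
    unfolding bij_betw_def inj_on_def by (auto simp: axis_eq_axis Basis_vec_def)
  from prod.reindex_bij_betw[OF this, of f] show ?thesis by simp
qed

definition reindex :: "('k \<Rightarrow> 'm) \<Rightarrow> real ^ 'm::finite \<Rightarrow> real ^ 'k::finite" where
  "reindex r x = (\<chi> i. x $ r i)"

lemma reindex_nth [simp]: "reindex r x $ i = x $ r i"
  by (simp add: reindex_def)

lemma reindex_linear: "linear (reindex r)"
  by (intro linearI) (simp_all add: vec_eq_iff)

lemma reindex_inverse:
  assumes "bij r" shows "reindex (inv r) (reindex r x) = x" "reindex r (reindex (inv r) y) = y"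
  using assms by (simp_all add: vec_eq_iff bij_is_surj bij_is_inj surj_f_inv_f inv_f_f)

lemma reindex_measurable [measurable]: "reindex r \<in> borel_measurable borel"
  by (intro borel_measurable_continuous_onI linear_continuous_on)
    (simp add: reindex_linear linear_conv_bounded_linear[symmetric])

text \<open>Boxes go to boxes with the same side lengths in another order, and boxes determine
  Lebesgue measure.\<close>

lemma lborel_distr_reindex:
  fixes r :: "'k::finite \<Rightarrow> 'm::finite"
  assumes r: "bij r" shows "distr lborel borel (reindex r) = (lborel :: (real ^ 'k) measure)"
proof (rule lborel_eqI[symmetric])
  fix l u :: "real ^ 'k" assume le: "\<And>b. b \<in> Basis \<Longrightarrow> l \<bullet> b \<le> u \<bullet> b"
  then have le': "l $ i \<le> u $ i" for i using le[of "axis i 1"] by (simp add: inner_axis axis_in_Basis_iff)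
  have "reindex r -` box l u = box (reindex (inv r) l) (reindex (inv r) u)"
    using r by (auto simp: mem_box_cart) (metis bij_inv_eq_iff)+
  then have "emeasure (distr lborel borel (reindex r)) (box l u) = emeasure lborel (box (reindex (inv r) l) (reindex (inv r) u))"
    by (simp add: emeasure_distr)
  also have "\<dots> = (\<Prod>b\<in>Basis. (reindex (inv r) u - reindex (inv r) l) \<bullet> b)"
    by (rule emeasure_lborel_box) (auto simp: Basis_vec_def inner_axis le')
  also have "\<dots> = (\<Prod>b\<in>Basis. (u - l) \<bullet> b)"
    unfolding prod_Basis_vec
    using prod.reindex_bij_betw[OF bij_imp_bij_inv[OF r], of "\<lambda>i. u $ i - l $ i"] by (simp add: inner_axis)
  finally show "emeasure (distr lborel borel (reindex r)) (box l u) = (\<Prod>b\<in>Basis. (u - l) \<bullet> b)" .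
qed simp

lemma emeasure_reindex_image:
  fixes r :: "'k::finite \<Rightarrow> 'm::finite"
  assumes r: "bij r" and A: "A \<in> sets borel"
  shows "reindex r ` A \<in> sets borel" "emeasure lborel (reindex r ` A) = emeasure lborel A"
proof -
  have e: "reindex r ` A = reindex (inv r) -` A"
    using reindex_inverse[OF r] by (auto simp: image_iff) metis
  show "reindex r ` A \<in> sets borel"
    using measurable_sets[OF reindex_measurable A, of "inv r"] unfolding e by simp
  have "emeasure lborel (reindex (inv r) -` A) = emeasure (distr lborel borel (reindex (inv r))) A"
    using A by (simp add: emeasure_distr)
  then show "emeasure lborel (reindex r ` A) = emeasure lborel A"
    unfolding lborel_distr_reindex[OF bij_imp_bij_inv[OF r]] e .
qed

text \<open>Conjugation by \<open>r\<close> is a sign-preserving bijection between the permutations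
  of the two index types.\<close>

lemma det_reindex:
  fixes A :: "real ^ 'm ^ 'm::finite" and r :: "'k::finite \<Rightarrow> 'm"
  assumes r: "bij r" shows "det (\<chi> i j. A $ r i $ r j) = det A"
proof -
  let ?s = "inv r"
  have s: "bij_betw ?s UNIV UNIV" "inj ?s" using bij_imp_bij_inv[OF r] by (auto intro: bij_is_inj)
  define h where "h p = map_permutation UNIV ?s p" for p
  have hp: "h p = ?s \<circ> p \<circ> r" for p
    using s bij_imp_bij_inv[OF r] inv_inv_eq[OF r] by (simp add: h_def map_permutation_def restrict_id_def bij_is_surj fun_eq_iff)
  have bij: "bij_betw h {p. p permutes UNIV} {p. p permutes UNIV}"
  proof (rule bij_betwI[where g="\<lambda>q. r \<circ> q \<circ> ?s"])
    show "h \<in> {p. p permutes UNIV} \<rightarrow> {p. p permutes UNIV}"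
      unfolding hp using r by (auto simp: permutes_univ bij_iff[symmetric] intro!: bij_comp bij_imp_bij_inv)
    show "(\<lambda>q. r \<circ> q \<circ> ?s) \<in> {p. p permutes UNIV} \<rightarrow> {p. p permutes UNIV}"
      using r by (auto simp: permutes_univ bij_iff[symmetric] intro!: bij_comp bij_imp_bij_inv)
  qed (use r in \<open>auto simp: hp fun_eq_iff bij_is_surj surj_f_inv_f bij_is_inj inv_f_f\<close>)
  have "det (\<chi> i j. A $ r i $ r j) = (\<Sum>q\<in>{p. p permutes UNIV}. of_int (sign q) * (\<Prod>i\<in>UNIV. A $ r i $ r (q i)))"
    by (simp add: det_def)
  also have "\<dots> = (\<Sum>p\<in>{p. p permutes UNIV}. of_int (sign (h p)) * (\<Prod>i\<in>UNIV. A $ r i $ r (h p i)))"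
    by (rule sum.reindex_bij_betw[OF bij, symmetric])
  also have "\<dots> = (\<Sum>p\<in>{p. p permutes UNIV}. of_int (sign p) * (\<Prod>i\<in>UNIV. A $ i $ p i))"
  proof (rule sum.cong[OF refl])
    fix p :: "'m \<Rightarrow> 'm" assume "p \<in> {p. p permutes UNIV}"
    then have "sign (h p) = sign p"
      unfolding h_def by (intro sign_map_permutation s) auto
    moreover have "(\<Prod>i\<in>UNIV. A $ r i $ r (h p i)) = (\<Prod>i\<in>UNIV. A $ i $ p i)"
      using prod.reindex_bij_betw[OF r, of "\<lambda>i. A $ i $ p i"] r by (simp add: hp bij_is_surj surj_f_inv_f)
    ultimately show "of_int (sign (h p)) * (\<Prod>i\<in>UNIV. A $ r i $ r (h p i)) = of_int (sign p) * (\<Prod>i\<in>UNIV. A $ i $ p i)"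
      by simp
  qed
  finally show ?thesis by (simp add: det_def)
qed

section \<open>Measure of images under injective differentiable maps\<close>

text \<open>The real-valued formula settles images of finite measure. If the image has infinite
  measure, a finite integral would give it finite measure by the same equivalence, so both sides are
  infinite.\<close>

lemma emeasure_differentiable_image_wellorder:
  fixes f :: "real ^ 'n::{finite,wellorder} \<Rightarrow> real ^ 'n::_"
  assumes S: "S \<in> sets borel" "f ` S \<in> sets borel"
    and f: "\<And>x. x \<in> S \<Longrightarrow> (f has_derivative f' x) (at x within S)" "inj_on f S"
    and m: "(\<lambda>x. \<bar>det (matrix (f' x))\<bar> * indicator S x) \<in> borel_measurable borel"
  shows "emeasure lborel (f ` S) = (\<integral>\<^sup>+x. ennreal (\<bar>det (matrix (f' x))\<bar> * indicator S x) \<partial>lborel)"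
proof -
  let ?D = "\<lambda>x. \<bar>det (matrix (f' x))\<bar> * indicator S x"
  have hi: "(\<lambda>x. \<bar>det (matrix (f' x))\<bar>) = (\<lambda>x. \<bar>det (matrix (f' x))\<bar>)" ..
  have key: "f ` S \<in> lmeasurable \<and> measure lebesgue (f ` S) = r \<longleftrightarrow> (?D has_integral r) UNIV" for r
  proof -
    have "((\<lambda>x. \<bar>det (matrix (f' x))\<bar>) has_integral r) S \<longleftrightarrow> (?D has_integral r) UNIV"
      unfolding has_integral_restrict_UNIV[of S, symmetric]
      by (rule arg_cong[where f="\<lambda>h. (h has_integral r) UNIV"]) (auto simp: indicator_def)
    then show ?thesis using has_measure_differentiable_image[of S f f' r] S f by simp
  qed
  have leb: "emeasure lebesgue (f ` S) = emeasure lborel (f ` S)" using S by simp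
  show ?thesis
  proof (cases "emeasure lborel (f ` S) < \<infinity>")
    case True
    then have lm: "f ` S \<in> lmeasurable" using S leb by (intro fmeasurableI) auto
    then have "(?D has_integral measure lebesgue (f ` S)) UNIV" using key by blast
    then have "(\<integral>\<^sup>+x. ennreal (?D x) \<partial>lborel) = ennreal (measure lebesgue (f ` S))"
      using m by (intro nn_integral_has_integral_lborel) auto
    also have "\<dots> = emeasure lborel (f ` S)"
      using emeasure_eq_measure2[OF lm] leb by simp
    finally show ?thesis by simp
  next
    case False
    have "(\<integral>\<^sup>+x. ennreal (?D x) \<partial>lborel) = \<infinity>"
    proof (rule ccontr)
      assume "(\<integral>\<^sup>+x. ennreal (?D x) \<partial>lborel) \<noteq> \<infinity>"
      then obtain r where r: "(\<integral>\<^sup>+x. ennreal (?D x) \<partial>lborel) = ennreal r" "0 \<le> r"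
        by (cases "\<integral>\<^sup>+x. ennreal (?D x) \<partial>lborel") auto
      then have "(?D has_integral r) UNIV"
        using m by (intro nn_integral_has_integral) auto
      then have "f ` S \<in> lmeasurable" using key by blast
      then show False using False leb by (auto simp: fmeasurable_def)
    qed
    then show ?thesis using False by (simp add: less_top[symmetric])
  qed
qed

text \<open>\<open>f\<close> is conjugated by the renaming \<open>R\<close> into the well-ordered
  copy of the index type; measures and Jacobian determinants are preserved.\<close>

lemma emeasure_differentiable_image:
  fixes f :: "real ^ 'n::finite \<Rightarrow> real ^ 'n"
  assumes S: "S \<in> sets borel" "f ` S \<in> sets borel"
    and f: "\<And>x. x \<in> S \<Longrightarrow> (f has_derivative f' x) (at x within S)" "inj_on f S"
    and m: "(\<lambda>x. \<bar>det (matrix (f' x))\<bar> * indicator S x) \<in> borel_measurable borel"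
  shows "emeasure lborel (f ` S) = (\<integral>\<^sup>+x. ennreal (\<bar>det (matrix (f' x))\<bar> * indicator S x) \<partial>lborel)"
proof -
  define r where "r = (of_copy :: 'n ordered_copy \<Rightarrow> 'n)"
  have r: "bij r" unfolding r_def by (rule bij_of_copy)
  define R where "R = (reindex r :: real ^ 'n \<Rightarrow> _)"
  define Q where "Q = (reindex (inv r) :: _ \<Rightarrow> real ^ 'n)"
  have RQ: "Q (R x) = x" "R (Q y) = y" for x y unfolding R_def Q_def using reindex_inverse[OF r] by auto
  define f2 where "f2 y = R (f (Q y))" for y
  define f2' where "f2' y v = R (f' (Q y) (Q v))" for y v
  have bl: "bounded_linear R" "bounded_linear Q"
    by (simp_all add: R_def Q_def linear_conv_bounded_linear[symmetric] reindex_linear)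
  have QS: "Q ` (R ` S) = S" "f2 ` (R ` S) = R ` (f ` S)" by (auto simp: image_image RQ f2_def)
  have lin: "linear (f' x)" if "x \<in> S" for x using f(1)[OF that] by (rule has_derivative_linear)
  have det: "det (matrix (f2' (R x))) = det (matrix (f' x))" if "x \<in> S" for x
  proof -
    have Qa: "Q (axis i 1) = axis (r i) 1" for i
      unfolding Q_def using r by (auto simp: vec_eq_iff axis_def inv_f_f bij_is_inj surj_f_inv_f bij_is_surj)
    have Rn: "R v $ i = v $ r i" for v i by (simp add: R_def)
    have "matrix (f2' (R x)) $ i $ j = matrix (f' x) $ r i $ r j" for i j
      by (simp add: matrix_def f2'_def RQ Qa Rn)
    then have "matrix (f2' (R x)) = (\<chi> i j. matrix (f' x) $ r i $ r j)" by (simp add: vec_eq_iff)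
    then show ?thesis using det_reindex[OF r] by simp
  qed
  have der: "(f2 has_derivative f2' y) (at y within R ` S)" if "y \<in> R ` S" for y
  proof -
    have "(Q has_derivative Q) (at y within R ` S)" by (rule bounded_linear_imp_has_derivative[OF bl(2)])
    moreover have "(f has_derivative f' (Q y)) (at (Q y) within Q ` (R ` S))"
      using that f(1) unfolding QS by (auto simp: RQ)
    ultimately have "((\<lambda>y. f (Q y)) has_derivative (\<lambda>v. f' (Q y) (Q v))) (at y within R ` S)"
      by (rule has_derivative_in_compose)
    then show ?thesis unfolding f2_def[abs_def] f2'_def by (rule bounded_linear.has_derivative[OF bl(1)])
  qed
  have inj: "inj_on f2 (R ` S)"
    using f(2) by (auto simp: inj_on_def f2_def RQ) (metis RQ(1))
  let ?D = "\<lambda>x. \<bar>det (matrix (f' x))\<bar> * indicator S x"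
  have D: "\<bar>det (matrix (f2' y))\<bar> * indicator (R ` S) y = ?D (Q y)" for y
  proof (cases "y \<in> R ` S")
    case True then show ?thesis using det by (auto simp: RQ)
  next
    case False
    then have "Q y \<notin> S" by (metis RQ(2) imageI)
    then show ?thesis using False by simp
  qed
  have Qm: "Q \<in> borel_measurable borel" unfolding Q_def by simp
  have "emeasure lborel (f ` S) = emeasure lborel (f2 ` (R ` S))"
    unfolding QS(2) using emeasure_reindex_image[OF r S(2)] by (simp add: R_def)
  also have "\<dots> = (\<integral>\<^sup>+y. ennreal (\<bar>det (matrix (f2' y))\<bar> * indicator (R ` S) y) \<partial>lborel)"
  proof (rule emeasure_differentiable_image_wellorder[OF _ _ der inj])
    show "R ` S \<in> sets borel" "f2 ` (R ` S) \<in> sets borel"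
      unfolding QS(2) using emeasure_reindex_image(1)[OF r] S by (simp_all add: R_def)
    show "(\<lambda>y. \<bar>det (matrix (f2' y))\<bar> * indicator (R ` S) y) \<in> borel_measurable borel"
      unfolding D using measurable_compose[OF Qm m] .
  qed
  also have "\<dots> = (\<integral>\<^sup>+y. ennreal (?D (Q y)) \<partial>lborel)" unfolding D ..
  also have "\<dots> = (\<integral>\<^sup>+x. ennreal (?D x) \<partial>distr lborel borel Q)"
    using Qm m by (subst nn_integral_distr) auto
  also have "distr lborel borel Q = lborel"
    unfolding Q_def by (rule lborel_distr_reindex[OF bij_imp_bij_inv[OF r]])
  finally show ?thesis .
qed

text \<open>Comparing the measures $|\det f'|\,dx$ pushed forward by \<open>f\<close> and $dy$ on Borel sets lets the
  integrand be arbitrary.\<close>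

lemma nn_integral_change_of_variables:
  fixes f :: "real ^ 'n::finite \<Rightarrow> real ^ 'n" and h :: "real ^ 'n \<Rightarrow> ennreal"
  assumes S: "S \<in> sets borel"
    and im: "\<And>B. B \<in> sets borel \<Longrightarrow> B \<subseteq> S \<Longrightarrow> f ` B \<in> sets borel"
    and f: "\<And>x. x \<in> S \<Longrightarrow> (f has_derivative f' x) (at x within S)" "inj_on f S"
    and m: "(\<lambda>x. \<bar>det (matrix (f' x))\<bar> * indicator S x) \<in> borel_measurable borel"
    and h: "(\<lambda>y. h y * indicator (f ` S) y) \<in> borel_measurable borel"
  shows "(\<integral>\<^sup>+y. h y * indicator (f ` S) y \<partial>lborel) =
    (\<integral>\<^sup>+x. ennreal \<bar>det (matrix (f' x))\<bar> * h (f x) * indicator S x \<partial>lborel)"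
proof -
  let ?D = "\<lambda>x. \<bar>det (matrix (f' x))\<bar> * indicator S x"
  \<comment> \<open>Extended by 0 so that the map is Borel on the whole space; the density vanishes
    off \<open>S\<close>, so the added values carry no mass.\<close>
  define f0 where "f0 x = (if x \<in> S then f x else 0)" for x
  have cont: "continuous_on S f" using f(1) has_derivative_continuous_on by blast
  have f0: "f0 \<in> borel_measurable borel"
    unfolding f0_def[abs_def] by (intro borel_measurable_continuous_on_if S cont continuous_intros)
  have mD: "(\<lambda>x. ennreal (?D x)) \<in> borel_measurable lborel" using m by auto
  have fS: "f ` S \<in> sets borel" using im[OF S] by simp
  have eq: "distr (density lborel (\<lambda>x. ennreal (?D x))) borel f0 = density lborel (indicator (f ` S))"
  proof (rule measure_eqI)
    fix B assume "B \<in> sets (distr (density lborel (\<lambda>x. ennreal (?D x))) borel f0)"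
    then have B: "B \<in> sets borel" by simp
    have SB: "S \<inter> f0 -` B \<in> sets borel" using S measurable_sets[OF f0 B] by auto
    have fB: "f ` (S \<inter> f0 -` B) = f ` S \<inter> B" by (auto simp: f0_def)
    have sub: "S \<inter> f0 -` B \<subseteq> S" by auto
    have mm: "(\<lambda>x. \<bar>det (matrix (f' x))\<bar> * indicator (S \<inter> f0 -` B) x) \<in> borel_measurable borel"
    proof -
      have "(\<lambda>x. \<bar>det (matrix (f' x))\<bar> * indicator (S \<inter> f0 -` B) x) = (\<lambda>x. ?D x * indicator (S \<inter> f0 -` B) x)"
        by (auto simp: indicator_def)
      then show ?thesis using m SB by simp
    qed
    have "emeasure (distr (density lborel (\<lambda>x. ennreal (?D x))) borel f0) B
       = (\<integral>\<^sup>+x. ennreal (?D x) * indicator (f0 -` B) x \<partial>lborel)"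
      using f0 B measurable_sets[OF f0 B] mD by (simp add: emeasure_distr emeasure_density)
    also have "\<dots> = (\<integral>\<^sup>+x. ennreal (\<bar>det (matrix (f' x))\<bar> * indicator (S \<inter> f0 -` B) x) \<partial>lborel)"
      by (intro nn_integral_cong) (auto simp: indicator_def)
    also have "\<dots> = emeasure lborel (f ` (S \<inter> f0 -` B))"
      by (rule emeasure_differentiable_image[symmetric, OF SB im[OF SB sub]
            has_derivative_subset[OF f(1) sub] inj_on_subset[OF f(2) sub] mm]) auto
    also have "\<dots> = emeasure (density lborel (indicator (f ` S))) B"
    proof -
      have "emeasure (density lborel (indicator (f ` S))) B = (\<integral>\<^sup>+y. indicator (f ` S) y * indicator B y \<partial>lborel)"
        by (rule emeasure_density) (use fS B in auto)
      also have "\<dots> = (\<integral>\<^sup>+y. indicator (f ` S \<inter> B) y \<partial>lborel)" by (simp only: indicator_inter_arith)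
      also have "\<dots> = emeasure lborel (f ` S \<inter> B)" by (rule nn_integral_indicator) (use fS B in auto)
      finally show ?thesis unfolding fB by simp
    qed
    finally show "emeasure (distr (density lborel (\<lambda>x. ennreal (?D x))) borel f0) B = emeasure (density lborel (indicator (f ` S))) B" .
  qed simp
  let ?h = "\<lambda>y. h y * indicator (f ` S) y"
  have "(\<integral>\<^sup>+y. h y * indicator (f ` S) y \<partial>lborel) = (\<integral>\<^sup>+y. indicator (f ` S) y * ?h y \<partial>lborel)"
    by (intro nn_integral_cong) (auto simp: indicator_def)
  also have "\<dots> = (\<integral>\<^sup>+y. ?h y \<partial>density lborel (indicator (f ` S)))"
    using h fS by (subst nn_integral_density) auto
  also have "\<dots> = (\<integral>\<^sup>+x. ennreal (?D x) * ?h (f0 x) \<partial>lborel)"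
    unfolding eq[symmetric] using h f0 mD by (simp add: nn_integral_distr nn_integral_density)
  also have "\<dots> = (\<integral>\<^sup>+x. ennreal \<bar>det (matrix (f' x))\<bar> * h (f x) * indicator S x \<partial>lborel)"
    by (intro nn_integral_cong) (auto simp: indicator_def f0_def)
  finally show ?thesis .
qed

section \<open>Measures on manifolds given by densities in charts\<close>

abbreviation cod_of :: "('a, 'd) chart \<Rightarrow> (real ^ 'd) set" where
  "cod_of c \<equiv> coord c ` dom_of c"

lemma smooth_atlasD:
  assumes M: "smooth_atlas M" and c: "c \<in> M"
  shows "open (dom_of c)" "open (cod_of c)" "continuous_on (dom_of c) (coord c)" "continuous_on (cod_of c) (param c)"
    "p \<in> dom_of c \<Longrightarrow> param c (coord c p) = p"
    "x \<in> cod_of c \<Longrightarrow> param c x \<in> dom_of c" "x \<in> cod_of c \<Longrightarrow> coord c (param c x) = x"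
  using assms unfolding smooth_atlas_def homeomorphism_def by auto

lemma chart_exists: "smooth_atlas M \<Longrightarrow> \<exists>c\<in>M. p \<in> dom_of c"
  unfolding smooth_atlas_def by blast

lemma chart_at:
  assumes "smooth_atlas M" shows "chart_at M p \<in> M" "p \<in> dom_of (chart_at M p)"
proof -
  have "\<exists>c. c \<in> M \<and> p \<in> dom_of c" using chart_exists[OF assms] by blast
  from someI_ex[OF this] show "chart_at M p \<in> M" "p \<in> dom_of (chart_at M p)"
    unfolding chart_at_def by auto
qed

text \<open>Images under the coordinate map become preimages under \<open>param c\<close>, from
  which their openness and measurability follow.\<close>

lemma chart_image_eq:
  assumes M: "smooth_atlas M" "c \<in> M" and E: "E \<subseteq> dom_of c"
  shows "coord c ` E = cod_of c \<inter> param c -` E"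
  using smooth_atlasD[OF M] E by (auto simp: image_iff)

text \<open>Off the coordinate image \<open>inv_into\<close> chooses from an unsatisfiable
  condition, so \<open>param c\<close> is constant there; on the open image it is
  continuous.\<close>

lemma param_measurable:
  fixes M :: "('a::topological_space, 'm::finite) atlas"
  assumes M: "smooth_atlas M" "c \<in> M"
  shows "param c \<in> borel_measurable borel"
proof -
  have "param c = (\<lambda>x. if x \<in> cod_of c then param c x else (SOME z. False))"
    by (auto simp: param_def inv_into_def fun_eq_iff intro!: arg_cong[where f=Eps])
  moreover have "(\<lambda>x. if x \<in> cod_of c then param c x else (SOME z. False)) \<in> borel_measurable borel"
    using smooth_atlasD[OF M] by (intro borel_measurable_continuous_on_if) auto
  ultimately show ?thesis by simp
qed

lemma chart_image_borel:
  assumes M: "smooth_atlas M" "c \<in> M" and E: "E \<in> sets borel" "E \<subseteq> dom_of c"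
  shows "coord c ` E \<in> sets borel"
  unfolding chart_image_eq[OF M E(2)]
  using smooth_atlasD(2)[OF M] measurable_sets[OF param_measurable[OF M] E(1)] by auto

lemma open_chart_image:
  assumes M: "smooth_atlas M" "c \<in> M" and E: "open E" "E \<subseteq> dom_of c"
  shows "open (coord c ` E)"
  unfolding chart_image_eq[OF M E(2)]
  using continuous_on_open_vimage[OF smooth_atlasD(2)[OF M]] smooth_atlasD(4)[OF M] E(1)
  by (metis Int_commute)

lemma open_chart_preimage:
  assumes M: "smooth_atlas M" "c \<in> M" and "open S"
  shows "open (dom_of c \<inter> coord c -` S)"
  using continuous_on_open_vimage[OF smooth_atlasD(1)[OF M]] smooth_atlasD(3)[OF M] assms(3)
  by (metis Int_commute)

text \<open>The condition under the description operator in \<open>vol_measure\<close>, for an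
  arbitrary density \<open>\<omega>\<close>, so that existence and uniqueness become statements
  about densities.\<close>

definition has_density :: "('a::topological_space, 'm::finite) atlas \<Rightarrow> (('a, 'm) chart \<Rightarrow> real ^ 'm \<Rightarrow> real) \<Rightarrow> 'a measure \<Rightarrow> bool" where
  "has_density M \<omega> \<mu> \<longleftrightarrow> sets \<mu> = sets borel \<and>
     (\<forall>c\<in>M. \<forall>E\<in>sets borel. E \<subseteq> dom_of c \<longrightarrow>
        emeasure \<mu> E = (\<integral>\<^sup>+x\<in>coord c ` E. ennreal (\<omega> c x) \<partial>lborel))"

lemma has_densityD:
  "has_density M \<omega> \<mu> \<Longrightarrow> c \<in> M \<Longrightarrow> E \<in> sets borel \<Longrightarrow> E \<subseteq> dom_of c \<Longrightarrow>
    emeasure \<mu> E = (\<integral>\<^sup>+x\<in>coord c ` E. ennreal (\<omega> c x) \<partial>lborel)"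
  unfolding has_density_def by blast

lemma vol_measure_eq: "vol_measure M h = (THE \<mu>. has_density M (\<lambda>c x. sqrt (det (h c x))) \<mu>)"
  unfolding vol_measure_def has_density_def ..

definition chart_measure :: "('a::topological_space, 'm::finite) chart \<Rightarrow> (real ^ 'm \<Rightarrow> real) \<Rightarrow> 'a measure" where
  "chart_measure c w = distr (density lborel (\<lambda>x. ennreal (indicator (cod_of c) x * w x))) borel (param c)"

lemma sets_chart_measure [simp]: "sets (chart_measure c w) = sets borel"
  by (simp add: chart_measure_def)

lemma emeasure_chart_measure:
  fixes M :: "('a::topological_space, 'm::finite) atlas"
  assumes M: "smooth_atlas M" "c \<in> M" and w: "continuous_on (cod_of c) w" and E: "E \<in> sets borel"
  shows "emeasure (chart_measure c w) E = (\<integral>\<^sup>+x\<in>coord c ` (dom_of c \<inter> E). ennreal (w x) \<partial>lborel)"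
proof -
  have pm: "param c \<in> borel_measurable borel" by (rule param_measurable[OF M])
  have m: "(\<lambda>x. indicator (cod_of c) x * w x) \<in> borel_measurable borel"
    using borel_measurable_continuous_on_indicator[of "cod_of c" w] w smooth_atlasD(2)[OF M] by auto
  have "emeasure (chart_measure c w) E = (\<integral>\<^sup>+x. ennreal (indicator (cod_of c) x * w x) * indicator (param c -` E) x \<partial>lborel)"
    unfolding chart_measure_def using E m pm measurable_sets[OF pm E] by (simp add: emeasure_distr emeasure_density)
  also have "\<dots> = (\<integral>\<^sup>+x\<in>coord c ` (dom_of c \<inter> E). ennreal (w x) \<partial>lborel)"
    unfolding chart_image_eq[OF M Int_lower1]
    using smooth_atlasD(6)[OF M] by (intro nn_integral_cong) (auto simp: indicator_def)
  finally show ?thesis .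
qed

text \<open>On one chart the measure is the push forward of a weighted Lebesgue measure, which
  reduces integration over the chart to coordinate space.\<close>

lemma has_density_restrict:
  fixes M :: "('a::topological_space, 'm::finite) atlas"
  assumes M: "smooth_atlas M" "c \<in> M" and \<mu>: "has_density M \<omega> \<mu>"
    and \<omega>: "continuous_on (cod_of c) (\<omega> c)"
  shows "density \<mu> (indicator (dom_of c)) = chart_measure c (\<omega> c)"
    (is "?L = ?R")
proof (rule measure_eqI)
  have s: "sets \<mu> = sets borel" using \<mu> by (simp add: has_density_def)
  show "sets ?L = sets ?R" by (simp add: s)
  fix E assume "E \<in> sets ?L"
  then have E: "E \<in> sets borel" by (simp add: s)
  have d: "dom_of c \<in> sets borel" using smooth_atlasD(1)[OF M] by simp
  have "emeasure ?L E = (\<integral>\<^sup>+p. indicator (dom_of c \<inter> E) p \<partial>\<mu>)"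
    unfolding indicator_inter_arith by (rule emeasure_density) (use E d s in \<open>auto cong: measurable_cong_sets\<close>)
  also have "\<dots> = emeasure \<mu> (dom_of c \<inter> E)"
    by (rule nn_integral_indicator) (use E d s in auto)
  also have "\<dots> = emeasure ?R E"
    unfolding emeasure_chart_measure[OF M \<omega> E] by (rule has_densityD[OF \<mu> M(2)]) (use E d in auto)
  finally show "emeasure ?L E = emeasure ?R E" .
qed

lemma has_density_integral:
  fixes M :: "('a::topological_space, 'm::finite) atlas" and h :: "'a \<Rightarrow> real"
  assumes M: "smooth_atlas M" "c \<in> M" and \<mu>: "has_density M \<omega> \<mu>"
    and \<omega>: "continuous_on (cod_of c) (\<omega> c)" "\<And>x. x \<in> cod_of c \<Longrightarrow> 0 \<le> \<omega> c x"
    and h: "h \<in> borel_measurable borel" "\<And>p. p \<notin> dom_of c \<Longrightarrow> h p = 0"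
  shows "integral\<^sup>L \<mu> h = (\<integral>x. indicator (cod_of c) x * \<omega> c x * h (param c x) \<partial>lborel)"
proof -
  have s: "sets \<mu> = sets borel" using \<mu> by (simp add: has_density_def)
  have m: "(\<lambda>x. indicator (cod_of c) x * \<omega> c x) \<in> borel_measurable borel"
    using borel_measurable_continuous_on_indicator[of "cod_of c" "\<omega> c"] \<omega> smooth_atlasD(2)[OF M] by auto
  have hm: "h \<in> borel_measurable \<mu>" using h s by (simp cong: measurable_cong_sets)
  have dm: "indicator (dom_of c) \<in> borel_measurable \<mu>"
    using smooth_atlasD(1)[OF M] s by (simp cong: measurable_cong_sets)
  have "integral\<^sup>L \<mu> h = (\<integral>p. indicator (dom_of c) p *\<^sub>R h p \<partial>\<mu>)"
    using h(2) by (intro Bochner_Integration.integral_cong) (auto simp: indicator_def)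
  also have "\<dots> = integral\<^sup>L (density \<mu> (\<lambda>p. ennreal (indicator (dom_of c) p))) h"
    using hm dm by (intro integral_density[symmetric]) auto
  also have "(\<lambda>p. ennreal (indicator (dom_of c) p)) = indicator (dom_of c)"
    by (auto simp: indicator_def)
  also have "integral\<^sup>L (density \<mu> (indicator (dom_of c))) h
     = (\<integral>x. h (param c x) \<partial>density lborel (\<lambda>x. ennreal (indicator (cod_of c) x * \<omega> c x)))"
    unfolding has_density_restrict[OF M \<mu> \<omega>(1)] chart_measure_def
    using h(1) param_measurable[OF M] by (intro integral_distr) auto
  also have "\<dots> = (\<integral>x. (indicator (cod_of c) x * \<omega> c x) *\<^sub>R h (param c x) \<partial>lborel)"
    using m \<omega>(2) measurable_compose[OF param_measurable[OF M] h(1)]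
    by (intro integral_density) (auto simp: indicator_def)
  finally show ?thesis by simp
qed

text \<open>Passes from the Lebesgue integral on the manifold to a Henstock-Kurzweil integral over a
  box, where differentiation under the integral and the fundamental theorem are at hand.\<close>

lemma has_density_integral_cbox:
  fixes M :: "('a::topological_space, 'm::finite) atlas" and h :: "'a \<Rightarrow> real"
  assumes M: "smooth_atlas M" "c \<in> M" and \<mu>: "has_density M \<omega> \<mu>"
    and \<omega>: "continuous_on (cod_of c) (\<omega> c)" "\<And>x. x \<in> cod_of c \<Longrightarrow> 0 \<le> \<omega> c x"
    and h: "continuous_on UNIV h" "\<And>p. p \<notin> param c ` cbox a b \<Longrightarrow> h p = 0" and ab: "cbox a b \<subseteq> cod_of c"
  shows "integral\<^sup>L \<mu> h = integral (cbox a b) (\<lambda>x. \<omega> c x * h (param c x))"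
proof -
  have h0: "h p = 0" if "p \<notin> dom_of c" for p
    by (rule h(2)) (use that ab smooth_atlasD(6)[OF M] in auto)
  have z: "h (param c x) = 0" if "x \<in> cod_of c" "x \<notin> cbox a b" for x
  proof (rule h(2))
    show "param c x \<notin> param c ` cbox a b"
    proof
      assume "param c x \<in> param c ` cbox a b"
      then obtain y where "y \<in> cbox a b" "param c x = param c y" by auto
      then show False using that ab smooth_atlasD(7)[OF M] by (metis subsetD)
    qed
  qed
  have cont: "continuous_on (cbox a b) (\<lambda>x. \<omega> c x * h (param c x))"
    using continuous_on_subset[OF \<omega>(1) ab] continuous_on_subset[OF smooth_atlasD(4)[OF M] ab] h(1)
    by (intro continuous_on_mult continuous_on_compose2[OF h(1)]) auto
  then have si: "set_integrable lborel (cbox a b) (\<lambda>x. \<omega> c x * h (param c x))"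
    unfolding set_integrable_def by (intro borel_integrable_compact) auto
  have "integral\<^sup>L \<mu> h = (\<integral>x. indicator (cod_of c) x * \<omega> c x * h (param c x) \<partial>lborel)"
    by (rule has_density_integral[OF M \<mu> \<omega> borel_measurable_continuous_onI[OF h(1)] h0])
  also have "\<dots> = (LINT x : cbox a b | lborel. \<omega> c x * h (param c x))"
    unfolding set_lebesgue_integral_def
    using z ab by (intro Bochner_Integration.integral_cong) (auto simp: indicator_def)
  finally show ?thesis by (simp add: set_borel_integral_eq_integral[OF si])
qed

section \<open>Gluing densities over a finite Borel partition\<close>

text \<open>Compactness leaves finitely many chart domains, and removing the earlier ones from each
  makes them disjoint. Borel pieces are enough to build and compare measures.\<close>

lemma finite_chart_partition:
  fixes M :: "('a::topological_space, 'm::finite) atlas"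
  assumes M: "smooth_atlas M" and comp: "compact (UNIV :: 'a set)"
  obtains K :: nat and cs :: "nat \<Rightarrow> ('a, 'm) chart" and P where
    "\<forall>i<K. cs i \<in> M" "\<forall>i. P i \<in> sets borel" "\<forall>i<K. P i \<subseteq> dom_of (cs i)"
    "disjoint_family P" "(\<Union>i<K. P i) = UNIV"
proof -
  have "(UNIV :: 'a set) \<subseteq> \<Union> (dom_of ` M)" using M unfolding smooth_atlas_def by auto
  moreover have "open B" if "B \<in> dom_of ` M" for B using that smooth_atlasD(1)[OF M] by auto
  ultimately obtain D where D: "D \<subseteq> dom_of ` M" "finite D" "UNIV \<subseteq> \<Union>D"
    using comp unfolding compact_eq_Heine_Borel by meson
  obtain C where C: "C \<subseteq> M" "finite C" "D = dom_of ` C" using finite_subset_image[OF D(2,1)] by blast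
  obtain xs where xs: "set xs = C" using finite_list[OF C(2)] by blast
  define K where "K = length xs"
  \<comment> \<open>Empty from index \<open>K\<close> on, so that \<open>disjointed\<close> applies
    to a sequence.\<close>
  define A where "A i = (if i < K then dom_of (xs ! i) else {})" for i
  have xsM: "xs ! i \<in> M" if "i < K" for i using that C(1) xs nth_mem unfolding K_def by blast
  have UA: "(\<Union>i\<in>{0..<K}. A i) = UNIV"
  proof -
    have "\<exists>i\<in>{0..<K}. p \<in> A i" for p
    proof -
      obtain c where "c \<in> C" "p \<in> dom_of c" using D(3) C(3) by blast
      then obtain i where "i < K" "xs ! i = c" using xs unfolding K_def by (metis in_set_conv_nth)
      then show ?thesis using \<open>p \<in> dom_of c\<close> by (auto simp: A_def)
    qed
    then show ?thesis by blast
  qed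
  have oA: "A i \<in> sets borel" for i using smooth_atlasD(1)[OF M xsM] by (simp add: A_def)
  show thesis
  proof (rule that[of K "\<lambda>i. xs ! i" "disjointed A"])
    show "\<forall>i. disjointed A i \<in> sets borel" unfolding disjointed_def using oA by auto
    show "\<forall>i<K. disjointed A i \<subseteq> dom_of (xs ! i)"
    proof (intro allI impI)
      fix i assume "i < K"
      then show "disjointed A i \<subseteq> dom_of (xs ! i)" using disjointed_subset[of A i] by (simp add: A_def)
    qed
    show "(\<Union>i<K. disjointed A i) = UNIV"
      using finite_UN_disjointed_eq[of A K] UA by (simp add: lessThan_atLeast0)
  qed (use xsM disjoint_family_disjointed in auto)
qed

lemma emeasure_partition:
  fixes K :: nat
  assumes s: "sets \<mu> = sets borel" and P: "\<And>i. P i \<in> sets borel" "disjoint_family P" "(\<Union>i<K. P i) = UNIV"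
    and E: "E \<in> sets borel"
  shows "emeasure \<mu> E = (\<Sum>i<K. emeasure \<mu> (E \<inter> P i))"
proof -
  have "(\<Sum>i<K. emeasure \<mu> (E \<inter> P i)) = emeasure \<mu> (\<Union>i<K. E \<inter> P i)"
    using P(1,2) E s by (intro sum_emeasure) (auto simp: disjoint_family_on_def)
  also have "(\<Union>i<K. E \<inter> P i) = E" using P(3) by auto
  finally show ?thesis by simp
qed

lemma nn_integral_coord_partition:
  fixes M :: "('a::topological_space, 'm::finite) atlas" and K :: nat
  assumes M: "smooth_atlas M" "c \<in> M" and w: "continuous_on (cod_of c) w"
    and P: "\<And>i. P i \<in> sets borel" "disjoint_family P" "(\<Union>i<K. P i) = UNIV"
    and E: "E \<in> sets borel" "E \<subseteq> dom_of c"
  shows "(\<Sum>i<K. \<integral>\<^sup>+x\<in>coord c ` (E \<inter> P i). ennreal (w x) \<partial>lborel) = (\<integral>\<^sup>+x\<in>coord c ` E. ennreal (w x) \<partial>lborel)"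
proof -
  have e: "emeasure (chart_measure c w) B = (\<integral>\<^sup>+x\<in>coord c ` B. ennreal (w x) \<partial>lborel)"
    if "B \<in> sets borel" "B \<subseteq> dom_of c" for B
    using emeasure_chart_measure[OF M w that(1)] Int_absorb1[OF that(2)] by simp
  have EP: "E \<inter> P i \<in> sets borel" "E \<inter> P i \<subseteq> dom_of c" for i
    using sets.Int[OF E(1) P(1)] E(2) by auto
  show ?thesis
    using emeasure_partition[OF sets_chart_measure P E(1), of c w] unfolding e[OF EP] e[OF E] by simp
qed

text \<open>Every Borel set splits into finitely many pieces inside chart domains, where the density
  prescribes the measure.\<close>

lemma has_density_unique:
  fixes M :: "('a::topological_space, 'm::finite) atlas"
  assumes M: "smooth_atlas M" and comp: "compact (UNIV :: 'a set)"
    and \<mu>: "has_density M \<omega> \<mu>" "has_density M \<omega> \<nu>"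
  shows "\<mu> = \<nu>"
proof (rule measure_eqI)
  have s: "sets \<mu> = sets borel" "sets \<nu> = sets borel" using \<mu> by (auto simp: has_density_def)
  then show "sets \<mu> = sets \<nu>" by simp
  fix E assume "E \<in> sets \<mu>"
  then have E: "E \<in> sets borel" using s by simp
  obtain K :: nat and cs P where P0: "\<forall>i<K. cs i \<in> M" "\<forall>i. P i \<in> sets borel" "\<forall>i<K. P i \<subseteq> dom_of (cs i)"
    "disjoint_family P" "(\<Union>i<K. P i) = UNIV"
    by (rule finite_chart_partition[OF M comp])
  note P = P0(1-3)[rule_format] P0(4,5)
  have "emeasure \<mu> (E \<inter> P i) = emeasure \<nu> (E \<inter> P i)" if "i < K" for i
  proof -
    have "E \<inter> P i \<in> sets borel" "E \<inter> P i \<subseteq> dom_of (cs i)" using E P(2,3) that by auto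
    then show ?thesis using \<mu> P(1)[OF that] unfolding has_density_def by metis
  qed
  then show "emeasure \<mu> E = emeasure \<nu> E"
    unfolding emeasure_partition[OF s(1) P(2,4,5) E] emeasure_partition[OF s(2) P(2,4,5) E] by simp
qed

section \<open>Diffeomorphisms in charts\<close>

lemma smooth_mapD:
  assumes f: "smooth_map M N f" and M: "smooth_atlas M" "c \<in> M" and N: "smooth_atlas N" "d \<in> N"
  shows "smooth_on (coord c ` (dom_of c \<inter> f -` dom_of d)) (loc_rep c d f)"
    "open (coord c ` (dom_of c \<inter> f -` dom_of d))" "open (dom_of c \<inter> f -` dom_of d)"
proof -
  show "smooth_on (coord c ` (dom_of c \<inter> f -` dom_of d)) (loc_rep c d f)"
    using assms by (simp add: smooth_map_def)
  show o: "open (dom_of c \<inter> f -` dom_of d)"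
    using f smooth_atlasD(1)[OF M] smooth_atlasD(1)[OF N] unfolding smooth_map_def
    by (intro open_Int open_vimage) auto
  show "open (coord c ` (dom_of c \<inter> f -` dom_of d))"
    by (rule open_chart_image[OF M o]) auto
qed

lemma id_Diff:
  assumes M: "smooth_atlas M" shows "(\<lambda>x. x) \<in> Diff M"
proof -
  have "smooth_map M M (\<lambda>x. x)"
    using M unfolding smooth_map_def smooth_atlas_def loc_rep_def by (auto simp: comp_def)
  then show ?thesis by (simp add: Diff_def bij_id[unfolded id_def] inv_id[unfolded id_def])
qed

lemma Diff_image_borel:
  assumes "\<phi> \<in> Diff M" "E \<in> sets borel" shows "\<phi> ` E \<in> sets borel"
proof -
  have "continuous_on UNIV (inv \<phi>)" "bij \<phi>" using assms(1) by (auto simp: Diff_def smooth_map_def)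
  then have "\<phi> ` E = inv \<phi> -` E" "inv \<phi> \<in> borel_measurable borel"
    by (auto simp: bij_vimage_eq_inv_image bij_imp_bij_inv inv_inv_eq intro: borel_measurable_continuous_onI)
  then show ?thesis using measurable_sets[of "inv \<phi>" borel borel E] assms(2) by simp
qed

text \<open>One statement for two uses: with the identity as diffeomorphism it compares two charts,
  in general it moves the measure along \<open>\<phi>\<close>.\<close>

lemma nn_integral_chart_change:
  fixes M :: "('a::topological_space, 'm::finite) atlas"
  assumes M: "smooth_atlas M" and c: "c \<in> M" "d \<in> M" and \<phi>: "\<phi> \<in> Diff M"
    and E: "E \<in> sets borel" "E \<subseteq> dom_of c" "\<phi> ` E \<subseteq> dom_of d"
    and \<omega>2: "continuous_on (cod_of d) \<omega>2"
    and \<omega>: "\<And>x. x \<in> coord c ` E \<Longrightarrow> \<omega>1 x = \<bar>det (matrix (fd (loc_rep c d \<phi>) x))\<bar> * \<omega>2 (loc_rep c d \<phi> x)"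
  shows "(\<integral>\<^sup>+x\<in>coord d ` \<phi> ` E. ennreal (\<omega>2 x) \<partial>lborel) = (\<integral>\<^sup>+x\<in>coord c ` E. ennreal (\<omega>1 x) \<partial>lborel)"
proof -
  let ?\<theta> = "loc_rep c d \<phi>" and ?S = "coord c ` E" and ?U = "coord c ` (dom_of c \<inter> \<phi> -` dom_of d)"
  have sm: "smooth_map M M \<phi>" and bij: "bij \<phi>" using \<phi> by (auto simp: Diff_def)
  note sd = smooth_mapD[OF sm M c(1) M c(2)]
  note cD = smooth_atlasD[OF M c(1)] and dD = smooth_atlasD[OF M c(2)]
  have SU: "?S \<subseteq> ?U" using E by (intro image_mono) auto
  have \<theta>: "?\<theta> (coord c p) = coord d (\<phi> p)" if "p \<in> dom_of c" for p
    using cD(5)[OF that] by (simp add: loc_rep_def)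
  have im: "?\<theta> ` (coord c ` B) = coord d ` \<phi> ` B" if "B \<subseteq> dom_of c" for B
    using \<theta> that by (auto simp: image_image intro!: image_cong)
  have bim: "coord d ` \<phi> ` B \<in> sets borel" if "B \<in> sets borel" "B \<subseteq> E" for B
    using that E by (intro chart_image_borel[OF M c(2)] Diff_image_borel[OF \<phi>]) auto
  have eqS: "coord d ` \<phi> ` E = ?\<theta> ` ?S" using im E(2) by simp
  have S: "?S \<in> sets borel" by (rule chart_image_borel[OF M c(1) E(1,2)])
  have detm: "(\<lambda>x. \<bar>det (matrix (fd ?\<theta> x))\<bar> * indicator ?S x) \<in> borel_measurable borel"
  proof -
    have "continuous_on ?U (\<lambda>x. \<bar>det (matrix (fd ?\<theta> x))\<bar>)"
      unfolding det_def matrix_def using smooth_on_continuous[OF smooth_on_fd[OF sd(1)]]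
      by (intro continuous_on_rabs continuous_on_sum continuous_on_mult continuous_on_const continuous_on_prod)
        (simp add: continuous_on_component)
    then have "continuous_on ?S (\<lambda>x. \<bar>det (matrix (fd ?\<theta> x))\<bar>)" by (rule continuous_on_subset[OF _ SU])
    then have "(\<lambda>x. indicator ?S x *\<^sub>R \<bar>det (matrix (fd ?\<theta> x))\<bar>) \<in> borel_measurable borel"
      by (rule borel_measurable_continuous_on_indicator[OF S])
    then show ?thesis by (simp add: mult.commute)
  qed
  have "(\<integral>\<^sup>+x\<in>?\<theta> ` ?S. ennreal (\<omega>2 x) \<partial>lborel) =
     (\<integral>\<^sup>+x. ennreal \<bar>det (matrix (fd ?\<theta> x))\<bar> * ennreal (\<omega>2 (?\<theta> x)) * indicator ?S x \<partial>lborel)"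
  proof (rule nn_integral_change_of_variables[OF S _ _ _ detm])
    fix B assume B: "B \<in> sets borel" "B \<subseteq> ?S"
    \<comment> \<open>Borel subsets of the coordinate image come from Borel subsets of
      \<open>E\<close>, whose images under the homeomorphism and the chart are Borel.\<close>
    define B' where "B' = E \<inter> dom_of c \<inter> coord c -` B"
    have "B = coord c ` B'"
    proof (intro equalityI subsetI)
      fix x assume x: "x \<in> B"
      with B(2) obtain p where "p \<in> E" "x = coord c p" by blast
      then show "x \<in> coord c ` B'" using x E(2) unfolding B'_def by (intro image_eqI[of x _ p]) auto
    qed (auto simp: B'_def)
    moreover have "B' \<in> sets borel"
    proof -
      have "(\<lambda>p. if p \<in> dom_of c then coord c p else 0) \<in> borel_measurable borel"
        using cD by (intro borel_measurable_continuous_on_if) auto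
      from measurable_sets[OF this B(1)]
      have "E \<inter> dom_of c \<inter> ((\<lambda>p. if p \<in> dom_of c then coord c p else 0) -` B) \<in> sets borel"
        using E(1) cD(1) by auto
      also have "E \<inter> dom_of c \<inter> ((\<lambda>p. if p \<in> dom_of c then coord c p else 0) -` B) = B'"
        by (auto simp: B'_def)
      finally show ?thesis .
    qed
    moreover have "B' \<subseteq> dom_of c" "B' \<subseteq> E" by (auto simp: B'_def)
    ultimately show "?\<theta> ` B \<in> sets borel"
      using im[of B'] bim[of B'] by metis
  next
    fix x assume "x \<in> ?S"
    then have "x \<in> ?U" using SU by blast
    then show "(?\<theta> has_derivative fd ?\<theta> x) (at x within ?S)"
      by (rule has_derivative_at_withinI[OF has_derivative_fd[OF smooth_on_differentiable[OF sd(1)]]])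
  next
    show "inj_on ?\<theta> ?S"
    proof (rule inj_onI)
      fix x y assume "x \<in> ?S" "y \<in> ?S" "?\<theta> x = ?\<theta> y"
      then obtain p q where pq: "p \<in> E" "x = coord c p" "q \<in> E" "y = coord c q" "?\<theta> (coord c p) = ?\<theta> (coord c q)"
        by blast
      then have eq: "coord d (\<phi> p) = coord d (\<phi> q)" using \<theta>[of p] \<theta>[of q] E(2) by (metis subsetD)
      have pd: "\<phi> p \<in> dom_of d" "\<phi> q \<in> dom_of d" using E(3) pq by auto
      have "\<phi> p = param d (coord d (\<phi> p))" by (rule dD(5)[OF pd(1), symmetric])
      also have "\<dots> = \<phi> q" unfolding eq by (rule dD(5)[OF pd(2)])
      finally have "\<phi> p = \<phi> q" .
      then have "p = q" by (rule injD[OF bij_is_inj[OF bij]])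
      then show "x = y" using pq(2,4) by simp
    qed
  next
    have "continuous_on (?\<theta> ` ?S) \<omega>2"
      using E(3) unfolding eqS[symmetric] by (intro continuous_on_subset[OF \<omega>2]) auto
    moreover have "?\<theta> ` ?S \<in> sets borel" using bim[OF E(1)] eqS by simp
    ultimately have "(\<lambda>y. indicator (?\<theta> ` ?S) y *\<^sub>R \<omega>2 y) \<in> borel_measurable borel"
      by (intro borel_measurable_continuous_on_indicator) auto
    then have "(\<lambda>y. ennreal (indicator (?\<theta> ` ?S) y *\<^sub>R \<omega>2 y)) \<in> borel_measurable borel" by simp
    also have "(\<lambda>y. ennreal (indicator (?\<theta> ` ?S) y *\<^sub>R \<omega>2 y)) = (\<lambda>y. ennreal (\<omega>2 y) * indicator (?\<theta> ` ?S) y)"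
      by (auto simp: indicator_def)
    finally show "(\<lambda>y. ennreal (\<omega>2 y) * indicator (?\<theta> ` ?S) y) \<in> borel_measurable borel" .
  qed
  also have "\<dots> = (\<integral>\<^sup>+x\<in>?S. ennreal (\<omega>1 x) \<partial>lborel)"
    using \<omega> by (intro nn_integral_cong) (auto simp: indicator_def ennreal_mult')
  finally show ?thesis by (simp add: eqS)
qed

text \<open>Each piece of a Borel partition is measured in its own chart; the transformation law
  makes the result agree with the measurement in any other chart.\<close>

lemma has_density_exists:
  fixes M :: "('a::topological_space, 'm::finite) atlas"
  assumes M: "smooth_atlas M" and comp: "compact (UNIV :: 'a set)"
    and \<omega>: "\<And>c. c \<in> M \<Longrightarrow> continuous_on (cod_of c) (\<omega> c)"
    and compat: "\<And>c d x. c \<in> M \<Longrightarrow> d \<in> M \<Longrightarrow> x \<in> coord c ` (dom_of c \<inter> dom_of d) \<Longrightarrow>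
      \<omega> c x = \<bar>det (matrix (fd (loc_rep c d (\<lambda>p. p)) x))\<bar> * \<omega> d (loc_rep c d (\<lambda>p. p) x)"
  shows "\<exists>\<mu>. has_density M \<omega> \<mu>"
proof -
  obtain K :: nat and cs P where P0: "\<forall>i<K. cs i \<in> M" "\<forall>i. P i \<in> sets borel" "\<forall>i<K. P i \<subseteq> dom_of (cs i)"
    "disjoint_family P" "(\<Union>i<K. P i) = UNIV"
    by (rule finite_chart_partition[OF M comp])
  note P = P0(1-3)[rule_format] P0(4,5)
  define C where "C i = chart_measure (cs i) (\<omega> (cs i))" for i
  have C: "emeasure (C i) (E \<inter> P i) = (\<integral>\<^sup>+x\<in>coord (cs i) ` (E \<inter> P i). ennreal (\<omega> (cs i) x) \<partial>lborel)"
    if i: "i < K" and E: "E \<in> sets borel" for i E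
  proof -
    have "dom_of (cs i) \<inter> (E \<inter> P i) = E \<inter> P i" using P(3)[OF i] by auto
    then show ?thesis
      unfolding C_def using emeasure_chart_measure[OF M P(1)[OF i] \<omega>[OF P(1)[OF i]] sets.Int[OF E P(2)], of i] by simp
  qed
  define \<mu> where "\<mu> = measure_of UNIV (sets borel) (\<lambda>E. \<Sum>i<K. emeasure (C i) (E \<inter> P i))"
  have s: "sets \<mu> = sets (borel :: 'a measure)"
    unfolding \<mu>_def using sets.sigma_sets_eq[of "borel :: 'a measure"] by (subst sets_measure_of) auto
  have \<mu>E: "emeasure \<mu> E = (\<Sum>i<K. emeasure (C i) (E \<inter> P i))" if "E \<in> sets borel" for E
  proof (rule emeasure_measure_of[OF \<mu>_def])
    show "positive (sets \<mu>) (\<lambda>E. \<Sum>i<K. emeasure (C i) (E \<inter> P i))" by (simp add: positive_def)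
    show "countably_additive (sets \<mu>) (\<lambda>E. \<Sum>i<K. emeasure (C i) (E \<inter> P i))"
      unfolding countably_additive_def
    proof (intro allI impI)
      fix A :: "nat \<Rightarrow> 'a set" assume A: "range A \<subseteq> sets \<mu>" "disjoint_family A"
      have "(\<Sum>n. \<Sum>i<K. emeasure (C i) (A n \<inter> P i)) = (\<Sum>i<K. \<Sum>n. emeasure (C i) (A n \<inter> P i))"
        by (intro suminf_sum) simp
      also have "\<dots> = (\<Sum>i<K. emeasure (C i) ((\<Union>n. A n) \<inter> P i))"
      proof (intro sum.cong refl)
        fix i
        have "(\<Sum>n. emeasure (C i) (A n \<inter> P i)) = emeasure (C i) (\<Union>n. A n \<inter> P i)"
          using A P(2) s by (intro suminf_emeasure) (auto simp: C_def disjoint_family_on_def)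
        also have "(\<Union>n. A n \<inter> P i) = (\<Union>n. A n) \<inter> P i" by auto
        finally show "(\<Sum>n. emeasure (C i) (A n \<inter> P i)) = emeasure (C i) ((\<Union>n. A n) \<inter> P i)" .
      qed
      finally show "(\<Sum>n. \<Sum>i<K. emeasure (C i) (A n \<inter> P i)) = (\<Sum>i<K. emeasure (C i) ((\<Union>n. A n) \<inter> P i))" .
    qed
  qed (use that s in auto)
  have "has_density M \<omega> \<mu>"
    unfolding has_density_def
  proof (intro conjI ballI impI s)
    fix c E assume c: "c \<in> M" and E: "E \<in> sets borel" "E \<subseteq> dom_of c"
    have part: "(\<integral>\<^sup>+x\<in>coord (cs i) ` (E \<inter> P i). ennreal (\<omega> (cs i) x) \<partial>lborel) =
        (\<integral>\<^sup>+x\<in>coord c ` (E \<inter> P i). ennreal (\<omega> c x) \<partial>lborel)" if i: "i < K" for i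
    proof -
      have "(\<integral>\<^sup>+x\<in>coord (cs i) ` (\<lambda>p. p) ` (E \<inter> P i). ennreal (\<omega> (cs i) x) \<partial>lborel) =
        (\<integral>\<^sup>+x\<in>coord c ` (E \<inter> P i). ennreal (\<omega> c x) \<partial>lborel)"
      proof (rule nn_integral_chart_change[OF M c P(1)[OF i] id_Diff[OF M]])
        show "E \<inter> P i \<in> sets borel" using E(1) P(2) by (rule sets.Int)
        show "E \<inter> P i \<subseteq> dom_of c" "(\<lambda>p. p) ` (E \<inter> P i) \<subseteq> dom_of (cs i)" using E(2) P(3)[OF i] by auto
        show "continuous_on (cod_of (cs i)) (\<omega> (cs i))" by (rule \<omega>[OF P(1)[OF i]])
        fix x assume x: "x \<in> coord c ` (E \<inter> P i)"
        have "coord c ` (E \<inter> P i) \<subseteq> coord c ` (dom_of c \<inter> dom_of (cs i))"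
          using E(2) P(3)[OF i] by (intro image_mono) auto
        with x have "x \<in> coord c ` (dom_of c \<inter> dom_of (cs i))" by (rule rev_subsetD)
        then show "\<omega> c x = \<bar>det (matrix (fd (loc_rep c (cs i) (\<lambda>p. p)) x))\<bar> * \<omega> (cs i) (loc_rep c (cs i) (\<lambda>p. p) x)"
          by (rule compat[OF c P(1)[OF i]])
      qed
      then show ?thesis by simp
    qed
    have "emeasure \<mu> E = (\<Sum>i<K. \<integral>\<^sup>+x\<in>coord c ` (E \<inter> P i). ennreal (\<omega> c x) \<partial>lborel)"
      unfolding \<mu>E[OF E(1)] using C[OF _ E(1)] part by simp
    also have "\<dots> = (\<integral>\<^sup>+x\<in>coord c ` E. ennreal (\<omega> c x) \<partial>lborel)"
      by (rule nn_integral_coord_partition[OF M c \<omega>[OF c] P(2,4,5) E])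
    finally show "emeasure \<mu> E = (\<integral>\<^sup>+x\<in>coord c ` E. ennreal (\<omega> c x) \<partial>lborel)" .
  qed
  then show ?thesis by blast
qed

lemma chart_neighbourhood:
  fixes M :: "('a::topological_space, 'm::finite) atlas"
  assumes M: "smooth_atlas M"
  obtains c a b r where "c \<in> M" "p \<in> dom_of c" "0 < r" "cball (coord c p) r \<subseteq> box a b" "cbox a b \<subseteq> cod_of c"
proof -
  obtain c where c: "c \<in> M" "p \<in> dom_of c" using chart_exists[OF M] by blast
  obtain a b where ab: "cbox a b \<subseteq> cod_of c" "coord c p \<in> box a b"
    using open_contains_cbox[OF smooth_atlasD(2)[OF M c(1)], of "coord c p"] c by blast
  obtain r where "0 < r" "cball (coord c p) r \<subseteq> box a b"
    using open_box[of a b] ab(2) open_contains_cball by blast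
  then show thesis using that c ab by blast
qed

text \<open>On a small closed coordinate ball the continuous density lies between two positive
  constants. Finitely many such neighbourhoods cover the space, and a single one already has
  positive mass.\<close>

lemma has_density_finite_pos:
  fixes M :: "('a::topological_space, 'm::finite) atlas"
  assumes M: "smooth_atlas M" and comp: "compact (UNIV :: 'a set)"
    and \<omega>: "\<And>c. c \<in> M \<Longrightarrow> continuous_on (cod_of c) (\<omega> c)" "\<And>c x. c \<in> M \<Longrightarrow> x \<in> cod_of c \<Longrightarrow> 0 < \<omega> c x"
    and \<mu>: "has_density M \<omega> \<mu>"
  shows "finite_measure \<mu>" "0 < measure \<mu> UNIV"
proof -
  have s: "sets \<mu> = sets borel" "space \<mu> = UNIV"
    using \<mu> sets_eq_imp_space_eq[of \<mu> borel] by (auto simp: has_density_def)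
  have nb: "\<exists>U. open U \<and> p \<in> U \<and> emeasure \<mu> U < \<infinity> \<and> 0 < emeasure \<mu> U" for p
  proof -
    obtain c a b r where c: "c \<in> M" "p \<in> dom_of c" "0 < r" "cball (coord c p) r \<subseteq> box a b" "cbox a b \<subseteq> cod_of c"
      by (rule chart_neighbourhood[OF M, of p])
    let ?x = "coord c p" and ?U = "dom_of c \<inter> coord c -` ball (coord c p) r"
    have cb: "cball ?x r \<subseteq> cod_of c" using c(4,5) box_subset_cbox by blast
    have U: "open ?U" by (rule open_chart_preimage[OF M c(1) open_ball])
    have "ball ?x r \<subseteq> cod_of c" using cb ball_subset_cball by blast
    then have img: "coord c ` ?U = ball ?x r" by auto
    have Ue: "emeasure \<mu> ?U = (\<integral>\<^sup>+x\<in>ball ?x r. ennreal (\<omega> c x) \<partial>lborel)"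
      using has_densityD[OF \<mu> c(1) borel_open[OF U] Int_lower1] unfolding img .
    have cc: "continuous_on (cball ?x r) (\<omega> c)" by (rule continuous_on_subset[OF \<omega>(1)[OF c(1)] cb])
    have ne: "cball ?x r \<noteq> {}" using c(3) by simp
    obtain y where y: "y \<in> cball ?x r" "\<And>x. x \<in> cball ?x r \<Longrightarrow> \<omega> c x \<le> \<omega> c y"
      using continuous_attains_sup[OF compact_cball ne cc] by blast
    obtain z where z: "z \<in> cball ?x r" "\<And>x. x \<in> cball ?x r \<Longrightarrow> \<omega> c z \<le> \<omega> c x"
      using continuous_attains_inf[OF compact_cball ne cc] by blast
    have bf: "emeasure lborel (ball ?x r) < \<infinity>" using emeasure_bounded_finite[OF bounded_ball] by simp
    have bp: "0 < emeasure lborel (ball ?x r)"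
      using bf content_ball_pos[OF c(3), of ?x] by (subst emeasure_eq_ennreal_measure) auto
    have "emeasure \<mu> ?U \<le> (\<integral>\<^sup>+x. ennreal (\<omega> c y) * indicator (ball ?x r) x \<partial>lborel)"
      unfolding Ue using y by (intro nn_integral_mono) (auto simp: indicator_def intro!: ennreal_leI)
    also have "\<dots> = ennreal (\<omega> c y) * emeasure lborel (ball ?x r)" by (simp add: nn_integral_cmult_indicator)
    also have "\<dots> < \<infinity>" using bf by (simp add: ennreal_mult_less_top)
    finally have f: "emeasure \<mu> ?U < \<infinity>" .
    have "0 < ennreal (\<omega> c z) * emeasure lborel (ball ?x r)"
      using bp \<omega>(2)[OF c(1), of z] z(1) cb by (auto simp: ennreal_zero_less_mult_iff)
    also have "\<dots> = (\<integral>\<^sup>+x. ennreal (\<omega> c z) * indicator (ball ?x r) x \<partial>lborel)" by (simp add: nn_integral_cmult_indicator)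
    also have "\<dots> \<le> emeasure \<mu> ?U"
      unfolding Ue using z by (intro nn_integral_mono) (auto simp: indicator_def intro!: ennreal_leI)
    finally have "0 < emeasure \<mu> ?U" .
    then show ?thesis using U f c by (intro exI[of _ ?U]) auto
  qed
  then obtain U where U: "\<And>p. open (U p)" "\<And>p. p \<in> U p" "\<And>p. emeasure \<mu> (U p) < \<infinity>" "\<And>p. 0 < emeasure \<mu> (U p)"
    by metis
  obtain D where D: "D \<subseteq> UNIV" "finite D" "UNIV \<subseteq> (\<Union>p\<in>D. U p)"
    by (rule compactE_image[OF comp, of UNIV U]) (use U in auto)
  have "emeasure \<mu> UNIV \<le> emeasure \<mu> (\<Union>p\<in>D. U p)"
    using D U(1) s by (intro emeasure_mono) auto
  also have "\<dots> \<le> (\<Sum>p\<in>D. emeasure \<mu> (U p))"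
    using D U(1) s by (intro emeasure_subadditive_finite) auto
  also have "\<dots> < \<infinity>" using U(3) D(2) by (simp add: less_top[symmetric])
  finally have fin: "emeasure \<mu> UNIV \<noteq> \<infinity>" by simp
  then show fm: "finite_measure \<mu>" by (intro finite_measureI) (simp add: s)
  \<comment> \<open>Types are nonempty, so the neighbourhood of any named point can serve.\<close>
  have "0 < emeasure \<mu> (U undefined)" by (rule U(4))
  also have "\<dots> \<le> emeasure \<mu> UNIV" using s by (intro emeasure_mono) auto
  finally show "0 < measure \<mu> UNIV"
    using finite_measure.emeasure_eq_measure[OF fm] by simp
qed

section \<open>Local representatives\<close>

lemma loc_rep_coord: "smooth_atlas M \<Longrightarrow> c \<in> M \<Longrightarrow> p \<in> dom_of c \<Longrightarrow> loc_rep c d f (coord c p) = coord d (f p)"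
  by (simp add: loc_rep_def smooth_atlasD(5))

lemma trace_hess_cong_open:
  assumes S: "open S" "x \<in> S" and eq: "\<And>y. y \<in> S \<Longrightarrow> \<phi> y = \<phi>' y"
  shows "trace_hess G \<phi> x = trace_hess G \<phi>' x"
proof -
  have fd: "fd \<phi> y = fd \<phi>' y" if "y \<in> S" for y by (rule fd_cong_open[OF S(1) that eq])
  have "fd (\<lambda>y. fd \<phi> y v) x = fd (\<lambda>y. fd \<phi>' y v) x" for v
    by (rule fd_cong_open[OF S]) (simp add: fd)
  then show ?thesis by (simp add: trace_hess_def cov_hess_def fd[OF S(2)] eq[OF S(2)])
qed

text \<open>Near a point all three charts apply at once, and the representative of the composite is
  the composite of representatives. With an identity in one place it describes a chart change of
  source or target.\<close>

lemma loc_rep_compose: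
  fixes M :: "('a::topological_space, 'm::finite) atlas" and N :: "('b::topological_space, 'n::finite) atlas"
    and P :: "('e::topological_space, 'k::finite) atlas"
  assumes M: "smooth_atlas M" "c \<in> M" and N: "smooth_atlas N" "d \<in> N" and P: "smooth_atlas P" "e \<in> P"
    and \<phi>: "smooth_map M N \<phi>" and f: "smooth_map N P f"
    and p: "p \<in> dom_of c" "\<phi> p \<in> dom_of d" "f (\<phi> p) \<in> dom_of e"
  obtains S where "open S" "coord c p \<in> S"
    "S \<subseteq> coord c ` (dom_of c \<inter> \<phi> -` dom_of d)" "loc_rep c d \<phi> ` S \<subseteq> coord d ` (dom_of d \<inter> f -` dom_of e)"
    "\<forall>y\<in>S. loc_rep c e (\<lambda>q. f (\<phi> q)) y = loc_rep d e f (loc_rep c d \<phi> y)"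
proof -
  define D where "D = dom_of c \<inter> \<phi> -` dom_of d \<inter> (dom_of c \<inter> (\<lambda>q. f (\<phi> q)) -` dom_of e)"
  have "continuous_on UNIV (\<lambda>q. f (\<phi> q))"
    using continuous_on_compose2[of UNIV f UNIV \<phi>] f \<phi> by (auto simp: smooth_map_def)
  then have "open ((\<lambda>q. f (\<phi> q)) -` dom_of e)" by (rule open_vimage[OF smooth_atlasD(1)[OF P]])
  then have oD: "open D"
    unfolding D_def by (intro open_Int smooth_mapD(3)[OF \<phi> M N] smooth_atlasD(1)[OF M])
  have *: "loc_rep c d \<phi> (coord c q) = coord d (\<phi> q)" if "q \<in> D" for q
    using that loc_rep_coord[OF M, of q d \<phi>] by (simp add: D_def)
  show thesis
  proof (rule that[of "coord c ` D"])
    show "open (coord c ` D)" by (rule open_chart_image[OF M oD]) (auto simp: D_def)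
    show "coord c p \<in> coord c ` D" using p by (auto simp: D_def)
    show "coord c ` D \<subseteq> coord c ` (dom_of c \<inter> \<phi> -` dom_of d)" by (auto simp: D_def)
    show "loc_rep c d \<phi> ` coord c ` D \<subseteq> coord d ` (dom_of d \<inter> f -` dom_of e)"
      using * by (auto simp: D_def)
    show "\<forall>y\<in>coord c ` D. loc_rep c e (\<lambda>q. f (\<phi> q)) y = loc_rep d e f (loc_rep c d \<phi> y)"
    proof
    fix y assume "y \<in> coord c ` D"
    then obtain q where q: "q \<in> D" "y = coord c q" by blast
    have "loc_rep c e (\<lambda>q. f (\<phi> q)) y = coord e (f (\<phi> q))"
      using q loc_rep_coord[OF M, of q e "\<lambda>q. f (\<phi> q)"] by (simp add: D_def)
    moreover have "loc_rep d e f (coord d (\<phi> q)) = coord e (f (\<phi> q))"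
      using q loc_rep_coord[OF N, of "\<phi> q" e f] by (simp add: D_def)
    ultimately show "loc_rep c e (\<lambda>q. f (\<phi> q)) y = loc_rep d e f (loc_rep c d \<phi> y)"
      using *[OF q(1)] q(2) by simp
    qed
  qed
qed

lemma smooth_map_id: "smooth_atlas M \<Longrightarrow> smooth_map M M (\<lambda>p. p)"
  using id_Diff by (auto simp: Diff_def)

text \<open>By the chain rule the derivative of the inverse diffeomorphism is a left
  inverse.\<close>

lemma inj_fd_Diff:
  assumes M: "smooth_atlas M" and c: "c \<in> M" "d \<in> M" and \<phi>: "\<phi> \<in> Diff M"
    and p: "p \<in> dom_of c" "\<phi> p \<in> dom_of d"
  shows "inj (fd (loc_rep c d \<phi>) (coord c p))"
proof -
  have \<phi>': "smooth_map M M \<phi>" "smooth_map M M (inv \<phi>)" "bij \<phi>" using \<phi> by (auto simp: Diff_def)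
  have ip: "inv \<phi> (\<phi> q) = q" for q using \<phi>'(3) by (simp add: bij_is_inj inv_f_f)
  obtain S where S: "open S" "coord c p \<in> S"
    "S \<subseteq> coord c ` (dom_of c \<inter> \<phi> -` dom_of d)" "loc_rep c d \<phi> ` S \<subseteq> coord d ` (dom_of d \<inter> inv \<phi> -` dom_of c)"
    "\<forall>y\<in>S. loc_rep c c (\<lambda>q. inv \<phi> (\<phi> q)) y = loc_rep d c (inv \<phi>) (loc_rep c d \<phi> y)"
    by (rule loc_rep_compose[OF M c(1) M c(2) M c(1) \<phi>'(1,2), of p]) (use p ip in auto)
  have d1: "loc_rep c d \<phi> differentiable at (coord c p)"
    using S(2,3) by (intro smooth_on_differentiable[OF smooth_mapD(1)[OF \<phi>'(1) M c(1) M c(2)]]) auto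
  have d2: "loc_rep d c (inv \<phi>) differentiable at (loc_rep c d \<phi> (coord c p))"
    using S(2,4) by (intro smooth_on_differentiable[OF smooth_mapD(1)[OF \<phi>'(2) M c(2) M c(1)]]) auto
  have "fd (\<lambda>y. loc_rep d c (inv \<phi>) (loc_rep c d \<phi> y)) (coord c p) = fd (\<lambda>y. y) (coord c p)"
  proof (rule fd_cong_open[OF S(1,2)])
    fix y assume y: "y \<in> S"
    then obtain q where "q \<in> dom_of c" "y = coord c q" using S(3) by auto
    then have "loc_rep c c (\<lambda>q. inv \<phi> (\<phi> q)) y = y" using loc_rep_coord[OF M c(1), of q] by (simp add: ip)
    then show "loc_rep d c (inv \<phi>) (loc_rep c d \<phi> y) = y" using bspec[OF S(5) y] by simp
  qed
  then have "fd (loc_rep d c (inv \<phi>)) (loc_rep c d \<phi> (coord c p)) (fd (loc_rep c d \<phi>) (coord c p) v) = v" for v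
    using fd_compose[OF d1 d2, of v] fd_eqI[OF has_derivative_ident, of "coord c p"] by simp
  then show ?thesis by (rule inj_on_inverseI)
qed

lemma ImmD:
  assumes f: "f \<in> Imm M N" and M: "smooth_atlas M" "c \<in> M" and N: "smooth_atlas N" "d \<in> N"
    and p: "p \<in> dom_of c" "f p \<in> dom_of d"
  shows "smooth_map M N f" "linear (fd (loc_rep c d f) (coord c p))" "inj (fd (loc_rep c d f) (coord c p))"
proof -
  show s: "smooth_map M N f" using f by (simp add: Imm_def)
  show "linear (fd (loc_rep c d f) (coord c p))"
    by (rule linear_fd[OF smooth_on_differentiable[OF smooth_mapD(1)[OF s M N]]]) (use p in blast)
  show "inj (fd (loc_rep c d f) (coord c p))"
    using f M N p unfolding Imm_def by blast
qed

section \<open>Independence of charts\<close>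

locale target =
  fixes N :: "('b::topological_space, 'n::finite) atlas" and g :: "('b, 'n) tensor"
  assumes N: "smooth_atlas N" and g: "riemannian_metric N g"
begin

lemma metric_on_chart:
  assumes d: "d \<in> N" shows "metric_on (cod_of d) (g d)"
  unfolding metric_on_def
proof (intro conjI ballI)
  show "open (cod_of d)" by (rule smooth_atlasD(2)[OF N d])
  show "C1_on (cod_of d) (g d)" using g d smooth_on_C1 unfolding riemannian_metric_def by blast
  show "pos_sym (g d y)" if "y \<in> cod_of d" for y
    using g d that unfolding riemannian_metric_def pos_sym_def gip_def by blast
qed

definition trans :: "('b, 'n) chart \<Rightarrow> ('b, 'n) chart \<Rightarrow> real ^ 'n \<Rightarrow> real ^ 'n" where
  "trans d e = loc_rep d e (\<lambda>q. q)"

lemma trans_props: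
  assumes d: "d \<in> N" "e \<in> N"
  shows "open (coord d ` (dom_of d \<inter> dom_of e))" "smooth_on (coord d ` (dom_of d \<inter> dom_of e)) (trans d e)"
    "trans d e ` coord d ` (dom_of d \<inter> dom_of e) \<subseteq> cod_of e"
    "q \<in> dom_of d \<Longrightarrow> q \<in> dom_of e \<Longrightarrow> inj (fd (trans d e) (coord d q))"
    "y \<in> coord d ` (dom_of d \<inter> dom_of e) \<Longrightarrow> g d y = pb (g e (trans d e y)) (fd (trans d e) y)"
    "q \<in> dom_of d \<Longrightarrow> q \<in> dom_of e \<Longrightarrow> linear (fd (trans d e) (coord d q))"
proof -
  have sm: "smooth_on (coord d ` (dom_of d \<inter> dom_of e)) (trans d e)" "open (coord d ` (dom_of d \<inter> dom_of e))"
    using smooth_mapD(1,2)[OF smooth_map_id[OF N] N d(1) N d(2)] by (simp_all add: trans_def)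
  then show "smooth_on (coord d ` (dom_of d \<inter> dom_of e)) (trans d e)" "open (coord d ` (dom_of d \<inter> dom_of e))"
    by auto
  have c: "trans d e (coord d q) = coord e q" if "q \<in> dom_of d" for q
    unfolding trans_def by (rule loc_rep_coord[OF N d(1) that])
  then show "trans d e ` coord d ` (dom_of d \<inter> dom_of e) \<subseteq> cod_of e" by auto
  show "inj (fd (trans d e) (coord d q))" if "q \<in> dom_of d" "q \<in> dom_of e"
    unfolding trans_def using inj_fd_Diff[OF N d id_Diff[OF N]] that by simp
  have lin: "linear (fd (trans d e) (coord d q))" if "q \<in> dom_of d" "q \<in> dom_of e" for q
    by (rule linear_fd[OF smooth_on_differentiable[OF sm(1)]]) (use that in blast)
  then show "linear (fd (trans d e) (coord d q))" if "q \<in> dom_of d" "q \<in> dom_of e" using that by blast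
  assume "y \<in> coord d ` (dom_of d \<inter> dom_of e)"
  then obtain q where q: "q \<in> dom_of d" "q \<in> dom_of e" "y = coord d q" by blast
  have "q \<in> dom_of d \<inter> dom_of e" using q by blast
  then have "g d (coord d q) = transpose (jacobian (coord e \<circ> param d) (at (coord d q))) ** g e (coord e q)
      ** jacobian (coord e \<circ> param d) (at (coord d q))"
    using g d unfolding riemannian_metric_def Let_def by blast
  also have "coord e \<circ> param d = trans d e" by (simp add: trans_def loc_rep_def fun_eq_iff)
  finally show "g d y = pb (g e (trans d e y)) (fd (trans d e) y)"
    unfolding jacobian_def matrix_congruence_pb[OF lin[OF q(1,2)]] q(3) c[OF q(1)] .
qed

abbreviation "gm d q \<equiv> g d (coord d q)"

lemma gm_trans:
  assumes d: "d \<in> N" "e \<in> N" and q: "q \<in> dom_of d" "q \<in> dom_of e"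
  shows "gm d q = pb (gm e q) (fd (trans d e) (coord d q))"
proof -
  have "trans d e (coord d q) = coord e q" unfolding trans_def by (rule loc_rep_coord[OF N d(1) q(1)])
  then show ?thesis using trans_props(5)[OF d, of "coord d q"] q by auto
qed

lemma pos_sym_gm: "d \<in> N \<Longrightarrow> q \<in> dom_of d \<Longrightarrow> pos_sym (gm d q)"
  using metric_onD(3)[OF metric_on_chart] by blast

text \<open>The type \<open>field_along\<close> imposes no relation between components in different
  charts; this is the transformation law of a tangent vector at \<open>f p\<close>.\<close>

definition vec_at :: "('a, 'b, 'n) field_along \<Rightarrow> ('a \<Rightarrow> 'b) \<Rightarrow> 'a \<Rightarrow> bool" where
  "vec_at h f p \<longleftrightarrow> (\<forall>d\<in>N. \<forall>e\<in>N. f p \<in> dom_of d \<inter> dom_of e \<longrightarrow>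
     h p e = fd (trans d e) (coord d (f p)) (h p d))"

lemma vec_atD:
  "vec_at h f p \<Longrightarrow> d \<in> N \<Longrightarrow> e \<in> N \<Longrightarrow> f p \<in> dom_of d \<Longrightarrow> f p \<in> dom_of e \<Longrightarrow>
    h p e = fd (trans d e) (coord d (f p)) (h p d)"
  unfolding vec_at_def by blast

text \<open>Transition maps are isometries for the components of \<open>g\<close>, so the chart
  picked by \<open>chart_at\<close> may be replaced by any chart around the point.\<close>

lemma inner_along_eq:
  assumes h: "vec_at h f p" "vec_at k f p" and d: "d \<in> N" "f p \<in> dom_of d"
  shows "inner_along N g f h k p = gip (gm d (f p)) (h p d) (k p d)"
proof -
  define e where "e = chart_at N (f p)"
  have e: "e \<in> N" "f p \<in> dom_of e" using chart_at[OF N] by (auto simp: e_def)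
  have he: "h p e = fd (trans d e) (coord d (f p)) (h p d)" "k p e = fd (trans d e) (coord d (f p)) (k p d)"
    by (rule vec_atD[OF h(1) d(1) e(1) d(2) e(2)], rule vec_atD[OF h(2) d(1) e(1) d(2) e(2)])
  have "gip (gm e (f p)) (h p e) (k p e) = gip (gm d (f p)) (h p d) (k p d)"
    by (simp only: gm_trans[OF d(1) e(1) d(2) e(2)] gip_pb[OF trans_props(6)[OF d(1) e(1) d(2) e(2)]] he)
  then show ?thesis by (simp add: inner_along_def Let_def e_def gip_def)
qed

text \<open>Near the point the representative in \<open>e\<close> is the transition map after the
  representative in \<open>d\<close>; the transition is an isometry, so
  \<open>trace_hess_isometry\<close> applies.\<close>

lemma fd_loc_rep_trans:
  fixes M :: "('a::topological_space, 'm::finite) atlas"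
  assumes M: "smooth_atlas M" "c \<in> M" and f: "smooth_map M N f" and d: "d \<in> N" "e \<in> N"
    and p: "p \<in> dom_of c" "f p \<in> dom_of d" "f p \<in> dom_of e"
  shows "fd (loc_rep c e f) (coord c p) = (\<lambda>v. fd (trans d e) (coord d (f p)) (fd (loc_rep c d f) (coord c p) v))"
    "trace_hess (g e) (loc_rep c e f) (coord c p) =
      fd (trans d e) (coord d (f p)) (trace_hess (g d) (loc_rep c d f) (coord c p))"
proof -
  obtain S where S: "open S" "coord c p \<in> S"
    "S \<subseteq> coord c ` (dom_of c \<inter> f -` dom_of d)" "loc_rep c d f ` S \<subseteq> coord d ` (dom_of d \<inter> (\<lambda>q. q) -` dom_of e)"
    "\<forall>y\<in>S. loc_rep c e (\<lambda>q. f q) y = loc_rep d e (\<lambda>q. q) (loc_rep c d f y)"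
    by (rule loc_rep_compose[OF M N d(1) N d(2) f smooth_map_id[OF N], of p]) (use p in auto)
  let ?V = "coord d ` (dom_of d \<inter> dom_of e)"
  have eq: "loc_rep c e f y = trans d e (loc_rep c d f y)" if "y \<in> S" for y
    using bspec[OF S(5) that] by (simp add: trans_def)
  have SV: "loc_rep c d f ` S \<subseteq> ?V" using S(4) by simp
  have sm: "smooth_on S (loc_rep c d f)"
    by (rule smooth_on_subset[OF smooth_mapD(1)[OF f M N d(1)] S(3)])
  have cp: "loc_rep c d f (coord c p) = coord d (f p)" by (rule loc_rep_coord[OF M p(1)])
  note tr = trans_props[OF d]
  have pV: "coord d (f p) \<in> ?V" using p by blast
  have "fd (loc_rep c e f) (coord c p) = fd (\<lambda>y. trans d e (loc_rep c d f y)) (coord c p)"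
    by (rule fd_cong_open[OF S(1,2) eq])
  also have "\<dots> = (\<lambda>v. fd (trans d e) (coord d (f p)) (fd (loc_rep c d f) (coord c p) v))"
    using fd_compose[OF smooth_on_differentiable[OF sm S(2)], of "trans d e"] smooth_on_differentiable[OF tr(2) pV]
    by (auto simp: cp fun_eq_iff)
  finally show "fd (loc_rep c e f) (coord c p) = (\<lambda>v. fd (trans d e) (coord d (f p)) (fd (loc_rep c d f) (coord c p) v))" .
  have "trace_hess (g e) (loc_rep c e f) (coord c p) = trace_hess (g e) (\<lambda>y. trans d e (loc_rep c d f y)) (coord c p)"
    by (rule trace_hess_cong_open[OF S(1,2) eq])
  also have "\<dots> = fd (trans d e) (loc_rep c d f (coord c p)) (trace_hess (g d) (loc_rep c d f) (coord c p))"
    by (rule trace_hess_isometry[OF metric_on_chart[OF d(2)] tr(1,2,3,5) _ S(1,2) sm SV])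
      (use tr(4)[OF p(2,3)] in \<open>auto simp: cp\<close>)
  finally show "trace_hess (g e) (loc_rep c e f) (coord c p) =
      fd (trans d e) (coord d (f p)) (trace_hess (g d) (loc_rep c d f) (coord c p))" by (simp add: cp)
qed

lemma pullback_eq:
  fixes M :: "('a::topological_space, 'm::finite) atlas"
  assumes M: "smooth_atlas M" "c \<in> M" and f: "smooth_map M N f" and d: "d \<in> N"
    and p: "p \<in> dom_of c" "f p \<in> dom_of d"
  shows "pullback N g f c (coord c p) = pb (gm d (f p)) (fd (loc_rep c d f) (coord c p))"
proof -
  define e where "e = chart_at N (f p)"
  have e: "e \<in> N" "f p \<in> dom_of e" using chart_at[OF N] by (auto simp: e_def)
  have lin: "linear (fd (loc_rep c d f) (coord c p))" if "d \<in> N" "f p \<in> dom_of d" for d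
    by (rule linear_fd[OF smooth_on_differentiable[OF smooth_mapD(1)[OF f M N that(1)]]]) (use p that in blast)
  have "pullback N g f c (coord c p) = pb (gm e (f p)) (fd (loc_rep c e f) (coord c p))"
    unfolding pullback_def Let_def smooth_atlasD(5)[OF M p(1)] e_def[symmetric] jacobian_def
      matrix_congruence_pb[OF lin[OF e]] loc_rep_coord[OF M p(1)] ..
  also have "\<dots> = pb (pb (gm e (f p)) (fd (trans d e) (coord d (f p)))) (fd (loc_rep c d f) (coord c p))"
    unfolding fd_loc_rep_trans(1)[OF M f d e(1) p e(2)]
    by (rule pb_compose[OF trans_props(6)[OF d e(1) p(2) e(2)] lin[OF d p(2)]])
  finally show ?thesis unfolding gm_trans[OF d e(1) p(2) e(2)] .
qed

text \<open>The pulled back metric changes by congruence, its determinant by the square of the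
  Jacobian determinant, and the square root leaves an absolute value. This is the law required of a
  density.\<close>

lemma pullback_compose_Diff:
  fixes M :: "('a::topological_space, 'm::finite) atlas"
  assumes M: "smooth_atlas M" and f: "smooth_map M N f" and c: "c \<in> M" "c' \<in> M" and \<phi>: "smooth_map M M \<phi>"
    and p: "p \<in> dom_of c" "\<phi> p \<in> dom_of c'"
  shows "sqrt (det (pullback N g (\<lambda>q. f (\<phi> q)) c (coord c p))) =
    \<bar>det (matrix (fd (loc_rep c c' \<phi>) (coord c p)))\<bar> * sqrt (det (pullback N g f c' (coord c' (\<phi> p))))"
proof -
  define d where "d = chart_at N (f (\<phi> p))"
  have d: "d \<in> N" "f (\<phi> p) \<in> dom_of d" using chart_at[OF N] by (auto simp: d_def)
  obtain S where S: "open S" "coord c p \<in> S"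
    "S \<subseteq> coord c ` (dom_of c \<inter> \<phi> -` dom_of c')" "loc_rep c c' \<phi> ` S \<subseteq> coord c' ` (dom_of c' \<inter> f -` dom_of d)"
    "\<forall>y\<in>S. loc_rep c d (\<lambda>q. f (\<phi> q)) y = loc_rep c' d f (loc_rep c c' \<phi> y)"
    by (rule loc_rep_compose[OF M c(1) M c(2) N d(1) \<phi> f p d(2)])
  have cp: "loc_rep c c' \<phi> (coord c p) = coord c' (\<phi> p)" by (rule loc_rep_coord[OF M c(1) p(1)])
  have d1: "loc_rep c c' \<phi> differentiable at (coord c p)"
    using S(2,3) by (intro smooth_on_differentiable[OF smooth_mapD(1)[OF \<phi> M c(1) M c(2)]]) auto
  have d2: "loc_rep c' d f differentiable at (loc_rep c c' \<phi> (coord c p))"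
    using S(2,4) by (intro smooth_on_differentiable[OF smooth_mapD(1)[OF f M c(2) N d(1)]]) auto
  have "fd (loc_rep c d (\<lambda>q. f (\<phi> q))) (coord c p) = fd (\<lambda>y. loc_rep c' d f (loc_rep c c' \<phi> y)) (coord c p)"
    by (rule fd_cong_open[OF S(1,2)]) (rule bspec[OF S(5)])
  also have "\<dots> = (\<lambda>v. fd (loc_rep c' d f) (coord c' (\<phi> p)) (fd (loc_rep c c' \<phi>) (coord c p) v))"
    using fd_compose[OF d1 d2] by (simp add: fun_eq_iff cp)
  finally have fdc: "fd (loc_rep c d (\<lambda>q. f (\<phi> q))) (coord c p) =
     (\<lambda>v. fd (loc_rep c' d f) (coord c' (\<phi> p)) (fd (loc_rep c c' \<phi>) (coord c p) v))" .
  define e where "e = chart_at N (f (\<phi> (param c (coord c p))))"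
  have ed: "e = d" unfolding e_def d_def smooth_atlasD(5)[OF M c(1) p(1)] ..
  have lin: "linear (fd (loc_rep c d (\<lambda>q. f (\<phi> q))) (coord c p))"
    unfolding fdc using linear_compose[OF linear_fd[OF d1] linear_fd[OF d2]] by (simp add: o_def cp)
  have "pullback N g (\<lambda>q. f (\<phi> q)) c (coord c p) = pb (gm d (f (\<phi> p))) (fd (loc_rep c d (\<lambda>q. f (\<phi> q))) (coord c p))"
    unfolding pullback_def Let_def e_def[symmetric] ed jacobian_def
      matrix_congruence_pb[OF lin] loc_rep_coord[OF M c(1) p(1)] ..
  also have "\<dots> = pb (pullback N g f c' (coord c' (\<phi> p))) (fd (loc_rep c c' \<phi>) (coord c p))"
    unfolding fdc pullback_eq[OF M c(2) f d(1) p(2) d(2)]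
    by (rule pb_compose) (use linear_fd[OF d2] linear_fd[OF d1] in \<open>auto simp: cp\<close>)
  finally show ?thesis
    by (simp add: det_pb[OF linear_fd[OF d1]] real_sqrt_mult)
qed

text \<open>A chart change of \<open>M\<close> reparametrises the same tangent space by a linear
  bijection, so normal parts agree and tangential coordinates transform by the derivative of the
  transition.\<close>

lemma M_chart_change:
  fixes M :: "('a::topological_space, 'm::finite) atlas"
  assumes M: "smooth_atlas M" "c \<in> M" "c' \<in> M" and f: "f \<in> Imm M N" and d: "d \<in> N"
    and p: "p \<in> dom_of c" "p \<in> dom_of c'" "f p \<in> dom_of d"
  shows "nproj (gm d (f p)) (fd (loc_rep c d f) (coord c p)) h = nproj (gm d (f p)) (fd (loc_rep c' d f) (coord c' p)) h"
    "nproj (gm d (f p)) (fd (loc_rep c d f) (coord c p)) (trace_hess (g d) (loc_rep c d f) (coord c p)) =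
     nproj (gm d (f p)) (fd (loc_rep c' d f) (coord c' p)) (trace_hess (g d) (loc_rep c' d f) (coord c' p))"
    "fd (loc_rep c c' (\<lambda>q. q)) (coord c p) (tcoord (gm d (f p)) (fd (loc_rep c d f) (coord c p)) h) =
     tcoord (gm d (f p)) (fd (loc_rep c' d f) (coord c' p)) h"
proof -
  note i = ImmD[OF f M(1,2) N d p(1,3)] and i' = ImmD[OF f M(1,3) N d p(2,3)]
  let ?\<theta> = "loc_rep c c' (\<lambda>q. q)"
  obtain S where S: "open S" "coord c p \<in> S"
    "S \<subseteq> coord c ` (dom_of c \<inter> (\<lambda>q. q) -` dom_of c')" "?\<theta> ` S \<subseteq> coord c' ` (dom_of c' \<inter> f -` dom_of d)"
    "\<forall>y\<in>S. loc_rep c d (\<lambda>q. f q) y = loc_rep c' d f (?\<theta> y)"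
    by (rule loc_rep_compose[OF M(1,2) M(1,3) N d smooth_map_id[OF M(1)] i(1) p])
  have cp: "?\<theta> (coord c p) = coord c' p" by (rule loc_rep_coord[OF M(1,2) p(1)])
  have sm: "smooth_on S ?\<theta>"
    by (rule smooth_on_subset[OF smooth_mapD(1)[OF smooth_map_id[OF M(1)] M(1,2) M(1,3)] S(3)])
  note fm = smooth_mapD(1,2)[OF i(1) M(1,3) N d]
  have d2: "loc_rep c' d f differentiable at (coord c' p)"
    by (rule smooth_on_differentiable[OF fm(1)]) (use p in blast)
  have "fd (loc_rep c d f) (coord c p) = fd (\<lambda>y. loc_rep c' d f (?\<theta> y)) (coord c p)"
    by (rule fd_cong_open[OF S(1,2)]) (rule bspec[OF S(5)])
  also have "\<dots> = (\<lambda>v. fd (loc_rep c' d f) (coord c' p) (fd ?\<theta> (coord c p) v))"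
    using fd_compose[OF smooth_on_differentiable[OF sm S(2)], of "loc_rep c' d f"] d2 by (auto simp: cp fun_eq_iff)
  finally have fdc: "fd (loc_rep c d f) (coord c p) = (\<lambda>v. fd (loc_rep c' d f) (coord c' p) (fd ?\<theta> (coord c p) v))" .
  have L: "linear (fd ?\<theta> (coord c p))" by (rule linear_fd[OF smooth_on_differentiable[OF sm S(2)]])
  have Li: "inj (fd ?\<theta> (coord c p))"
    using inj_fd_Diff[OF M id_Diff[OF M(1)] p(1)] p(2) by simp
  have A: "pos_sym (gm d (f p))" by (rule pos_sym_gm[OF d p(3)])
  show np: "nproj (gm d (f p)) (fd (loc_rep c d f) (coord c p)) h = nproj (gm d (f p)) (fd (loc_rep c' d f) (coord c' p)) h" for h
    unfolding fdc by (rule nproj_reparam[OF A i'(2,3) L linear_inj_bij[OF L Li]])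
  show "fd ?\<theta> (coord c p) (tcoord (gm d (f p)) (fd (loc_rep c d f) (coord c p)) h) =
     tcoord (gm d (f p)) (fd (loc_rep c' d f) (coord c' p)) h"
    unfolding fdc by (rule tcoord_reparam[OF A i'(2,3) L linear_inj_bij[OF L Li]])
  have "trace_hess (g d) (loc_rep c d f) (coord c p) = trace_hess (g d) (\<lambda>y. loc_rep c' d f (?\<theta> y)) (coord c p)"
    by (rule trace_hess_cong_open[OF S(1,2)]) (rule bspec[OF S(5)])
  moreover have "nproj (gm d (f p)) (fd (loc_rep c' d f) (coord c' p)) (trace_hess (g d) (\<lambda>y. loc_rep c' d f (?\<theta> y)) (coord c p)) =
     nproj (gm d (f p)) (fd (loc_rep c' d f) (coord c' p)) (trace_hess (g d) (loc_rep c' d f) (coord c' p))"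
    using trace_hess_precompose[OF metric_on_chart[OF d] S(1,2) sm fm(2) S(4) fm(1), unfolded cp loc_rep_coord[OF M(1,3) p(2)]]
      p Li i'(3) by blast
  ultimately show "nproj (gm d (f p)) (fd (loc_rep c d f) (coord c p)) (trace_hess (g d) (loc_rep c d f) (coord c p)) =
     nproj (gm d (f p)) (fd (loc_rep c' d f) (coord c' p)) (trace_hess (g d) (loc_rep c' d f) (coord c' p))"
    unfolding np by simp
qed

text \<open>Replaces both the description operator and the chart chosen by \<open>chart_at\<close>;
  a projection formula in any chart around \<open>p\<close> remains.\<close>

lemma normal_part_eq:
  fixes M :: "('a::topological_space, 'm::finite) atlas"
  assumes M: "smooth_atlas M" "c \<in> M" and f: "f \<in> Imm M N" and d: "d \<in> N"
    and p: "p \<in> dom_of c" "f p \<in> dom_of d"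
  shows "normal_part M g f h p d = nproj (gm d (f p)) (fd (loc_rep c d f) (coord c p)) (h p d)"
proof -
  define c0 where "c0 = chart_at M p"
  have c0: "c0 \<in> M" "p \<in> dom_of c0" using chart_at[OF M(1)] by (auto simp: c0_def)
  note i = ImmD[OF f M(1) c0(1) N d c0(2) p(2)]
  have "normal_part M g f h p d = (THE w. is_nproj (gm d (f p)) (fd (loc_rep c0 d f) (coord c0 p)) (h p d) w)"
    unfolding normal_part_def Let_def c0_def[symmetric] is_nproj_def gip_def ..
  also have "\<dots> = nproj (gm d (f p)) (fd (loc_rep c0 d f) (coord c0 p)) (h p d)"
    unfolding is_nproj_iff[OF pos_sym_gm[OF d p(2)] i(2,3)] by simp
  also have "\<dots> = nproj (gm d (f p)) (fd (loc_rep c d f) (coord c p)) (h p d)"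
    by (rule M_chart_change(1)[OF M(1) c0(1) M(2) f d c0(2) p])
  finally show ?thesis .
qed

text \<open>Here the second fundamental form disappears: in every chart the mean curvature is the
  projected Hessian trace.\<close>

lemma mean_curvature_eq:
  fixes M :: "('a::topological_space, 'm::finite) atlas"
  assumes M: "smooth_atlas M" "c \<in> M" and f: "f \<in> Imm M N" and d: "d \<in> N"
    and p: "p \<in> dom_of c" "f p \<in> dom_of d"
  shows "mean_curvature M N g f p d =
    nproj (gm d (f p)) (fd (loc_rep c d f) (coord c p)) (trace_hess (g d) (loc_rep c d f) (coord c p))"
proof -
  define c0 where "c0 = chart_at M p"
  have c0: "c0 \<in> M" "p \<in> dom_of c0" using chart_at[OF M(1)] by (auto simp: c0_def)
  note i = ImmD[OF f M(1) c0(1) N d c0(2) p(2)]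
  let ?U = "coord c0 ` (dom_of c0 \<inter> f -` dom_of d)"
  note sm = smooth_mapD(1,2)[OF i(1) M(1) c0(1) N d]
  have lc: "loc_rep c0 d f (coord c0 q) = coord d (f q)" if "q \<in> dom_of c0" for q
    by (rule loc_rep_coord[OF M(1) c0(1) that])
  have "mean_curvature M N g f p d = nproj (g d (loc_rep c0 d f (coord c0 p))) (fd (loc_rep c0 d f) (coord c0 p))
      (trace_hess (g d) (loc_rep c0 d f) (coord c0 p))"
    unfolding mean_curvature_def Let_def c0_def[symmetric]
  proof (rule trace_second_ff[OF metric_on_chart[OF d] sm(2,1)])
    show "loc_rep c0 d f ` ?U \<subseteq> cod_of d" using lc by auto
    show "coord c0 p \<in> ?U" using c0 p by blast
    show "inj (fd (loc_rep c0 d f) (coord c0 p))" by (rule i(3))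
    fix y assume "y \<in> ?U"
    then obtain q where q: "q \<in> dom_of c0" "f q \<in> dom_of d" "y = coord c0 q" by blast
    show "pullback N g f c0 y = pb (g d (loc_rep c0 d f y)) (fd (loc_rep c0 d f) y)"
      unfolding q(3) lc[OF q(1)] by (rule pullback_eq[OF M(1) c0(1) i(1) d q(1,2)])
  qed
  also have "\<dots> = nproj (gm d (f p)) (fd (loc_rep c d f) (coord c p)) (trace_hess (g d) (loc_rep c d f) (coord c p))"
    unfolding lc[OF c0(2)] by (rule M_chart_change(2)[OF M(1) c0(1) M(2) f d c0(2) p])
  finally show ?thesis .
qed

lemma nproj_trans:
  fixes M :: "('a::topological_space, 'm::finite) atlas"
  assumes M: "smooth_atlas M" "c \<in> M" and f: "f \<in> Imm M N" and d: "d \<in> N" "e \<in> N"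
    and p: "p \<in> dom_of c" "f p \<in> dom_of d" "f p \<in> dom_of e"
  shows "nproj (gm e (f p)) (fd (loc_rep c e f) (coord c p)) (fd (trans d e) (coord d (f p)) h) =
    fd (trans d e) (coord d (f p)) (nproj (gm d (f p)) (fd (loc_rep c d f) (coord c p)) h)"
proof -
  note i = ImmD[OF f M N d(1) p(1,2)]
  show ?thesis
    unfolding fd_loc_rep_trans(1)[OF M i(1) d p]
    by (rule nproj_pushforward[OF pos_sym_gm[OF d(1) p(2)] gm_trans[OF d p(2,3)] pos_sym_gm[OF d(2) p(3)] i(2,3)
          trans_props(6)[OF d p(2,3)] trans_props(4)[OF d p(2,3)]])
qed

lemma vec_at_mean_curvature:
  fixes M :: "('a::topological_space, 'm::finite) atlas"
  assumes M: "smooth_atlas M" and f: "f \<in> Imm M N"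
  shows "vec_at (mean_curvature M N g f) f p"
  unfolding vec_at_def
proof (intro ballI impI)
  fix d e assume d: "d \<in> N" "e \<in> N" and "f p \<in> dom_of d \<inter> dom_of e"
  then have p: "f p \<in> dom_of d" "f p \<in> dom_of e" by auto
  obtain c where c: "c \<in> M" "p \<in> dom_of c" using chart_exists[OF M] by blast
  have s: "smooth_map M N f" using f by (simp add: Imm_def)
  show "mean_curvature M N g f p e = fd (trans d e) (coord d (f p)) (mean_curvature M N g f p d)"
    unfolding mean_curvature_eq[OF M c(1) f d(1) c(2) p(1)] mean_curvature_eq[OF M c(1) f d(2) c(2) p(2)]
      fd_loc_rep_trans(2)[OF M c(1) s d c(2) p]
    by (rule nproj_trans[OF M c(1) f d c(2) p])
qed

lemma vec_at_normal_part:
  fixes M :: "('a::topological_space, 'm::finite) atlas"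
  assumes M: "smooth_atlas M" and f: "f \<in> Imm M N" and h: "vec_at h f p"
  shows "vec_at (normal_part M g f h) f p"
  unfolding vec_at_def
proof (intro ballI impI)
  fix d e assume d: "d \<in> N" "e \<in> N" and pp: "f p \<in> dom_of d \<inter> dom_of e"
  then have p: "f p \<in> dom_of d" "f p \<in> dom_of e" by auto
  obtain c where c: "c \<in> M" "p \<in> dom_of c" using chart_exists[OF M] by blast
  have he: "h p e = fd (trans d e) (coord d (f p)) (h p d)" by (rule vec_atD[OF h d p])
  show "normal_part M g f h p e = fd (trans d e) (coord d (f p)) (normal_part M g f h p d)"
    unfolding normal_part_eq[OF M c(1) f d(1) c(2) p(1)] normal_part_eq[OF M c(1) f d(2) c(2) p(2)] he
    by (rule nproj_trans[OF M c(1) f d c(2) p])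
qed

end

section \<open>The volume of an immersion\<close>

lemma continuous_on_if_locally:
  assumes "\<And>x. x \<in> U \<Longrightarrow> \<exists>S. open S \<and> x \<in> S \<and> continuous_on (U \<inter> S) h"
  shows "continuous_on U h"
  unfolding continuous_on_def
proof
  fix x assume x: "x \<in> U"
  then obtain S where S: "open S" "x \<in> S" "continuous_on (U \<inter> S) h" using assms by blast
  then have "(h \<longlongrightarrow> h x) (at x within U \<inter> S)" using x by (simp add: continuous_on_def)
  moreover have "at x within U \<inter> S = at x within U" by (rule at_within_nhd[OF S(2,1)]) auto
  ultimately show "(h \<longlongrightarrow> h x) (at x within U)" by simp
qed

lemma loc_rep_image:
  assumes M: "smooth_atlas M" "c \<in> M"
  shows "loc_rep c d f ` coord c ` (dom_of c \<inter> f -` dom_of d) \<subseteq> cod_of d"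
proof
  fix y assume "y \<in> loc_rep c d f ` coord c ` (dom_of c \<inter> f -` dom_of d)"
  then obtain q where q: "q \<in> dom_of c" "f q \<in> dom_of d" "y = loc_rep c d f (coord c q)" by blast
  show "y \<in> cod_of d" unfolding q(3) loc_rep_coord[OF M q(1)] using q(2) by (rule imageI)
qed

context target
begin

definition imm_dens :: "('a \<Rightarrow> 'b) \<Rightarrow> ('a, 'm::finite) chart \<Rightarrow> real ^ 'm \<Rightarrow> real" where
  "imm_dens f c x = sqrt (det (pullback N g f c x))"

lemma imm_dens_pos:
  fixes M :: "('a::topological_space, 'm::finite) atlas"
  assumes M: "smooth_atlas M" "c \<in> M" and f: "f \<in> Imm M N" and x: "x \<in> cod_of c"
  shows "0 < imm_dens f c x"
proof -
  obtain p where p: "p \<in> dom_of c" "x = coord c p" using x by blast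
  define d where "d = chart_at N (f p)"
  have d: "d \<in> N" "f p \<in> dom_of d" using chart_at[OF N] by (auto simp: d_def)
  note i = ImmD[OF f M N d(1) p(1) d(2)]
  show ?thesis
    unfolding imm_dens_def p(2) pullback_eq[OF M i(1) d(1) p(1) d(2)] real_sqrt_gt_0_iff
    by (intro pos_sym_det_pos pos_sym_pb pos_sym_gm[OF d] i(2,3))
qed

text \<open>\<open>pullback\<close> selects a target chart separately at each point, which hides
  continuity; near each point one fixed chart computes the same density.\<close>

lemma continuous_imm_dens:
  fixes M :: "('a::topological_space, 'm::finite) atlas"
  assumes M: "smooth_atlas M" "c \<in> M" and f: "f \<in> Imm M N"
  shows "continuous_on (cod_of c) (imm_dens f c)"
proof (rule continuous_on_if_locally)
  fix x assume "x \<in> cod_of c"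
  then obtain p where p: "p \<in> dom_of c" "x = coord c p" by blast
  define d where "d = chart_at N (f p)"
  have d: "d \<in> N" "f p \<in> dom_of d" using chart_at[OF N] by (auto simp: d_def)
  have s: "smooth_map M N f" using f by (simp add: Imm_def)
  note sm = smooth_mapD[OF s M N d(1)]
  let ?S = "coord c ` (dom_of c \<inter> f -` dom_of d)"
  let ?\<phi> = "loc_rep c d f"
  have im: "?\<phi> ` ?S \<subseteq> cod_of d" by (rule loc_rep_image[OF M])
  have "C1_on ?S (\<lambda>y. pb (g d (?\<phi> y)) (\<lambda>v. fd ?\<phi> y v))"
    using C1_on_pb[OF metric_on_chart[OF d(1)] sm(1) im, of "\<lambda>v. v"] by simp
  then have "continuous_on ?S (\<lambda>y. sqrt (det (pb (g d (?\<phi> y)) (\<lambda>v. fd ?\<phi> y v))))"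
    by (intro continuous_on_real_sqrt C1_on_continuous[OF C1_on_det])
  moreover have "sqrt (det (pb (g d (?\<phi> y)) (\<lambda>v. fd ?\<phi> y v))) = imm_dens f c y" if y: "y \<in> ?S" for y
  proof -
    obtain q where q: "q \<in> dom_of c" "f q \<in> dom_of d" "y = coord c q" using y by blast
    show ?thesis
      unfolding imm_dens_def q(3) pullback_eq[OF M s d(1) q(1,2)] loc_rep_coord[OF M q(1)] ..
  qed
  ultimately have "continuous_on ?S (imm_dens f c)" by (simp cong: continuous_on_cong)
  then have "continuous_on (cod_of c \<inter> ?S) (imm_dens f c)" by (rule continuous_on_subset) auto
  then show "\<exists>S. open S \<and> x \<in> S \<and> continuous_on (cod_of c \<inter> S) (imm_dens f c)"
    using sm(2) p d(2) by (intro exI[of _ ?S]) auto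
qed

lemma imm_dens_Diff:
  fixes M :: "('a::topological_space, 'm::finite) atlas"
  assumes M: "smooth_atlas M" and f: "smooth_map M N f" and c: "c \<in> M" "c' \<in> M" and \<phi>: "smooth_map M M \<phi>"
    and x: "x \<in> coord c ` (dom_of c \<inter> \<phi> -` dom_of c')"
  shows "imm_dens (\<lambda>q. f (\<phi> q)) c x = \<bar>det (matrix (fd (loc_rep c c' \<phi>) x))\<bar> * imm_dens f c' (loc_rep c c' \<phi> x)"
proof -
  obtain p where p: "p \<in> dom_of c" "\<phi> p \<in> dom_of c'" "x = coord c p" using x by blast
  show ?thesis
    unfolding imm_dens_def p(3) loc_rep_coord[OF M c(1) p(1)] by (rule pullback_compose_Diff[OF M f c \<phi> p(1,2)])
qed

text \<open>Existence and uniqueness justify the description operator in \<open>vol_measure\<close>;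
  from here on its value is known through its density.\<close>

lemma has_density_vol:
  fixes M :: "('a::topological_space, 'm::finite) atlas"
  assumes M: "smooth_atlas M" and comp: "compact (UNIV :: 'a set)" and f: "f \<in> Imm M N"
  shows "has_density M (imm_dens f) (vol_measure M (pullback N g f))"
    "finite_measure (vol_measure M (pullback N g f))" "0 < Vol M N g f"
proof -
  have s: "smooth_map M N f" using f by (simp add: Imm_def)
  have "\<exists>\<mu>. has_density M (imm_dens f) \<mu>"
  proof (rule has_density_exists[OF M comp])
    fix c d x assume c: "c \<in> M" "d \<in> M" and x: "x \<in> coord c ` (dom_of c \<inter> dom_of d)"
    have "x \<in> coord c ` (dom_of c \<inter> (\<lambda>p. p) -` dom_of d)" using x by simp
    from imm_dens_Diff[OF M s c smooth_map_id[OF M] this]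
    show "imm_dens f c x = \<bar>det (matrix (fd (loc_rep c d (\<lambda>p. p)) x))\<bar> * imm_dens f d (loc_rep c d (\<lambda>p. p) x)"
      by simp
  qed (rule continuous_imm_dens[OF M _ f])
  then have "\<exists>!\<mu>. has_density M (imm_dens f) \<mu>" using has_density_unique[OF M comp] by blast
  then show d: "has_density M (imm_dens f) (vol_measure M (pullback N g f))"
    unfolding vol_measure_eq imm_dens_def[abs_def] by (rule theI')
  show "finite_measure (vol_measure M (pullback N g f))"
    by (rule has_density_finite_pos(1)[OF M comp continuous_imm_dens[OF M _ f] imm_dens_pos[OF M _ f] d])
  show "0 < Vol M N g f"
    unfolding Vol_def
    by (rule has_density_finite_pos(2)[OF M comp continuous_imm_dens[OF M _ f] imm_dens_pos[OF M _ f] d])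
qed

text \<open>The push forward of the volume measure of \<open>f \<circ> \<phi>\<close> by \<open>\<phi>\<close> is the volume measure of \<open>f\<close>; it is
  stated here for the inverse direction, where the densities are known.\<close>

lemma Vol_Diff_invariant:
  fixes M :: "('a::topological_space, 'm::finite) atlas"
  assumes M: "smooth_atlas M" and comp: "compact (UNIV :: 'a set)" and f: "f \<in> Imm M N" and \<phi>: "\<phi> \<in> Diff M"
  shows "Vol M N g (f \<circ> \<phi>) = Vol M N g f"
proof -
  let ?\<mu> = "vol_measure M (pullback N g f)"
  have s: "smooth_map M N f" using f by (simp add: Imm_def)
  have \<phi>': "smooth_map M M \<phi>" "bij \<phi>" "continuous_on UNIV (inv \<phi>)" using \<phi> by (auto simp: Diff_def smooth_map_def)
  note \<mu> = has_density_vol(1)[OF M comp f]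
  have sets: "sets ?\<mu> = sets borel" using \<mu> by (simp add: has_density_def)
  have im: "inv \<phi> \<in> measurable ?\<mu> borel"
    using borel_measurable_continuous_onI[OF \<phi>'(3)] sets by (simp cong: measurable_cong_sets)
  have space: "space ?\<mu> = UNIV" using sets_eq_imp_space_eq[OF sets] by simp
  define \<nu> where "\<nu> = distr ?\<mu> borel (inv \<phi>)"
  have \<nu>: "emeasure \<nu> E = emeasure ?\<mu> (\<phi> ` E)" if "E \<in> sets borel" for E
    unfolding \<nu>_def using that im space \<phi>'(2) by (simp add: emeasure_distr bij_vimage_eq_inv_image bij_imp_bij_inv inv_inv_eq)
  obtain K :: nat and cs P where P0: "\<forall>i<K. cs i \<in> M" "\<forall>i. P i \<in> sets borel" "\<forall>i<K. P i \<subseteq> dom_of (cs i)"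
    "disjoint_family P" "(\<Union>i<K. P i) = UNIV"
    by (rule finite_chart_partition[OF M comp])
  note P = P0(1-3)[rule_format] P0(4,5)
  have \<phi>m: "\<phi> \<in> borel_measurable borel"
    using \<phi>'(1) by (intro borel_measurable_continuous_onI) (simp add: smooth_map_def)
  \<comment> \<open>The partition pulled back by \<open>\<phi>\<close>, so that each piece of
    \<open>E\<close> is sent into a single chart domain.\<close>
  define Q where "Q i = \<phi> -` P i" for i
  have Q: "\<And>i. Q i \<in> sets borel" "disjoint_family Q" "(\<Union>i<K. Q i) = UNIV"
  proof -
    show "Q i \<in> sets borel" for i using measurable_sets[OF \<phi>m P(2)] by (simp add: Q_def)
    show "disjoint_family Q"
      unfolding disjoint_family_on_def
    proof (intro ballI impI)
      fix i j :: nat assume "i \<noteq> j"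
      then have "P i \<inter> P j = {}" using P(4) by (simp add: disjoint_family_on_def)
      then show "Q i \<inter> Q j = {}" unfolding Q_def by blast
    qed
    show "(\<Union>i<K. Q i) = UNIV" unfolding Q_def vimage_UN[symmetric] P(5) by simp
  qed
  have "has_density M (imm_dens (\<lambda>q. f (\<phi> q))) \<nu>"
    unfolding has_density_def
  proof (intro conjI ballI impI)
    show "sets \<nu> = sets borel" by (simp add: \<nu>_def)
    fix c E assume c: "c \<in> M" and E: "E \<in> sets borel" "E \<subseteq> dom_of c"
    have \<phi>E: "\<phi> ` E \<in> sets borel" by (rule Diff_image_borel[OF \<phi> E(1)])
    \<comment> \<open>The composite has not been shown to be an immersion, so continuity of its
      density is taken from the transformation law and not from
      \<open>continuous_imm_dens\<close>.\<close>
    have cont: "continuous_on (cod_of c) (imm_dens (\<lambda>q. f (\<phi> q)) c)"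
    proof (rule continuous_on_if_locally)
      fix x assume "x \<in> cod_of c"
      then obtain p where p: "p \<in> dom_of c" "x = coord c p" by blast
      obtain c' where c': "c' \<in> M" "\<phi> p \<in> dom_of c'" using chart_exists[OF M] by blast
      let ?S = "coord c ` (dom_of c \<inter> \<phi> -` dom_of c')" and ?\<theta> = "loc_rep c c' \<phi>"
      note sm = smooth_mapD[OF \<phi>'(1) M c M c'(1)]
      have "continuous_on ?S (\<lambda>x. det (matrix (fd ?\<theta> x)))"
        unfolding det_def matrix_def using smooth_on_continuous[OF smooth_on_fd[OF sm(1)]]
        by (intro continuous_on_sum continuous_on_mult continuous_on_const continuous_on_prod)
          (simp add: continuous_on_component)
      moreover have "continuous_on ?S (\<lambda>x. imm_dens f c' (?\<theta> x))"
        by (rule continuous_on_compose2[OF continuous_imm_dens[OF M c'(1) f] smooth_on_continuous[OF sm(1)]])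
          (rule loc_rep_image[OF M c])
      ultimately have "continuous_on ?S (\<lambda>x. \<bar>det (matrix (fd ?\<theta> x))\<bar> * imm_dens f c' (?\<theta> x))"
        by (intro continuous_on_mult continuous_on_rabs)
      then have "continuous_on ?S (imm_dens (\<lambda>q. f (\<phi> q)) c)"
        using imm_dens_Diff[OF M s c c'(1) \<phi>'(1)] by (simp cong: continuous_on_cong)
      then have "continuous_on (cod_of c \<inter> ?S) (imm_dens (\<lambda>q. f (\<phi> q)) c)" by (rule continuous_on_subset) auto
      then show "\<exists>S. open S \<and> x \<in> S \<and> continuous_on (cod_of c \<inter> S) (imm_dens (\<lambda>q. f (\<phi> q)) c)"
        using sm(2) p c'(2) by (intro exI[of _ ?S]) auto
    qed
    have part: "emeasure ?\<mu> (\<phi> ` E \<inter> P i) = (\<integral>\<^sup>+x\<in>coord c ` (E \<inter> Q i). ennreal (imm_dens (\<lambda>q. f (\<phi> q)) c x) \<partial>lborel)"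
      if i: "i < K" for i
    proof -
      have e: "\<phi> ` E \<inter> P i = \<phi> ` (E \<inter> Q i)" by (auto simp: Q_def)
      have EQ: "E \<inter> Q i \<in> sets borel" "E \<inter> Q i \<subseteq> dom_of c" "\<phi> ` (E \<inter> Q i) \<subseteq> dom_of (cs i)"
        using E P(3)[OF i] Q(1) by (auto simp: Q_def)
      have "emeasure ?\<mu> (\<phi> ` (E \<inter> Q i)) = (\<integral>\<^sup>+x\<in>coord (cs i) ` \<phi> ` (E \<inter> Q i). ennreal (imm_dens f (cs i) x) \<partial>lborel)"
        by (rule has_densityD[OF \<mu> P(1)[OF i] Diff_image_borel[OF \<phi> EQ(1)] EQ(3)])
      also have "\<dots> = (\<integral>\<^sup>+x\<in>coord c ` (E \<inter> Q i). ennreal (imm_dens (\<lambda>q. f (\<phi> q)) c x) \<partial>lborel)"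
      proof (rule nn_integral_chart_change[OF M c P(1)[OF i] \<phi> EQ continuous_imm_dens[OF M P(1)[OF i] f]])
        fix x assume x: "x \<in> coord c ` (E \<inter> Q i)"
        have "coord c ` (E \<inter> Q i) \<subseteq> coord c ` (dom_of c \<inter> \<phi> -` dom_of (cs i))"
          using EQ(2,3) by (intro image_mono) auto
        with x have "x \<in> coord c ` (dom_of c \<inter> \<phi> -` dom_of (cs i))" by (rule rev_subsetD)
        then show "imm_dens (\<lambda>q. f (\<phi> q)) c x = \<bar>det (matrix (fd (loc_rep c (cs i) \<phi>) x))\<bar> * imm_dens f (cs i) (loc_rep c (cs i) \<phi> x)"
          by (rule imm_dens_Diff[OF M s c P(1)[OF i] \<phi>'(1)])
      qed
      finally show ?thesis unfolding e .
    qed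
    have "emeasure \<nu> E = (\<Sum>i<K. emeasure ?\<mu> (\<phi> ` E \<inter> P i))"
      unfolding \<nu>[OF E(1)] by (rule emeasure_partition[OF sets P(2,4,5) \<phi>E])
    also have "\<dots> = (\<Sum>i<K. \<integral>\<^sup>+x\<in>coord c ` (E \<inter> Q i). ennreal (imm_dens (\<lambda>q. f (\<phi> q)) c x) \<partial>lborel)"
      using part by simp
    also have "\<dots> = (\<integral>\<^sup>+x\<in>coord c ` E. ennreal (imm_dens (\<lambda>q. f (\<phi> q)) c x) \<partial>lborel)"
      by (rule nn_integral_coord_partition[OF M c cont Q E])
    finally show "emeasure \<nu> E = (\<integral>\<^sup>+x\<in>coord c ` E. ennreal (imm_dens (\<lambda>q. f (\<phi> q)) c x) \<partial>lborel)" .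
  qed
  then have "has_density M (\<lambda>c x. sqrt (det (pullback N g (f \<circ> \<phi>) c x))) \<nu>"
    by (simp add: imm_dens_def[abs_def] comp_def)
  then have "vol_measure M (pullback N g (f \<circ> \<phi>)) = \<nu>"
    unfolding vol_measure_eq using has_density_unique[OF M comp] by (intro the_equality) auto
  then show ?thesis
    unfolding Vol_def using \<nu>[of UNIV] bij_is_surj[OF \<phi>'(2)] by (simp add: measure_def)
qed

section \<open>Smooth paths in charts\<close>

lemma smooth_path_local:
  assumes f: "smooth_path M N f" and "t \<in> {0..1}" "c \<in> M" "d \<in> N" "p \<in> dom_of c" "f t p \<in> dom_of d"
  obtains W F where "open W" "(t, coord c p) \<in> W" "smooth_on W F"
    "\<forall>s x. (s, x) \<in> W \<longrightarrow> s \<in> {0..1} \<longrightarrow> x \<in> cod_of c \<and> f s (param c x) \<in> dom_of d \<and> loc_rep c d (f s) x = F (s, x)"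
proof -
  obtain W F where W: "open W" "(t, coord c p) \<in> W" "smooth_on W F"
          "(\<forall>(s, x)\<in>W. s \<in> {0..1} \<longrightarrow> x \<in> coord c ` dom_of c \<and> f s (param c x) \<in> dom_of d \<and>
             loc_rep c d (f s) x = F (s, x))"
    using assms unfolding smooth_path_def by blast
  show thesis
  proof (rule that[OF W(1-3)], intro allI impI)
    fix s x assume "(s, x) \<in> W" "s \<in> {0..1}"
    then show "x \<in> cod_of c \<and> f s (param c x) \<in> dom_of d \<and> loc_rep c d (f s) x = F (s, x)"
      using bspec[OF W(4), of "(s, x)"] by simp
  qed
qed

text \<open>The function \<open>h\<close> lives on \<open>T\<close> only; at an end of the time
  interval its one-sided derivative exists because \<open>F\<close> is differentiable on a full
  neighbourhood.\<close>

lemma has_vector_derivative_time_slice: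
  fixes F :: "real \<times> 'x::real_normed_vector \<Rightarrow> 'e::real_normed_vector"
  assumes W: "open W" "(s, x) \<in> W" and F: "F differentiable at (s, x)" and s: "s \<in> T"
    and eq: "\<forall>\<sigma>. (\<sigma>, x) \<in> W \<longrightarrow> \<sigma> \<in> T \<longrightarrow> h \<sigma> = F (\<sigma>, x)"
  shows "(h has_vector_derivative fd F (s, x) (1, 0)) (at s within T)"
proof -
  have "((\<lambda>\<sigma>. (\<sigma>, x)) has_derivative (\<lambda>k. (k, 0))) (at s)"
    by (intro has_derivative_Pair has_derivative_const has_derivative_ident)
  from has_derivative_compose[OF this has_derivative_fd[OF F]]
  have "((\<lambda>\<sigma>. F (\<sigma>, x)) has_derivative (\<lambda>k. fd F (s, x) (k, 0))) (at s)" .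
  moreover have "(\<lambda>k. fd F (s, x) (k, 0)) = (\<lambda>k. k *\<^sub>R fd F (s, x) (1, 0))"
  proof
    fix k :: real
    have "(k, 0) = k *\<^sub>R (1, 0 :: 'x)" by simp
    then show "fd F (s, x) (k, 0) = k *\<^sub>R fd F (s, x) (1, 0)"
      by (simp only: linear_cmul[OF linear_fd[OF F]])
  qed
  ultimately have "((\<lambda>\<sigma>. F (\<sigma>, x)) has_derivative (\<lambda>k. k *\<^sub>R fd F (s, x) (1, 0))) (at s)" by (simp only:)
  then have 1: "((\<lambda>\<sigma>. F (\<sigma>, x)) has_vector_derivative fd F (s, x) (1, 0)) (at s within T)"
    unfolding has_vector_derivative_def by (rule has_derivative_at_withinI)
  have "open ((\<lambda>\<sigma>. (\<sigma>, x)) -` W)" by (intro open_vimage W continuous_intros)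
  moreover have "s \<in> (\<lambda>\<sigma>. (\<sigma>, x)) -` W" using W by simp
  ultimately obtain e where e: "e > 0" "ball s e \<subseteq> (\<lambda>\<sigma>. (\<sigma>, x)) -` W" using open_contains_ball by blast
  show ?thesis
  proof (rule has_vector_derivative_transform_within[OF 1 e(1) s])
    fix \<sigma> :: real assume \<sigma>: "\<sigma> \<in> T" "dist \<sigma> s < e"
    then have "\<sigma> \<in> ball s e" by (simp add: dist_commute)
    then have "(\<sigma>, x) \<in> W" using e(2) by blast
    then show "F (\<sigma>, x) = h \<sigma>" using eq \<sigma>(1) by simp
  qed
qed

lemma velocity_local:
  fixes F :: "real \<times> (real ^ 'm::finite) \<Rightarrow> real ^ 'n"
  assumes W: "open W" "(s, x) \<in> W" and F: "F differentiable at (s, x)" and s: "s \<in> {0..1}"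
    and eq: "\<forall>\<sigma> y. (\<sigma>, y) \<in> W \<longrightarrow> \<sigma> \<in> {0..1} \<longrightarrow> loc_rep c d (f \<sigma>) y = F (\<sigma>, y)"
  shows "((\<lambda>\<sigma>. coord d (f \<sigma> (param c x))) has_vector_derivative fd F (s, x) (1, 0)) (at s within {0..1})"
    "velocity f s (param c x) d = fd F (s, x) (1, 0)"
proof -
  show v: "((\<lambda>\<sigma>. coord d (f \<sigma> (param c x))) has_vector_derivative fd F (s, x) (1, 0)) (at s within {0..1})"
    by (rule has_vector_derivative_time_slice[OF W F s]) (use eq in \<open>simp add: loc_rep_def\<close>)
  show "velocity f s (param c x) d = fd F (s, x) (1, 0)"
    unfolding velocity_def by (rule vector_derivative_within_closed_interval[OF _ s v]) simp
qed

text \<open>Chain rule in time with derivatives within [0,1]. The transition map relates the two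
  coordinate curves as long as the path stays in \<open>dom_of d\<close>, which the neighbourhood
  \<open>W\<close> ensures near \<open>t\<close>.\<close>

lemma vec_at_velocity:
  fixes M :: "('a::topological_space, 'm::finite) atlas"
  assumes M: "smooth_atlas M" and f: "smooth_path M N f" and t: "t \<in> {0..1}"
  shows "vec_at (velocity f t) (f t) p"
  unfolding vec_at_def
proof (intro ballI impI)
  fix d e assume d: "d \<in> N" "e \<in> N" and "f t p \<in> dom_of d \<inter> dom_of e"
  then have p: "f t p \<in> dom_of d" "f t p \<in> dom_of e" by auto
  obtain c where c: "c \<in> M" "p \<in> dom_of c" using chart_exists[OF M] by blast
  have pp: "param c (coord c p) = p" by (rule smooth_atlasD(5)[OF M c])
  obtain W F where W: "open W" "(t, coord c p) \<in> W" "smooth_on W F"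
    "\<forall>s x. (s, x) \<in> W \<longrightarrow> s \<in> {0..1} \<longrightarrow> x \<in> cod_of c \<and> f s (param c x) \<in> dom_of d \<and> loc_rep c d (f s) x = F (s, x)"
    by (rule smooth_path_local[OF f t c(1) d(1) c(2) p(1)])
  obtain W' F' where W': "open W'" "(t, coord c p) \<in> W'" "smooth_on W' F'"
    "\<forall>s x. (s, x) \<in> W' \<longrightarrow> s \<in> {0..1} \<longrightarrow> x \<in> cod_of c \<and> f s (param c x) \<in> dom_of e \<and> loc_rep c e (f s) x = F' (s, x)"
    by (rule smooth_path_local[OF f t c(1) d(2) c(2) p(2)])
  have v: "((\<lambda>\<sigma>. coord d (f \<sigma> p)) has_vector_derivative velocity f t p d) (at t within {0..1})"
    using velocity_local[OF W(1,2) smooth_on_differentiable[OF W(3,2)] t, of c d f] W(4) unfolding pp by metis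
  have v': "((\<lambda>\<sigma>. coord e (f \<sigma> p)) has_vector_derivative velocity f t p e) (at t within {0..1})"
    using velocity_local[OF W'(1,2) smooth_on_differentiable[OF W'(3,2)] t, of c e f] W'(4) unfolding pp by metis
  have td: "trans d e differentiable at (coord d (f t p))"
    by (rule smooth_on_differentiable[OF trans_props(2)[OF d]]) (use p in blast)
  have "((trans d e \<circ> (\<lambda>\<sigma>. coord d (f \<sigma> p))) has_vector_derivative fd (trans d e) (coord d (f t p)) (velocity f t p d)) (at t within {0..1})"
    by (rule vector_derivative_diff_chain_within[OF v]) (rule has_derivative_at_withinI[OF has_derivative_fd[OF td]])
  moreover have "open ((\<lambda>\<sigma>. (\<sigma>, coord c p)) -` W)" by (intro open_vimage W continuous_intros)
  moreover have "t \<in> (\<lambda>\<sigma>. (\<sigma>, coord c p)) -` W" using W(2) by simp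
  ultimately obtain r where r: "r > 0" "ball t r \<subseteq> (\<lambda>\<sigma>. (\<sigma>, coord c p)) -` W"
    and cv: "((trans d e \<circ> (\<lambda>\<sigma>. coord d (f \<sigma> p))) has_vector_derivative fd (trans d e) (coord d (f t p)) (velocity f t p d)) (at t within {0..1})"
    using open_contains_ball by blast
  have "((\<lambda>\<sigma>. coord e (f \<sigma> p)) has_vector_derivative fd (trans d e) (coord d (f t p)) (velocity f t p d)) (at t within {0..1})"
  proof (rule has_vector_derivative_transform_within[OF cv r(1) t])
    fix \<sigma> :: real assume \<sigma>: "\<sigma> \<in> {0..1}" "dist \<sigma> t < r"
    then have "\<sigma> \<in> ball t r" by (simp add: dist_commute)
    then have "(\<sigma>, coord c p) \<in> W" using r(2) by blast
    then have "f \<sigma> (param c (coord c p)) \<in> dom_of d" using W(4) \<sigma>(1) by blast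
    then have "f \<sigma> p \<in> dom_of d" unfolding pp .
    from loc_rep_coord[OF N d(1) this, of e "\<lambda>q. q"]
    show "(trans d e \<circ> (\<lambda>\<sigma>. coord d (f \<sigma> p))) \<sigma> = coord e (f \<sigma> p)" by (simp add: trans_def)
  qed
  from vector_derivative_within_closed_interval[OF _ t this]
  show "velocity f t p e = fd (trans d e) (coord d (f t p)) (velocity f t p d)"
    by (simp add: velocity_def)
qed

section \<open>Integrands of the volume variation and of the energy\<close>

definition nvelocity :: "('a, 'm::finite) atlas \<Rightarrow> (real \<Rightarrow> 'a \<Rightarrow> 'b) \<Rightarrow> real \<Rightarrow> ('a, 'b, 'n) field_along" where
  "nvelocity M f s = normal_part M g (f s) (velocity f s)"

text \<open>Signed so that the total volume changes at minus its integral.\<close>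

definition vol_decay :: "('a::topological_space, 'm::finite) atlas \<Rightarrow> (real \<Rightarrow> 'a \<Rightarrow> 'b) \<Rightarrow> real \<Rightarrow> 'a \<Rightarrow> real" where
  "vol_decay M f s p = inner_along N g (f s) (mean_curvature M N g (f s)) (nvelocity M f s) p"

definition energy :: "('a::topological_space, 'm::finite) atlas \<Rightarrow> real \<Rightarrow> (real \<Rightarrow> 'a \<Rightarrow> 'b) \<Rightarrow> real \<Rightarrow> 'a \<Rightarrow> real" where
  "energy M A f s p = (1 + A * inner_along N g (f s) (mean_curvature M N g (f s)) (mean_curvature M N g (f s)) p) *
     inner_along N g (f s) (nvelocity M f s) (nvelocity M f s) p"

text \<open>The tangential part of the velocity as a vector field on \<open>M\<close> in chart
  coordinates. It is the field whose divergence appears in the first variation.\<close>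

definition tvec :: "(real \<Rightarrow> 'a \<Rightarrow> 'b) \<Rightarrow> real \<Rightarrow> ('a, 'm::finite) chart \<Rightarrow> real ^ 'm \<Rightarrow> real ^ 'm" where
  "tvec f s c x = (let p = param c x; d = chart_at N (f s p)
     in tcoord (gm d (f s p)) (fd (loc_rep c d (f s)) x) (velocity f s p d))"

lemma smooth_path_Imm: "smooth_path M N f \<Longrightarrow> s \<in> {0..1} \<Longrightarrow> f s \<in> Imm M N"
  by (simp add: smooth_path_def)

lemma inner_along_path:
  fixes M :: "('a::topological_space, 'm::finite) atlas"
  assumes M: "smooth_atlas M" and f: "smooth_path M N f" and s: "s \<in> {0..1}" and d: "d \<in> N" "f s p \<in> dom_of d"
  shows "vol_decay M f s p = gip (gm d (f s p)) (mean_curvature M N g (f s) p d) (nvelocity M f s p d)"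
    "energy M A f s p = (1 + A * gip (gm d (f s p)) (mean_curvature M N g (f s) p d) (mean_curvature M N g (f s) p d)) *
     gip (gm d (f s p)) (nvelocity M f s p d) (nvelocity M f s p d)"
proof -
  note i = smooth_path_Imm[OF f s]
  have v: "vec_at (nvelocity M f s) (f s) p"
    unfolding nvelocity_def by (rule vec_at_normal_part[OF M i vec_at_velocity[OF M f s]])
  note m = vec_at_mean_curvature[OF M i]
  show "vol_decay M f s p = gip (gm d (f s p)) (mean_curvature M N g (f s) p d) (nvelocity M f s p d)"
    "energy M A f s p = (1 + A * gip (gm d (f s p)) (mean_curvature M N g (f s) p d) (mean_curvature M N g (f s) p d)) *
     gip (gm d (f s p)) (nvelocity M f s p d) (nvelocity M f s p d)"
    unfolding vol_decay_def energy_def inner_along_eq[OF m v d] inner_along_eq[OF m m d] inner_along_eq[OF v v d]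
    by (rule refl)+
qed

lemma vol_decay_energy:
  fixes M :: "('a::topological_space, 'm::finite) atlas"
  assumes M: "smooth_atlas M" and f: "smooth_path M N f" and s: "s \<in> {0..1}" and A: "A > 0"
  shows "A * (vol_decay M f s p)\<^sup>2 \<le> energy M A f s p" "0 \<le> energy M A f s p"
proof -
  define d where "d = chart_at N (f s p)"
  have d: "d \<in> N" "f s p \<in> dom_of d" using chart_at[OF N] by (auto simp: d_def)
  note e = inner_along_path[OF M f s d]
  have ps: "pos_sym (gm d (f s p))" by (rule pos_sym_gm[OF d])
  define a where "a = gip (gm d (f s p)) (mean_curvature M N g (f s) p d) (mean_curvature M N g (f s) p d)"
  define b where "b = gip (gm d (f s p)) (nvelocity M f s p d) (nvelocity M f s p d)"
  have ab: "0 \<le> a" "0 \<le> b" unfolding a_def b_def by (rule pos_sym_nonneg[OF ps])+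
  have "(vol_decay M f s p)\<^sup>2 \<le> a * b"
    unfolding e(1) a_def b_def by (rule Cauchy_Schwarz_gip[OF ps])
  then have "A * (vol_decay M f s p)\<^sup>2 \<le> A * (a * b)" using A by (intro mult_left_mono) auto
  also have "\<dots> \<le> (1 + A * a) * b" using ab by (simp add: algebra_simps)
  finally show "A * (vol_decay M f s p)\<^sup>2 \<le> energy M A f s p" unfolding e(2) a_def b_def .
  show "0 \<le> energy M A f s p"
    unfolding e(2) a_def[symmetric] b_def[symmetric] using A ab by (intro mult_nonneg_nonneg) auto
qed

text \<open>An isometric chart change of the target alters neither the Gram matrix nor the
  right-hand side of the normal equations.\<close>

lemma tvec_eq:
  fixes M :: "('a::topological_space, 'm::finite) atlas"
  assumes M: "smooth_atlas M" and f: "smooth_path M N f" and s: "s \<in> {0..1}" and d: "d \<in> N" "f s p \<in> dom_of d"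
    and c: "c \<in> M" "p \<in> dom_of c"
  shows "tvec f s c (coord c p) = tcoord (gm d (f s p)) (fd (loc_rep c d (f s)) (coord c p)) (velocity f s p d)"
proof -
  define e where "e = chart_at N (f s p)"
  have e: "e \<in> N" "f s p \<in> dom_of e" using chart_at[OF N] by (auto simp: e_def)
  note i = ImmD[OF smooth_path_Imm[OF f s] M c(1) N d(1) c(2) d(2)]
  let ?P = "fd (trans d e) (coord d (f s p))" and ?T = "fd (loc_rep c d (f s)) (coord c p)"
  have P: "linear ?P" by (rule trans_props(6)[OF d(1) e(1) d(2) e(2)])
  have v: "velocity f s p e = ?P (velocity f s p d)"
    by (rule vec_atD[OF vec_at_velocity[OF M f s] d(1) e(1) d(2) e(2)])
  have "tvec f s c (coord c p) = tcoord (gm e (f s p)) (fd (loc_rep c e (f s)) (coord c p)) (velocity f s p e)"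
    unfolding tvec_def Let_def smooth_atlasD(5)[OF M c] e_def ..
  also have "\<dots> = tcoord (gm e (f s p)) (\<lambda>v. ?P (?T v)) (?P (velocity f s p d))"
    unfolding v fd_loc_rep_trans(1)[OF M c(1) i(1) d(1) e(1) c(2) d(2) e(2)] ..
  also have "\<dots> = tcoord (gm d (f s p)) ?T (velocity f s p d)"
    unfolding tcoord_def pb_compose[OF P i(2)] gm_trans[OF d(1) e(1) d(2) e(2)] gip_pb[OF P] ..
  finally show ?thesis .
qed

lemma tvec_chart_change:
  fixes M :: "('a::topological_space, 'm::finite) atlas"
  assumes M: "smooth_atlas M" and f: "smooth_path M N f" and s: "s \<in> {0..1}"
    and c: "c \<in> M" "c' \<in> M" "p \<in> dom_of c" "p \<in> dom_of c'"
  shows "tvec f s c' (coord c' p) = fd (loc_rep c c' (\<lambda>q. q)) (coord c p) (tvec f s c (coord c p))"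
proof -
  define d where "d = chart_at N (f s p)"
  have d: "d \<in> N" "f s p \<in> dom_of d" using chart_at[OF N] by (auto simp: d_def)
  show ?thesis
    unfolding tvec_eq[OF M f s d c(1,3)] tvec_eq[OF M f s d c(2,4)]
    by (rule M_chart_change(3)[OF M c(1,2) smooth_path_Imm[OF f s] d(1) c(3,4) d(2), symmetric])
qed

text \<open>All quantities of the first variation are, near each point of $[0,1] \times M$, restrictions of
  functions on an open set of $\mathbb{R} \times \mathbb{R}^m$.\<close>

definition local_variation ::
  "('a::topological_space, 'm::finite) atlas \<Rightarrow> real \<Rightarrow> (real \<Rightarrow> 'a \<Rightarrow> 'b) \<Rightarrow> ('a, 'm) chart \<Rightarrow> (real \<times> (real ^ 'm)) set \<Rightarrow>
   (real \<times> (real ^ 'm) \<Rightarrow> real) \<Rightarrow> (real \<times> (real ^ 'm) \<Rightarrow> real ^ 'm) \<Rightarrow> (real \<times> (real ^ 'm) \<Rightarrow> real) \<Rightarrow> (real \<times> (real ^ 'm) \<Rightarrow> real) \<Rightarrow> bool" where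
  "local_variation M A f c W l X k q \<longleftrightarrow> open W \<and> C1_on W l \<and> C1_on W X \<and> continuous_on W k \<and> continuous_on W q \<and>
     (\<forall>s x. (s, x) \<in> W \<longrightarrow> s \<in> {0..1} \<longrightarrow> x \<in> cod_of c \<and> imm_dens (f s) c x = l (s, x) \<and> tvec f s c x = X (s, x) \<and>
        vol_decay M f s (param c x) = k (s, x) \<and> energy M A f s (param c x) = q (s, x) \<and>
        fd l (s, x) (1, 0) = (\<Sum>i\<in>UNIV. fd (\<lambda>z. l z * X z $ i) (s, x) (0, axis i 1)) - l (s, x) * k (s, x))"

text \<open>A local extension \<open>F\<close> of the path is restricted until it satisfies the
  assumptions of \<open>coord_variation\<close>; the formulas proved there are then read at times in
  [0,1], where \<open>F\<close> is the path.\<close>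

lemma local_variation_exists:
  fixes M :: "('a::topological_space, 'm::finite) atlas"
  assumes M: "smooth_atlas M" and f: "smooth_path M N f" and t: "t \<in> {0..1}" and c: "c \<in> M" and x0: "x0 \<in> cod_of c"
  shows "\<exists>W l X k q. (t, x0) \<in> W \<and> local_variation M A f c W l X k q"
proof -
  obtain p0 where p0: "p0 \<in> dom_of c" "x0 = coord c p0" using x0 by blast
  define d where "d = chart_at N (f t p0)"
  have d: "d \<in> N" "f t p0 \<in> dom_of d" using chart_at[OF N] by (auto simp: d_def)
  obtain W F where W: "open W" "(t, coord c p0) \<in> W" "smooth_on W F"
    "\<forall>s x. (s, x) \<in> W \<longrightarrow> s \<in> {0..1} \<longrightarrow> x \<in> cod_of c \<and> f s (param c x) \<in> dom_of d \<and> loc_rep c d (f s) x = F (s, x)"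
    by (rule smooth_path_local[OF f t c d(1) p0(1) d(2)])
  \<comment> \<open>At times outside [0,1] nothing keeps \<open>F\<close> in the target chart, so
    this is imposed.\<close>
  define W1 where "W1 = F -` cod_of d \<inter> W"
  have oW1: "open W1"
    unfolding W1_def using continuous_on_open_vimage[OF W(1)] smooth_on_continuous[OF W(3)] smooth_atlasD(2)[OF N d(1)] by blast
  define H where "H z = pb (g d (F z)) (\<lambda>v. fd F z (0, v))" for z
  have F1: "smooth_on W1 F" "F ` W1 \<subseteq> cod_of d" using smooth_on_subset[OF W(3)] by (auto simp: W1_def)
  have "continuous_on W1 (\<lambda>z. det (H z))"
    unfolding H_def by (rule C1_on_continuous[OF C1_on_det[OF C1_on_pb[OF metric_on_chart[OF d(1)] F1]]])
  then have "open ((\<lambda>z. det (H z)) -` (- {0}) \<inter> W1)"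
    using continuous_on_open_vimage[OF oW1] by blast
  \<comment> \<open>Spatial injectivity is imposed in the same way, through its open determinant
    condition.\<close>
  moreover define W2 where "W2 = (\<lambda>z. det (H z)) -` (- {0}) \<inter> W1"
  ultimately have oW2: "open W2" by simp
  have W2W1: "W2 \<subseteq> W1" and W1W: "W1 \<subseteq> W" by (auto simp: W2_def W1_def)
  interpret cv: coord_variation "cod_of d" "g d" W2 F
  proof
    show "metric_on (cod_of d) (g d)" by (rule metric_on_chart[OF d(1)])
    show "smooth_on W2 F" by (rule smooth_on_subset[OF F1(1) W2W1])
    show "F ` W2 \<subseteq> cod_of d" using F1(2) W2W1 by blast
    fix z assume z: "z \<in> W2"
    have "linear (fd F z)" using z W2W1 by (intro linear_fd smooth_on_differentiable[OF F1(1)]) auto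
    moreover have "linear (\<lambda>v. (0::real, v::real ^ 'm))" by (intro linearI) auto
    ultimately have "linear (\<lambda>v. fd F z (0, v))" using linear_compose by (fastforce simp: o_def)
    then show "inj (\<lambda>v. fd F z (0, v))"
      using z by (intro pos_sym_pb_imp_inj[of "g d (F z)"]) (auto simp: W2_def H_def)
  qed (rule oW2)
  have slice: "x \<in> cod_of c" "f s (param c x) \<in> dom_of d" "F (s, x) = coord d (f s (param c x))"
    "fd (loc_rep c d (f s)) x = (\<lambda>v. fd F (s, x) (0, v))"
    "velocity f s (param c x) d = fd F (s, x) (1, 0)"
    if s: "s \<in> {0..1}" and sx: "(s, x) \<in> W1" for s x
  proof -
    have sx': "(s, x) \<in> W" using sx W1W by blast
    have a: "x \<in> cod_of c \<and> f s (param c x) \<in> dom_of d \<and> loc_rep c d (f s) x = F (s, x)" using W(4) s sx' by blast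
    then show "x \<in> cod_of c" "f s (param c x) \<in> dom_of d" by auto
    show "F (s, x) = coord d (f s (param c x))" using a by (simp add: loc_rep_def)
    have d': "F differentiable at (s, x)" by (rule smooth_on_differentiable[OF W(3) sx'])
    have "fd (loc_rep c d (f s)) x = fd (\<lambda>y. F (s, y)) x"
      by (rule fd_cong_open[OF open_slice[OF W(1), of s]]) (use W(4) s sx' in auto)
    also have "\<dots> = (\<lambda>v. fd F (s, x) (0, v))"
      by (rule fd_eqI[OF has_derivative_slice[OF d']])
    finally show "fd (loc_rep c d (f s)) x = (\<lambda>v. fd F (s, x) (0, v))" .
    show "velocity f s (param c x) d = fd F (s, x) (1, 0)"
      by (rule velocity_local(2)[OF W(1) sx' d' s]) (use W(4) in blast)
  qed
  have t0: "(t, x0) \<in> W2"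
  proof -
    have "loc_rep c d (f t) x0 = F (t, x0)" using W(2,4) t p0(2) by blast
    then have "F (t, x0) \<in> cod_of d" using loc_rep_coord[OF M c p0(1)] d(2) p0(2) by (metis imageI)
    then have in1: "(t, x0) \<in> W1" using W(2) p0(2) by (simp add: W1_def)
    note i = ImmD[OF smooth_path_Imm[OF f t] M c N d(1) p0(1) d(2)]
    have "H (t, x0) = pb (gm d (f t p0)) (fd (loc_rep c d (f t)) (coord c p0))"
      unfolding H_def slice(3,4)[OF t in1] p0(2)[symmetric] unfolding p0(2) smooth_atlasD(5)[OF M c p0(1)] slice(4)[OF t in1, symmetric, unfolded p0(2)] ..
    then have "det (H (t, x0)) \<noteq> 0"
      using pos_sym_det_nz[OF pos_sym_pb[OF pos_sym_gm[OF d] i(2,3)]] by simp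
    then show ?thesis using in1 by (simp add: W2_def)
  qed
  define q where "q z = (1 + A * gip (cv.gF z) (nproj (cv.gF z) (cv.sp z) (cv.trh z)) (nproj (cv.gF z) (cv.sp z) (cv.trh z))) *
     gip (cv.gF z) (cv.nvel z) (cv.nvel z)" for z
  define k where "k z = gip (cv.gF z) (cv.trh z) (cv.nvel z)" for z
  have "local_variation M A f c W2 cv.lam cv.tang k q"
    unfolding local_variation_def
  proof (intro conjI allI impI oW2 cv.C1_lam cv.C1_tang)
    show "continuous_on W2 k"
      unfolding k_def by (intro continuous_on_gip cv.continuous_gF cv.continuous_trh cv.continuous_nvel)
    show "continuous_on W2 q"
      unfolding q_def by (intro continuous_on_mult continuous_on_add continuous_on_const continuous_on_gip
          cv.continuous_gF cv.continuous_nproj cv.continuous_trh cv.continuous_nvel)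
    fix s x assume sx: "(s, x) \<in> W2" and s: "s \<in> {0..1}"
    then have sx1: "(s, x) \<in> W1" using W2W1 by blast
    note sl = slice[OF s sx1]
    define p where "p = param c x"
    have p: "p \<in> dom_of c" "coord c p = x" using smooth_atlasD(6,7)[OF M c sl(1)] by (auto simp: p_def)
    have dp: "f s p \<in> dom_of d" using sl(2) by (simp add: p_def)
    have gF: "cv.gF (s, x) = gm d (f s p)" unfolding cv.gF_def sl(3) p_def ..
    have sp: "fd (loc_rep c d (f s)) (coord c p) = cv.sp (s, x)" unfolding p(2) sl(4) cv.sp_def[abs_def] ..
    have vel: "velocity f s p d = cv.vel (s, x)" unfolding p_def sl(5) cv.vel_def ..
    note im = smooth_path_Imm[OF f s]
    have sm: "smooth_map M N (f s)" using im by (simp add: Imm_def)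
    have trh: "trace_hess (g d) (loc_rep c d (f s)) (coord c p) = cv.trh (s, x)"
    proof -
      have "trace_hess (g d) (loc_rep c d (f s)) x = trace_hess (g d) (\<lambda>y. F (s, y)) x"
        by (rule trace_hess_cong_open[OF open_slice[OF oW2, of s]]) (use W(4) s sx W2W1 W1W in auto)
      then show ?thesis unfolding p(2) cv.trace_hess_slice[OF sx] .
    qed
    have mc: "mean_curvature M N g (f s) p d = nproj (cv.gF (s, x)) (cv.sp (s, x)) (cv.trh (s, x))"
      unfolding mean_curvature_eq[OF M c im d(1) p(1) dp] trh sp gF ..
    have nv: "nvelocity M f s p d = cv.nvel (s, x)"
      unfolding nvelocity_def normal_part_eq[OF M c im d(1) p(1) dp] vel sp gF[symmetric] cv.nvel_def ..
    show "x \<in> cod_of c" by (rule sl(1))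
    show "imm_dens (f s) c x = cv.lam (s, x)"
      unfolding imm_dens_def p(2)[symmetric] pullback_eq[OF M c sm d(1) p(1) dp] sp
      by (simp add: cv.lam_def cv.H_def gF p(2))
    show "tvec f s c x = cv.tang (s, x)"
      using tvec_eq[OF M f s d(1) dp c p(1)] unfolding sp vel unfolding p(2) cv.tang_def gF .
    note ip = inner_along_path[OF M f s d(1) dp, unfolded mc nv gF[symmetric]]
    \<comment> \<open>Tangent vectors are orthogonal to the normal velocity, so the projection
      inside the mean curvature does not affect the pairing and \<open>k\<close> may use the
      unprojected trace.\<close>
    have "gip (cv.gF (s, x)) (cv.sp (s, x) Y) (cv.nvel (s, x)) = 0" for Y
      using is_nproj_nproj[OF cv.pos_gF[OF sx] cv.linear_sp[OF sx] cv.inj_sp[OF sx], of "cv.vel (s, x)"]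
      unfolding is_nproj_def cv.nvel_def pos_sym_commute[OF cv.pos_gF[OF sx], of "cv.sp (s, x) Y"] by blast
    then have "gip (cv.gF (s, x)) (nproj (cv.gF (s, x)) (cv.sp (s, x)) (cv.trh (s, x))) (cv.nvel (s, x)) = k (s, x)"
      unfolding nproj_def k_def gip_diff_left by simp
    then show "vol_decay M f s (param c x) = k (s, x)" unfolding p_def[symmetric] ip(1) .
    show "energy M A f s (param c x) = q (s, x)" unfolding p_def[symmetric] ip(2) q_def ..
    show "fd cv.lam (s, x) (1, 0) = (\<Sum>i\<in>UNIV. fd (\<lambda>z. cv.lam z * cv.tang z $ i) (s, x) (0, axis i 1)) - cv.lam (s, x) * k (s, x)"
      unfolding k_def by (rule cv.first_variation[OF sx])
  qed
  then show ?thesis using t0 by blast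
qed

end

section \<open>Partitions of unity and the divergence theorem\<close>

text \<open>Extending by 0 turns box integrals into integrals over the whole space, which are
  translation invariant; the second part of \<open>K\<close> keeps the shifted support inside the
  box.\<close>

lemma integral_translate_compact_support:
  fixes y :: "'a::euclidean_space \<Rightarrow> real"
  assumes cont: "continuous_on UNIV y" and y0: "\<And>x. x \<notin> K \<Longrightarrow> y x = 0"
    and K: "K \<subseteq> cbox a b" "\<And>x. x + v \<in> K \<Longrightarrow> x \<in> cbox a b"
  shows "integral (cbox a b) (\<lambda>x. y (x + v)) = integral (cbox a b) y"
proof -
  define J where "J = integral (cbox a b) y"
  have "(y has_integral J) (cbox a b)"
    unfolding J_def by (intro integrable_integral integrable_continuous continuous_on_subset[OF cont]) auto
  from has_integral_affinity[OF this, of 1 v]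
  have "((\<lambda>x. y (x + v)) has_integral J) ((\<lambda>x. x - v) ` cbox a b)" by simp
  then have "((\<lambda>x. y (x + v)) has_integral J) UNIV"
  proof (rule has_integral_on_superset)
    fix x assume x: "x \<notin> (\<lambda>x. x - v) ` cbox a b"
    have "x + v \<notin> K"
    proof
      assume "x + v \<in> K"
      then have "x + v \<in> cbox a b" using K(1) by blast
      then have "(x + v) - v \<in> (\<lambda>x. x - v) ` cbox a b" by (rule imageI)
      then show False using x by simp
    qed
    then show "y (x + v) = 0" by (rule y0)
  qed simp
  then have "((\<lambda>x. if x \<in> cbox a b then y (x + v) else 0) has_integral J) UNIV"
  proof (rule has_integral_eq[rotated])
    fix x show "y (x + v) = (if x \<in> cbox a b then y (x + v) else 0)"
      using y0[of "x + v"] K(2)[of x] by auto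
  qed
  then show ?thesis unfolding has_integral_restrict_UNIV J_def by (rule integral_unique)
qed

text \<open>The integral of the translate \<open>y (x + s e)\<close> does not depend on small
  \<open>s\<close>. Differentiating under the integral at \<open>s = 0\<close> gives the claim for
  every direction at once, without iterated integrals.\<close>

lemma integral_derivative_compact_support:
  fixes y :: "'a::euclidean_space \<Rightarrow> real"
  assumes C1: "C1_on UNIV y" and K: "compact K" "K \<subseteq> box a b" and y0: "\<And>x. x \<notin> K \<Longrightarrow> y x = 0"
  shows "integral (cbox a b) (\<lambda>x. fd y x e) = 0"
proof -
  obtain \<epsilon> where \<epsilon>: "\<epsilon> > 0" "(\<Union>x\<in>K. ball x \<epsilon>) \<subseteq> box a b"
    using compact_subset_open_imp_ball_epsilon_subset[OF K(1) open_box K(2)] by blast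
  \<comment> \<open>Shifts by less than \<open>r\<close> along \<open>e\<close> are shorter than the
    distance \<open>\<epsilon>\<close> left around \<open>K\<close>; the summand 1 covers
    \<open>e = 0\<close>.\<close>
  define r where "r = \<epsilon> / (norm e + 1)"
  have ne: "0 < norm e + 1" by (simp add: add_nonneg_pos)
  then have r: "r > 0" using \<epsilon>(1) by (simp add: r_def)
  define U where "U = {- r <..< r}"
  have cont: "continuous_on UNIV y" by (rule C1_on_continuous[OF C1])
  have I: "integral (cbox a b) (\<lambda>x. y (x + s *\<^sub>R e)) = integral (cbox a b) y" if s: "s \<in> U" for s
  proof (rule integral_translate_compact_support[OF cont y0])
    show "K \<subseteq> cbox a b" using K(2) box_subset_cbox by blast
    fix x assume x: "x + s *\<^sub>R e \<in> K"
    have "\<bar>s\<bar> * norm e < \<epsilon>"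
    proof -
      have "\<bar>s\<bar> * norm e \<le> \<bar>s\<bar> * (norm e + 1)" by (intro mult_left_mono) auto
      also have "\<dots> < r * (norm e + 1)" using s ne by (intro mult_strict_right_mono) (auto simp: U_def)
      also have "\<dots> = \<epsilon>" using ne by (simp add: r_def)
      finally show ?thesis .
    qed
    then have "x \<in> ball (x + s *\<^sub>R e) \<epsilon>" by (simp add: dist_norm)
    then show "x \<in> cbox a b" using \<epsilon>(2) x box_subset_cbox by blast
  qed auto
  have der: "((\<lambda>s. y (x + s *\<^sub>R e)) has_field_derivative fd y (x + s *\<^sub>R e) e) (at s within U)" for s x
  proof -
    have "(y has_derivative fd y (x + s *\<^sub>R e)) (at (x + s *\<^sub>R e))" by (rule C1_on_fd[OF C1]) simp
    moreover have "((\<lambda>s. x + s *\<^sub>R e) has_derivative (\<lambda>h. h *\<^sub>R e)) (at s)"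
      by (auto intro!: derivative_eq_intros)
    ultimately have "((\<lambda>s. y (x + s *\<^sub>R e)) has_derivative (\<lambda>h. fd y (x + s *\<^sub>R e) (h *\<^sub>R e))) (at s)"
      by (rule has_derivative_compose[rotated])
    moreover have "fd y (x + s *\<^sub>R e) (h *\<^sub>R e) = fd y (x + s *\<^sub>R e) e * h" for h
      using linear_cmul[OF linear_fd[OF C1_on_differentiable[OF C1]], of "x + s *\<^sub>R e" h e] by simp
    ultimately have "((\<lambda>s. y (x + s *\<^sub>R e)) has_field_derivative fd y (x + s *\<^sub>R e) e) (at s)"
      by (simp add: has_field_derivative_def)
    then show ?thesis by (rule has_field_derivative_at_within)
  qed
  have "((\<lambda>s. integral (cbox a b) (\<lambda>x. y (x + s *\<^sub>R e))) has_field_derivative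
      integral (cbox a b) (\<lambda>x. fd y (x + 0 *\<^sub>R e) e)) (at 0 within U)"
  proof (rule leibniz_rule_field_derivative)
    show "(\<lambda>x. y (x + s *\<^sub>R e)) integrable_on cbox a b" for s
      by (intro integrable_continuous continuous_on_compose2[OF cont]) (auto intro!: continuous_intros)
    have "continuous_on UNIV (\<lambda>x. fd y x e)" by (rule C1_on_continuous_fd[OF C1])
    then show "continuous_on (U \<times> cbox a b) (\<lambda>(s, x). fd y (x + s *\<^sub>R e) e)"
      unfolding case_prod_unfold by (rule continuous_on_compose2) (auto intro!: continuous_intros)
  qed (use r in \<open>auto simp: U_def der[unfolded U_def]\<close>)
  then have "((\<lambda>s. integral (cbox a b) (\<lambda>x. y (x + s *\<^sub>R e))) has_field_derivative
      integral (cbox a b) (\<lambda>x. fd y x e)) (at 0)"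
    using r at_within_open[of 0 U] by (simp add: U_def)
  moreover have "((\<lambda>s. integral (cbox a b) (\<lambda>x. y (x + s *\<^sub>R e))) has_field_derivative 0) (at 0)"
  proof (rule DERIV_cong_ev[THEN iffD2])
    show "\<forall>\<^sub>F s in nhds 0. integral (cbox a b) (\<lambda>x. y (x + s *\<^sub>R e)) = integral (cbox a b) y"
      unfolding eventually_nhds using I r by (intro exI[of _ U]) (auto simp: U_def)
  qed (auto intro!: derivative_eq_intros)
  ultimately show ?thesis by (rule DERIV_unique)
qed

lemma C1_on_Un: "C1_on S f \<Longrightarrow> C1_on T f \<Longrightarrow> open S \<Longrightarrow> open T \<Longrightarrow> C1_on (S \<union> T) f"
  by (auto intro: continuous_on_open_Un)

lemma C1_on_if_locally:
  assumes "\<And>x. x \<in> U \<Longrightarrow> \<exists>S. open S \<and> x \<in> S \<and> C1_on S f"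
  shows "C1_on U f"
proof (rule C1_onI)
  show "(f has_derivative fd f x) (at x)" if "x \<in> U" for x
    using assms[OF that] C1_on_fd by blast
  show "continuous_on U (\<lambda>x. fd f x v)" for v
  proof (rule continuous_on_if_locally)
    fix x assume "x \<in> U"
    then obtain S where "open S" "x \<in> S" "C1_on S f" using assms by blast
    then show "\<exists>S. open S \<and> x \<in> S \<and> continuous_on (U \<inter> S) (\<lambda>x. fd f x v)"
      using C1_on_continuous_fd[of S f v] continuous_on_subset[of S _ "U \<inter> S"] by blast
  qed
qed

section \<open>Bump functions and C1 partitions of unity\<close>

text \<open>Squaring the positive part makes the derivative continuous across the boundary sphere,
  and one derivative is all that the cutoffs have to offer.\<close>

lemma C1_on_bump:
  fixes x0 :: "'a::euclidean_space"
  shows "C1_on UNIV (\<lambda>x. (max 0 (r\<^sup>2 - (x - x0) \<bullet> (x - x0)))\<^sup>2)"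
proof -
  have *: "C1_on UNIV (\<lambda>u::real. (max 0 u)\<^sup>2)"
  proof (rule C1_onI)
    fix u :: real
    have "((\<lambda>u::real. (max 0 u)\<^sup>2) has_field_derivative 2 * max 0 u) (at u)"
    proof (cases "u = 0")
      case False
      have "((\<lambda>u::real. if 0 < u then u\<^sup>2 else 0) has_field_derivative (if 0 < u then 2 * u else 0)) (at u)"
      proof (cases "0 < u")
        case True
        have "((\<lambda>u::real. u\<^sup>2) has_field_derivative 2 * u) (at u)" by (auto intro!: derivative_eq_intros)
        moreover have "\<forall>\<^sub>F v in nhds u. (if 0 < v then v\<^sup>2 else 0) = v\<^sup>2"
          unfolding eventually_nhds using True by (intro exI[of _ "{0<..}"]) auto
        ultimately show ?thesis using True by (simp add: DERIV_cong_ev)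
      next
        case F: False
        have "((\<lambda>u::real. 0) has_field_derivative (0::real)) (at u)" by simp
        moreover have "\<forall>\<^sub>F v in nhds u. (if 0 < v then v\<^sup>2 else 0) = 0"
          unfolding eventually_nhds using F False by (intro exI[of _ "{..<0}"]) auto
        ultimately show ?thesis using F by (simp add: DERIV_cong_ev)
      qed
      moreover have "(\<lambda>u::real. if 0 < u then u\<^sup>2 else 0) = (\<lambda>u. (max 0 u)\<^sup>2)" by (auto simp: max_def)
      ultimately show ?thesis by (auto simp: max_def split: if_splits)
    next
      case True
      have "((\<lambda>h::real. (max 0 h)\<^sup>2 / h) \<longlongrightarrow> 0) (at 0)"
      proof (rule Lim_null_comparison)
        show "\<forall>\<^sub>F h in at 0. norm ((max 0 h)\<^sup>2 / h) \<le> \<bar>h\<bar>"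
          by (rule always_eventually) (auto simp: max_def power2_eq_square)
        show "((\<lambda>h::real. \<bar>h\<bar>) \<longlongrightarrow> 0) (at 0)"
          using tendsto_rabs[OF tendsto_ident_at[of "0::real" UNIV]] by simp
      qed
      then show ?thesis by (simp add: has_field_derivative_iff True)
    qed
    then show "((\<lambda>u::real. (max 0 u)\<^sup>2) has_derivative (\<lambda>v. 2 * max 0 u * v)) (at u)"
      by (simp add: has_field_derivative_def)
  qed (auto intro!: continuous_intros)
  have "C1_on UNIV (\<lambda>x. r\<^sup>2 - (x - x0) \<bullet> (x - x0))"
  proof (rule C1_onI)
    show "((\<lambda>x. r\<^sup>2 - (x - x0) \<bullet> (x - x0)) has_derivative (\<lambda>v. - 2 * ((x - x0) \<bullet> v))) (at x)" for x
      by (auto intro!: derivative_eq_intros simp: inner_commute)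
  qed (auto intro!: continuous_intros)
  then show ?thesis by (rule C1_on_compose[OF _ *]) auto
qed

lemma continuous_on_UNIV_charts:
  fixes M :: "('a::topological_space, 'm::finite) atlas" and h :: "'a \<Rightarrow> 'e::topological_space"
  assumes M: "smooth_atlas M" and h: "\<And>c. c \<in> M \<Longrightarrow> continuous_on (cod_of c) (\<lambda>x. h (param c x))"
  shows "continuous_on UNIV h"
proof (rule continuous_on_if_locally)
  fix q
  obtain c where c: "c \<in> M" "q \<in> dom_of c" using chart_exists[OF M] by blast
  have "continuous_on (dom_of c) (\<lambda>q. h (param c (coord c q)))"
    by (rule continuous_on_compose2[OF h[OF c(1)] smooth_atlasD(3)[OF M c(1)]]) simp
  then have "continuous_on (dom_of c) h"
    using smooth_atlasD(5)[OF M c(1)] by (auto intro: continuous_on_eq)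
  then show "\<exists>S. open S \<and> q \<in> S \<and> continuous_on (UNIV \<inter> S) h"
    using smooth_atlasD(1)[OF M c(1)] c(2) by auto
qed

definition chart_bump :: "('a, 'm::finite) chart \<Rightarrow> real ^ 'm \<Rightarrow> real \<Rightarrow> 'a \<Rightarrow> real" where
  "chart_bump c x0 r q = (if q \<in> dom_of c then (max 0 (r\<^sup>2 - (coord c q - x0) \<bullet> (coord c q - x0)))\<^sup>2 else 0)"

lemma chart_bump_support:
  fixes M :: "('a::topological_space, 'm::finite) atlas"
  assumes M: "smooth_atlas M" "c \<in> M" and r: "r > 0"
  shows "0 \<le> chart_bump c x0 r q" "chart_bump c x0 r q \<noteq> 0 \<longleftrightarrow> q \<in> dom_of c \<and> coord c q \<in> ball x0 r"
    "q \<notin> param c ` cball x0 r \<Longrightarrow> chart_bump c x0 r q = 0"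
proof -
  show "0 \<le> chart_bump c x0 r q" by (simp add: chart_bump_def)
  have "coord c q \<in> ball x0 r \<longleftrightarrow> (norm (coord c q - x0))\<^sup>2 < r\<^sup>2"
    using r by (simp add: dist_norm norm_minus_commute abs_le_square_iff[symmetric] not_le[symmetric])
  then show *: "chart_bump c x0 r q \<noteq> 0 \<longleftrightarrow> q \<in> dom_of c \<and> coord c q \<in> ball x0 r"
    unfolding chart_bump_def power2_norm_eq_inner by auto
  assume "q \<notin> param c ` cball x0 r"
  then have "\<not> (q \<in> dom_of c \<and> coord c q \<in> ball x0 r)"
    using smooth_atlasD(5)[OF M, of q] ball_subset_cball by (metis imageI subsetD)
  then show "chart_bump c x0 r q = 0" using * by blast
qed

text \<open>The support lies in the image of a closed ball, which is compact and hence closed in a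
  Hausdorff space. Its complement is open, and there the extension by 0 is trivially C1.\<close>

lemma C1_on_chart_bump:
  fixes M :: "('a::t2_space, 'm::finite) atlas"
  assumes M: "smooth_atlas M" and c: "c \<in> M" "c' \<in> M" and r: "r > 0" "cball x0 r \<subseteq> cod_of c"
  shows "C1_on (cod_of c') (\<lambda>x. chart_bump c x0 r (param c' x))"
proof (rule C1_on_if_locally)
  fix x assume x: "x \<in> cod_of c'"
  define \<tau> where "\<tau> = loc_rep c' c (\<lambda>q. q)"
  define C where "C = param c ` cball x0 r"
  have "compact C"
    unfolding C_def by (rule compact_continuous_image[OF continuous_on_subset[OF smooth_atlasD(4)[OF M c(1)] r(2)]]) simp
  then have oC: "open (- C)" using compact_imp_closed by blast
  show "\<exists>S. open S \<and> x \<in> S \<and> C1_on S (\<lambda>x. chart_bump c x0 r (param c' x))"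
  proof (cases "param c' x \<in> dom_of c")
    case True
    define S where "S = coord c' ` (dom_of c' \<inter> (\<lambda>q. q) -` dom_of c)"
    note sm = smooth_mapD[OF smooth_map_id[OF M] M c(2) M c(1), folded S_def \<tau>_def]
    have "C1_on S (\<lambda>x. (max 0 (r\<^sup>2 - (\<tau> x - x0) \<bullet> (\<tau> x - x0)))\<^sup>2)"
      by (rule C1_on_compose[OF smooth_on_C1[OF sm(1)] C1_on_bump]) simp
    then have "C1_on S (\<lambda>x. chart_bump c x0 r (param c' x))"
    proof (rule C1_on_cong_open[OF sm(2), rotated])
      fix y assume "y \<in> S"
      then have "param c' y \<in> dom_of c" using smooth_atlasD(5)[OF M c(2)] by (auto simp: S_def)
      then show "(max 0 (r\<^sup>2 - (\<tau> y - x0) \<bullet> (\<tau> y - x0)))\<^sup>2 = chart_bump c x0 r (param c' y)"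
        by (simp add: chart_bump_def \<tau>_def loc_rep_def)
    qed
    moreover have "x \<in> S"
      using smooth_atlasD(6,7)[OF M c(2) x] True unfolding S_def by (metis IntI image_eqI vimageI)
    ultimately show ?thesis using sm(2) by blast
  next
    case False
    define S where "S = coord c' ` (dom_of c' \<inter> - C)"
    have oS: "open S"
      unfolding S_def by (rule open_chart_image[OF M c(2)]) (use oC smooth_atlasD(1)[OF M c(2)] in auto)
    have "C \<subseteq> dom_of c" using r(2) smooth_atlasD(6)[OF M c(1)] by (auto simp: C_def)
    then have "param c' x \<notin> C" using False by blast
    then have "x \<in> S"
      using smooth_atlasD(6,7)[OF M c(2) x] unfolding S_def by (metis ComplI IntI image_eqI)
    moreover have "C1_on S (\<lambda>x. chart_bump c x0 r (param c' x))"
    proof (rule C1_on_cong_open[OF oS _ C1_on_const[of S 0]])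
      fix y assume "y \<in> S"
      then have "param c' y \<notin> C" using smooth_atlasD(5)[OF M c(2)] by (auto simp: S_def)
      then show "0 = chart_bump c x0 r (param c' y)"
        using chart_bump_support(3)[OF M c(1) r(1)] by (simp add: C_def)
    qed
    ultimately show ?thesis using oS by blast
  qed
qed

text \<open>Each function is tied to a coordinate box. A compact \<open>K i\<close> inside the open
  box leaves room for the translation argument, and the closed box inside the coordinate image turns
  integrals over \<open>M\<close> into integrals over boxes.\<close>

definition partition_of_unity :: "('a::topological_space, 'm::finite) atlas \<Rightarrow> 'i set \<Rightarrow> ('i \<Rightarrow> ('a, 'm) chart) \<Rightarrow>
    ('i \<Rightarrow> real ^ 'm) \<Rightarrow> ('i \<Rightarrow> real ^ 'm) \<Rightarrow> ('i \<Rightarrow> (real ^ 'm) set) \<Rightarrow> ('i \<Rightarrow> 'a \<Rightarrow> real) \<Rightarrow> bool" where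
  "partition_of_unity M D c a b K \<rho> \<longleftrightarrow> finite D \<and>
     (\<forall>i\<in>D. c i \<in> M \<and> compact (K i) \<and> K i \<subseteq> box (a i) (b i) \<and> cbox (a i) (b i) \<subseteq> cod_of (c i) \<and>
        (\<forall>q. q \<notin> param (c i) ` K i \<longrightarrow> \<rho> i q = 0) \<and>
        (\<forall>c'\<in>M. C1_on (cod_of c') (\<lambda>x. \<rho> i (param c' x)))) \<and>
     (\<forall>q. (\<Sum>i\<in>D. \<rho> i q) = 1)"

text \<open>Finitely many bumps, indexed by their centres, have a positive sum; dividing by it
  normalises them.\<close>

lemma partition_of_unity_exists:
  fixes M :: "('a::t2_space, 'm::finite) atlas"
  assumes M: "smooth_atlas M" and comp: "compact (UNIV :: 'a set)"
  shows "\<exists>(D :: 'a set) c a b K \<rho>. partition_of_unity M D c a b K \<rho>"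
proof -
  have "\<exists>c a b r. c \<in> M \<and> p \<in> dom_of c \<and> 0 < r \<and> cball (coord c p) r \<subseteq> box a b \<and> cbox a b \<subseteq> cod_of c" for p
    using chart_neighbourhood[OF M, of p] by metis
  then obtain c a b r where c: "\<And>p. c p \<in> M" "\<And>p. p \<in> dom_of (c p)" "\<And>p. 0 < r p"
    "\<And>p. cball (coord (c p) p) (r p) \<subseteq> box (a p) (b p)" "\<And>p. cbox (a p) (b p) \<subseteq> cod_of (c p)"
    by metis
  define \<beta> where "\<beta> p = chart_bump (c p) (coord (c p) p) (r p)" for p
  have sup: "0 \<le> \<beta> p q" "\<beta> p q \<noteq> 0 \<longleftrightarrow> q \<in> dom_of (c p) \<and> coord (c p) q \<in> ball (coord (c p) p) (r p)"
    "q \<notin> param (c p) ` cball (coord (c p) p) (r p) \<Longrightarrow> \<beta> p q = 0" for p q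
    unfolding \<beta>_def by (rule chart_bump_support[OF M c(1)[of p] c(3)[of p]], (assumption)?)+
  define U where "U p = dom_of (c p) \<inter> coord (c p) -` ball (coord (c p) p) (r p)" for p
  have oU: "open (U p)" for p unfolding U_def by (rule open_chart_preimage[OF M c(1)]) simp
  have pU: "p \<in> U p" for p using c(2,3) by (simp add: U_def)
  have "UNIV \<subseteq> (\<Union>p\<in>UNIV. U p)" using pU by blast
  then obtain D where D: "finite D" "UNIV \<subseteq> (\<Union>p\<in>D. U p)"
    using compactE_image[OF comp, of UNIV U] oU by metis
  define \<sigma> where "\<sigma> q = (\<Sum>p\<in>D. \<beta> p q)" for q
  have \<sigma>: "\<sigma> q > 0" for q
  proof -
    obtain p where p: "p \<in> D" "q \<in> U p" using D(2) by blast
    then have "\<beta> p q \<noteq> 0" using sup(2)[of p q] by (simp add: U_def)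
    then have "0 < \<beta> p q" using sup(1)[of p q] by simp
    then show ?thesis
      unfolding \<sigma>_def using sum_pos2[OF D(1) p(1), of "\<lambda>p. \<beta> p q"] sup(1) by blast
  qed
  define \<rho> where "\<rho> p q = \<beta> p q * inverse (\<sigma> q)" for p q
  have \<beta>1: "C1_on (cod_of c') (\<lambda>x. \<beta> p (param c' x))" if "c' \<in> M" for p c'
    unfolding \<beta>_def
    by (rule C1_on_chart_bump[OF M c(1) that c(3)]) (use c(4,5)[of p] box_subset_cbox in blast)
  have "partition_of_unity M D c a b (\<lambda>p. cball (coord (c p) p) (r p)) \<rho>"
    unfolding partition_of_unity_def
  proof (intro conjI ballI allI impI D(1) c(1,4,5) compact_cball)
    show "\<rho> p q = 0" if "q \<notin> param (c p) ` cball (coord (c p) p) (r p)" for p q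
      using sup(3)[OF that] by (simp add: \<rho>_def)
    show "C1_on (cod_of c') (\<lambda>x. \<rho> p (param c' x))" if "c' \<in> M" for p c'
      unfolding \<rho>_def \<sigma>_def
      by (intro C1_on_mult C1_on_inverse C1_on_sum \<beta>1 that) (use \<sigma> in \<open>auto simp: \<sigma>_def less_imp_neq[symmetric]\<close>)
    have "(\<Sum>p\<in>D. \<rho> p q) = \<sigma> q * inverse (\<sigma> q)" for q
      unfolding \<rho>_def \<sigma>_def by (rule sum_distrib_right[symmetric])
    then show "(\<Sum>p\<in>D. \<rho> p q) = 1" for q using \<sigma>[of q] by simp
  qed
  then show ?thesis by blast
qed

lemma continuous_on_local_eq:
  assumes "\<And>z. z \<in> T \<Longrightarrow> \<exists>W j. open W \<and> z \<in> W \<and> continuous_on W j \<and> (\<forall>w\<in>W \<inter> T. h w = j w)"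
  shows "continuous_on T h"
proof (rule continuous_on_if_locally)
  fix z assume "z \<in> T"
  then obtain W j where W: "open W" "z \<in> W" "continuous_on W j" "\<forall>w\<in>W \<inter> T. h w = j w" using assms by blast
  have "continuous_on (T \<inter> W) j" using continuous_on_subset[OF W(3)] by blast
  then have "continuous_on (T \<inter> W) h" by (rule continuous_on_eq) (use W(4) in auto)
  then show "\<exists>S. open S \<and> z \<in> S \<and> continuous_on (T \<inter> S) h" using W(1,2) by blast
qed

lemma C1_on_slice:
  fixes j :: "real \<times> 'x::euclidean_space \<Rightarrow> 'e::real_normed_vector"
  assumes "C1_on W j"
  shows "C1_on {x. (s, x) \<in> W} (\<lambda>x. j (s, x))"
proof (rule C1_on_compose[OF _ assms])
  show "C1_on {x. (s, x) \<in> W} (Pair s)"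
  proof (rule C1_onI)
    show "(Pair s has_derivative (\<lambda>v. (0, v))) (at x)" for x :: 'x
      by (intro has_derivative_Pair has_derivative_const has_derivative_ident)
  qed auto
qed auto

section \<open>The volume along a path\<close>

text \<open>Cauchy-Schwarz against the constant 1, obtained from the nonnegative integral of the
  squared deviation from the mean.\<close>

lemma (in finite_measure) integral_square_bound:
  fixes k :: "'a \<Rightarrow> real"
  assumes k: "integrable M k" "integrable M (\<lambda>x. (k x)\<^sup>2)" and V: "measure M (space M) > 0"
  shows "(integral\<^sup>L M k)\<^sup>2 \<le> measure M (space M) * (\<integral>x. (k x)\<^sup>2 \<partial>M)"
proof -
  define V where "V = measure M (space M)"
  define I where "I = integral\<^sup>L M k"
  \<comment> \<open>The mean value of \<open>k\<close>, which minimises the integral of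
    \<open>(k x - m)^2\<close>.\<close>
  define m where "m = I / V"
  have "0 \<le> (\<integral>x. (k x - m)\<^sup>2 \<partial>M)" by simp
  also have "(\<lambda>x. (k x - m)\<^sup>2) = (\<lambda>x. (k x)\<^sup>2 - 2 * m * k x + m\<^sup>2)"
    by (auto simp: power2_eq_square algebra_simps)
  also have "(\<integral>x. (k x)\<^sup>2 - 2 * m * k x + m\<^sup>2 \<partial>M) = (\<integral>x. (k x)\<^sup>2 \<partial>M) - 2 * m * I + m\<^sup>2 * V"
    using k by (simp add: I_def V_def)
  also have "\<dots> = (\<integral>x. (k x)\<^sup>2 \<partial>M) - I\<^sup>2 / V"
    using V by (simp add: m_def V_def[symmetric] power2_eq_square field_simps)
  finally have "I\<^sup>2 / V \<le> (\<integral>x. (k x)\<^sup>2 \<partial>M)" by simp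
  then show ?thesis using V by (simp add: V_def I_def pos_divide_le_eq mult.commute)
qed

locale path_of_immersions = target N g
  for N :: "('b::{t2_space,second_countable_topology}, 'n::finite) atlas" and g :: "('b, 'n) tensor" +
  fixes M :: "('a::t2_space, 'm::finite) atlas" and A :: real and f :: "real \<Rightarrow> 'a \<Rightarrow> 'b"
  assumes M: "smooth_atlas M" and comp: "compact (UNIV :: 'a set)" and A: "A > 0" and f: "smooth_path M N f"
begin

definition \<mu> :: "real \<Rightarrow> 'a measure" where "\<mu> s = vol_measure M (pullback N g (f s))"

definition dens_dt :: "('a, 'm) chart \<Rightarrow> real \<Rightarrow> real ^ 'm \<Rightarrow> real" where
  "dens_dt c s x = vector_derivative (\<lambda>\<sigma>. imm_dens (f \<sigma>) c x) (at s within {0..1})"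

lemma has_density_\<mu>: "s \<in> {0..1} \<Longrightarrow> has_density M (imm_dens (f s)) (\<mu> s)"
  unfolding \<mu>_def by (rule has_density_vol(1)[OF M comp smooth_path_Imm[OF f]])

lemma sets_\<mu>: "s \<in> {0..1} \<Longrightarrow> sets (\<mu> s) = sets borel"
  using has_density_\<mu> by (simp add: has_density_def)

lemma finite_\<mu>: "s \<in> {0..1} \<Longrightarrow> finite_measure (\<mu> s)"
  unfolding \<mu>_def by (rule has_density_vol(2)[OF M comp smooth_path_Imm[OF f]])

lemma integrable_\<mu>:
  fixes h :: "'a \<Rightarrow> real"
  assumes s: "s \<in> {0..1}" and h: "continuous_on UNIV h"
  shows "integrable (\<mu> s) h"
proof -
  have "bounded (range h)" using compact_continuous_image[OF h comp] by (rule compact_imp_bounded)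
  then obtain B where B: "\<And>q. norm (h q) \<le> B" unfolding bounded_iff by blast
  have "h \<in> borel_measurable borel" using h by (rule borel_measurable_continuous_onI)
  then have "h \<in> borel_measurable (\<mu> s)" using measurable_cong_sets[OF sets_\<mu>[OF s] refl] by blast
  then show ?thesis
    using finite_measure.integrable_const_bound[OF finite_\<mu>[OF s], of h B] B by simp
qed

lemma integral_\<mu>_cbox:
  assumes s: "s \<in> {0..1}" and c: "c \<in> M" and h: "continuous_on UNIV h"
    "\<And>p. p \<notin> param c ` cbox a b \<Longrightarrow> h p = 0" and ab: "cbox a b \<subseteq> cod_of c"
  shows "integral\<^sup>L (\<mu> s) h = integral (cbox a b) (\<lambda>x. imm_dens (f s) c x * h (param c x))"
  by (rule has_density_integral_cbox[OF M c has_density_\<mu>[OF s] continuous_imm_dens[OF M c smooth_path_Imm[OF f s]] _ h ab])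
    (use imm_dens_pos[OF M c smooth_path_Imm[OF f s]] in \<open>simp add: less_imp_le\<close>)

lemma local_variation:
  assumes "s \<in> {0..1}" "c \<in> M" "x \<in> cod_of c"
  obtains W :: "(real \<times> (real ^ 'm)) set" and l X k q where "(s, x) \<in> W" "local_variation M A f c W l X k q"
  using local_variation_exists[OF M f assms] by blast

lemma local_variationD:
  assumes lv: "local_variation M A f c W l X k q" and sx: "(s, x) \<in> W" and s: "s \<in> {0..1}"
  shows "x \<in> cod_of c" "imm_dens (f s) c x = l (s, x)" "tvec f s c x = X (s, x)" "vol_decay M f s (param c x) = k (s, x)"
    "energy M A f s (param c x) = q (s, x)"
    "fd l (s, x) (1, 0) = (\<Sum>i\<in>UNIV. fd (\<lambda>z. l z * X z $ i) (s, x) (0, axis i 1)) - l (s, x) * k (s, x)"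
  using lv sx s unfolding local_variation_def by blast+

lemma local_variation_regular:
  assumes lv: "local_variation M A f c W l X k q"
  shows "open W" "C1_on W l" "C1_on W X" "continuous_on W k" "continuous_on W q"
  using lv unfolding local_variation_def by blast+

lemma dens_dt_local:
  assumes lv: "local_variation M A f c W l X k q" and sx: "(s, x) \<in> W" and s: "s \<in> {0..1}"
  shows "((\<lambda>\<sigma>. imm_dens (f \<sigma>) c x) has_vector_derivative fd l (s, x) (1, 0)) (at s within {0..1})"
    "dens_dt c s x = fd l (s, x) (1, 0)"
proof -
  note r = local_variation_regular[OF lv]
  show v: "((\<lambda>\<sigma>. imm_dens (f \<sigma>) c x) has_vector_derivative fd l (s, x) (1, 0)) (at s within {0..1})"
    by (rule has_vector_derivative_time_slice[OF r(1) sx C1_on_differentiable[OF r(2) sx] s])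
      (use local_variationD(2)[OF lv] in blast)
  show "dens_dt c s x = fd l (s, x) (1, 0)"
    unfolding dens_dt_def by (rule vector_derivative_within_closed_interval[OF _ s v]) simp
qed

lemma dens_dt:
  assumes c: "c \<in> M" and s: "s \<in> {0..1}" and x: "x \<in> cod_of c"
  shows "((\<lambda>\<sigma>. imm_dens (f \<sigma>) c x) has_field_derivative dens_dt c s x) (at s within {0..1})"
proof -
  obtain W :: "(real \<times> (real ^ 'm)) set" and l X k q where lv: "(s, x) \<in> W" "local_variation M A f c W l X k q" by (rule local_variation[OF s c x])
  show ?thesis
    using dens_dt_local[OF lv(2,1) s] by (simp add: has_real_derivative_iff_has_vector_derivative)
qed

text \<open>Continuity in time and space together is what differentiation under the integral asks
  for. Each function is locally the restriction of a continuous function on an open set of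
  space-time.\<close>

lemma continuous_joint:
  assumes c: "c \<in> M"
  shows "continuous_on ({0..1} \<times> cod_of c) (\<lambda>(s, x). imm_dens (f s) c x)"
    "continuous_on ({0..1} \<times> cod_of c) (\<lambda>(s, x). dens_dt c s x)"
    "continuous_on ({0..1} \<times> cod_of c) (\<lambda>(s, x). energy M A f s (param c x))"
    "continuous_on ({0..1} \<times> cod_of c) (\<lambda>(s, x). vol_decay M f s (param c x))"
proof -
  \<comment> \<open>Common reduction for the four claims: it suffices to name the component of
    \<open>local_variation\<close> that extends \<open>h\<close>.\<close>
  have *: "continuous_on ({0..1} \<times> cod_of c) h"
    if j: "\<And>W l X k q. local_variation M A f c W l X k q \<Longrightarrow>
      \<exists>j. continuous_on W j \<and> (\<forall>s x. (s, x) \<in> W \<longrightarrow> s \<in> {0..1} \<longrightarrow> h (s, x) = j (s, x))" for h :: "real \<times> (real ^ 'm) \<Rightarrow> real"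
  proof (rule continuous_on_local_eq)
    fix z :: "real \<times> (real ^ 'm)" assume "z \<in> {0..1} \<times> cod_of c"
    then obtain s x where z: "z = (s, x)" "s \<in> {0..1}" "x \<in> cod_of c" by blast
    obtain W :: "(real \<times> (real ^ 'm)) set" and l X k q where lv: "(s, x) \<in> W" "local_variation M A f c W l X k q" by (rule local_variation[OF z(2) c z(3)])
    obtain j where j: "continuous_on W j" "\<forall>s x. (s, x) \<in> W \<longrightarrow> s \<in> {0..1} \<longrightarrow> h (s, x) = j (s, x)" using j[OF lv(2)] by blast
    have "\<forall>w\<in>W \<inter> {0..1} \<times> cod_of c. h w = j w" using j(2) by auto
    then show "\<exists>W j. open W \<and> z \<in> W \<and> continuous_on W j \<and> (\<forall>w\<in>W \<inter> {0..1} \<times> cod_of c. h w = j w)"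
      using lv(1) local_variation_regular(1)[OF lv(2)] j(1) z(1) by blast
  qed
  show "continuous_on ({0..1} \<times> cod_of c) (\<lambda>(s, x). imm_dens (f s) c x)"
  proof (rule *)
    fix W l X k q assume lv: "local_variation M A f c W l X k q"
    show "\<exists>j. continuous_on W j \<and> (\<forall>s x. (s, x) \<in> W \<longrightarrow> s \<in> {0..1} \<longrightarrow> (case (s, x) of (s, x) \<Rightarrow> imm_dens (f s) c x) = j (s, x))"
      using local_variationD(2)[OF lv] C1_on_continuous[OF local_variation_regular(2)[OF lv]] by (intro exI[of _ l]) simp
  qed
  show "continuous_on ({0..1} \<times> cod_of c) (\<lambda>(s, x). dens_dt c s x)"
  proof (rule *)
    fix W l X k q assume lv: "local_variation M A f c W l X k q"
    show "\<exists>j. continuous_on W j \<and> (\<forall>s x. (s, x) \<in> W \<longrightarrow> s \<in> {0..1} \<longrightarrow> (case (s, x) of (s, x) \<Rightarrow> dens_dt c s x) = j (s, x))"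
      using dens_dt_local(2)[OF lv] C1_on_continuous_fd[OF local_variation_regular(2)[OF lv], of "(1, 0)"]
      by (intro exI[of _ "\<lambda>z. fd l z (1, 0)"]) simp
  qed
  show "continuous_on ({0..1} \<times> cod_of c) (\<lambda>(s, x). energy M A f s (param c x))"
  proof (rule *)
    fix W l X k q assume lv: "local_variation M A f c W l X k q"
    show "\<exists>j. continuous_on W j \<and> (\<forall>s x. (s, x) \<in> W \<longrightarrow> s \<in> {0..1} \<longrightarrow> (case (s, x) of (s, x) \<Rightarrow> energy M A f s (param c x)) = j (s, x))"
      using local_variationD(5)[OF lv] local_variation_regular(5)[OF lv] by (intro exI[of _ q]) simp
  qed
  show "continuous_on ({0..1} \<times> cod_of c) (\<lambda>(s, x). vol_decay M f s (param c x))"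
  proof (rule *)
    fix W l X k q assume lv: "local_variation M A f c W l X k q"
    show "\<exists>j. continuous_on W j \<and> (\<forall>s x. (s, x) \<in> W \<longrightarrow> s \<in> {0..1} \<longrightarrow> (case (s, x) of (s, x) \<Rightarrow> vol_decay M f s (param c x)) = j (s, x))"
      using local_variationD(4)[OF lv] local_variation_regular(4)[OF lv] by (intro exI[of _ k]) simp
  qed
qed

lemma continuous_at_time:
  assumes s: "s \<in> {0..1}"
  shows "continuous_on UNIV (energy M A f s)" "continuous_on UNIV (vol_decay M f s)"
proof -
  have *: "continuous_on (cod_of c) (Pair s)" "Pair s ` cod_of c \<subseteq> {0..1} \<times> cod_of c" for c :: "('a, 'm) chart"
    using s by (auto intro!: continuous_intros)
  show "continuous_on UNIV (energy M A f s)"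
    by (rule continuous_on_UNIV_charts[OF M]) (use continuous_on_compose2[OF continuous_joint(3) *] in simp)
  show "continuous_on UNIV (vol_decay M f s)"
    by (rule continuous_on_UNIV_charts[OF M]) (use continuous_on_compose2[OF continuous_joint(4) *] in simp)
qed

lemma C1_tvec:
  assumes c: "c \<in> M" and s: "s \<in> {0..1}"
  shows "C1_on (cod_of c) (\<lambda>x. imm_dens (f s) c x * tvec f s c x $ i)" "C1_on (cod_of c) (tvec f s c)"
proof -
  show "C1_on (cod_of c) (tvec f s c)"
  proof (rule C1_on_if_locally)
    fix x assume x: "x \<in> cod_of c"
    obtain W :: "(real \<times> (real ^ 'm)) set" and l X k q where lv: "(s, x) \<in> W" "local_variation M A f c W l X k q" by (rule local_variation[OF s c x])
    note r = local_variation_regular[OF lv(2)]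
    have "C1_on {x. (s, x) \<in> W} (tvec f s c)"
      by (rule C1_on_cong_open[OF open_slice[OF r(1)] _ C1_on_slice[OF r(3)]])
        (use local_variationD(3)[OF lv(2) _ s] in auto)
    then show "\<exists>S. open S \<and> x \<in> S \<and> C1_on S (tvec f s c)" using open_slice[OF r(1), of s] lv(1) by blast
  qed
  show "C1_on (cod_of c) (\<lambda>x. imm_dens (f s) c x * tvec f s c x $ i)"
  proof (rule C1_on_if_locally)
    fix x assume x: "x \<in> cod_of c"
    obtain W :: "(real \<times> (real ^ 'm)) set" and l X k q where lv: "(s, x) \<in> W" "local_variation M A f c W l X k q" by (rule local_variation[OF s c x])
    note r = local_variation_regular[OF lv(2)]
    have "C1_on {x. (s, x) \<in> W} (\<lambda>x. imm_dens (f s) c x * tvec f s c x $ i)"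
      by (rule C1_on_cong_open[OF open_slice[OF r(1)] _ C1_on_slice[OF C1_on_mult[OF r(2) C1_on_nth[OF r(3), of i]]]])
        (use local_variationD(2,3)[OF lv(2) _ s] in auto)
    then show "\<exists>S. open S \<and> x \<in> S \<and> C1_on S (\<lambda>x. imm_dens (f s) c x * tvec f s c x $ i)"
      using open_slice[OF r(1), of s] lv(1) by blast
  qed
qed

lemma dens_dt_divergence:
  assumes c: "c \<in> M" and s: "s \<in> {0..1}" and x: "x \<in> cod_of c"
  shows "dens_dt c s x = (\<Sum>i\<in>UNIV. fd (\<lambda>x. imm_dens (f s) c x * tvec f s c x $ i) x (axis i 1)) -
    imm_dens (f s) c x * vol_decay M f s (param c x)"
proof -
  obtain W :: "(real \<times> (real ^ 'm)) set" and l X k q where lv: "(s, x) \<in> W" "local_variation M A f c W l X k q" by (rule local_variation[OF s c x])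
  note r = local_variation_regular[OF lv(2)]
  have "fd (\<lambda>x. imm_dens (f s) c x * tvec f s c x $ i) x = fd (\<lambda>x. l (s, x) * X (s, x) $ i) x" for i
    by (rule fd_cong_open[OF open_slice[OF r(1), of s]]) (use lv(1) local_variationD(2,3)[OF lv(2) _ s] in auto)
  also have "fd (\<lambda>x. l (s, x) * X (s, x) $ i) x = (\<lambda>v. fd (\<lambda>z. l z * X z $ i) (s, x) (0, v))" for i
    by (rule fd_eqI[OF has_derivative_slice[OF C1_on_differentiable[OF C1_on_mult[OF r(2) C1_on_nth[OF r(3)]] lv(1)]]])
  finally show ?thesis
    unfolding dens_dt_local(2)[OF lv(2,1) s] local_variationD(2,4,6)[OF lv(2,1) s] by simp
qed

section \<open>Derivatives of functions along the tangential velocity\<close>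

definition C1_fun :: "('a \<Rightarrow> real) \<Rightarrow> bool" where
  "C1_fun h \<longleftrightarrow> (\<forall>c\<in>M. C1_on (cod_of c) (\<lambda>x. h (param c x)))"

text \<open>Multiplying a divergence by a cutoff leaves, after integration by parts, the derivative
  of the cutoff along the field; this is that remainder as a function on \<open>M\<close>.\<close>

definition lie :: "('a \<Rightarrow> real) \<Rightarrow> real \<Rightarrow> 'a \<Rightarrow> real" where
  "lie h s q = (let c = chart_at M q in fd (\<lambda>x. h (param c x)) (coord c q) (tvec f s c (coord c q)))"

lemma C1_fun_continuous: "C1_fun h \<Longrightarrow> continuous_on UNIV h"
  by (rule continuous_on_UNIV_charts[OF M]) (use C1_on_continuous in \<open>unfold C1_fun_def, blast\<close>)

text \<open>The transition derivative from the chain rule is exactly the one by which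
  \<open>tvec\<close> transforms.\<close>

lemma lie_chart:
  assumes s: "s \<in> {0..1}" and h: "C1_fun h" and c: "c \<in> M" "q \<in> dom_of c"
  shows "lie h s q = fd (\<lambda>x. h (param c x)) (coord c q) (tvec f s c (coord c q))"
proof -
  define c' where "c' = chart_at M q"
  have c': "c' \<in> M" "q \<in> dom_of c'" using chart_at[OF M] by (auto simp: c'_def)
  define \<tau> where "\<tau> = loc_rep c c' (\<lambda>q. q)"
  define S where "S = coord c ` (dom_of c \<inter> (\<lambda>q. q) -` dom_of c')"
  note sm = smooth_mapD[OF smooth_map_id[OF M] M c(1) M c'(1), folded S_def \<tau>_def]
  have q: "coord c q \<in> S" "\<tau> (coord c q) = coord c' q"
    using c c' by (auto simp: S_def \<tau>_def loc_rep_def smooth_atlasD(5)[OF M])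
  have "fd (\<lambda>x. h (param c x)) (coord c q) = fd (\<lambda>x. h (param c' (\<tau> x))) (coord c q)"
    by (rule fd_cong_open[OF sm(2) q(1)])
      (auto simp: S_def \<tau>_def loc_rep_def smooth_atlasD(5)[OF M c(1)] smooth_atlasD(5)[OF M c'(1)])
  moreover have "\<tau> differentiable at (coord c q)" by (rule smooth_on_differentiable[OF sm(1) q(1)])
  moreover have "(\<lambda>x. h (param c' x)) differentiable at (\<tau> (coord c q))"
    unfolding q(2) by (rule C1_on_differentiable[of "cod_of c'"]) (use h c' in \<open>auto simp: C1_fun_def simp del: Ck_on.simps\<close>)
  ultimately have "fd (\<lambda>x. h (param c x)) (coord c q) v = fd (\<lambda>x. h (param c' x)) (coord c' q) (fd \<tau> (coord c q) v)" for v
    using fd_compose[of \<tau> "coord c q" "\<lambda>x. h (param c' x)" v] by (simp add: q(2))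
  then show ?thesis
    unfolding lie_def Let_def c'_def[symmetric] tvec_chart_change[OF M f s c(1) c'(1) c(2) c'(2)] \<tau>_def by simp
qed

lemma lie_param:
  assumes s: "s \<in> {0..1}" and h: "C1_fun h" and c: "c \<in> M" "x \<in> cod_of c"
  shows "lie h s (param c x) = fd (\<lambda>x. h (param c x)) x (tvec f s c x)"
  using lie_chart[OF s h c(1) smooth_atlasD(6)[OF M c]] smooth_atlasD(7)[OF M c] by simp

lemma continuous_lie:
  assumes s: "s \<in> {0..1}" and h: "C1_fun h"
  shows "continuous_on UNIV (lie h s)"
proof (rule continuous_on_UNIV_charts[OF M])
  fix c assume c: "c \<in> M"
  have "continuous_on (cod_of c) (\<lambda>x. fd (\<lambda>x. h (param c x)) x (tvec f s c x))"
    by (rule continuous_on_fd_joint[where S="cod_of c"])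
      (use h c C1_on_continuous[OF C1_tvec(2)[OF c s]] in \<open>auto simp: C1_fun_def simp del: Ck_on.simps\<close>)
  then show "continuous_on (cod_of c) (\<lambda>x. lie h s (param c x))"
    by (rule continuous_on_eq) (use lie_param[OF s h c] in auto)
qed

lemma lie_eq_0:
  assumes s: "s \<in> {0..1}" and h: "C1_fun h" and S: "open S" "q \<in> S" "\<And>q. q \<in> S \<Longrightarrow> h q = 0"
  shows "lie h s q = 0"
proof -
  define c where "c = chart_at M q"
  have c: "c \<in> M" "q \<in> dom_of c" using chart_at[OF M] by (auto simp: c_def)
  have "fd (\<lambda>x. h (param c x)) (coord c q) = fd (\<lambda>x. 0) (coord c q)"
  proof (rule fd_cong_open)
    show "open (coord c ` (dom_of c \<inter> S))"
      by (rule open_chart_image[OF M c(1)]) (use S smooth_atlasD(1)[OF M c(1)] in auto)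
  qed (use c S smooth_atlasD(5)[OF M c(1)] in auto)
  then show ?thesis
    unfolding lie_def Let_def c_def[symmetric] by simp
qed

text \<open>The sum is the derivative of the constant 1. This cancels the errors made by localising
  the divergence.\<close>

lemma sum_lie_partition:
  assumes s: "s \<in> {0..1}" and \<rho>: "\<And>i. i \<in> D \<Longrightarrow> C1_fun (\<rho> i)" "\<And>q. (\<Sum>i\<in>D. \<rho> i q) = 1"
  shows "(\<Sum>i\<in>D. lie (\<rho> i) s q) = 0"
proof -
  define c where "c = chart_at M q"
  have c: "c \<in> M" "q \<in> dom_of c" using chart_at[OF M] by (auto simp: c_def)
  have "((\<lambda>x. \<rho> i (param c x)) has_derivative fd (\<lambda>x. \<rho> i (param c x)) (coord c q)) (at (coord c q))" if "i \<in> D" for i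
    by (rule C1_on_fd[of "cod_of c"]) (use \<rho>(1)[OF that] c in \<open>auto simp: C1_fun_def simp del: Ck_on.simps\<close>)
  then have "((\<lambda>x. \<Sum>i\<in>D. \<rho> i (param c x)) has_derivative (\<lambda>v. \<Sum>i\<in>D. fd (\<lambda>x. \<rho> i (param c x)) (coord c q) v)) (at (coord c q))"
    by (rule has_derivative_sum)
  then have "((\<lambda>x. 1::real) has_derivative (\<lambda>v. \<Sum>i\<in>D. fd (\<lambda>x. \<rho> i (param c x)) (coord c q) v)) (at (coord c q))"
    unfolding \<rho>(2) .
  from fd_eqI[OF this] have "(\<Sum>i\<in>D. fd (\<lambda>x. \<rho> i (param c x)) (coord c q) v) = 0" for v
    by (simp add: fun_eq_iff)
  then show ?thesis unfolding lie_def Let_def c_def[symmetric] .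
qed

text \<open>The cutoff is moved inside the divergence of \<open>dens_dt_divergence\<close> by the
  product rule: the divergence of the compactly supported product integrates to 0, and the
  correction is the density times \<open>lie \<rho> s\<close>.\<close>

lemma integral_dens_dt:
  assumes s: "s \<in> {0..1}" and c: "c \<in> M" and K: "compact K" "K \<subseteq> box a b" and ab: "cbox a b \<subseteq> cod_of c"
    and \<rho>: "C1_fun \<rho>" "\<And>q. q \<notin> param c ` K \<Longrightarrow> \<rho> q = 0"
  shows "integral (cbox a b) (\<lambda>x. dens_dt c s x * \<rho> (param c x)) =
    - integral\<^sup>L (\<mu> s) (lie \<rho> s) - integral\<^sup>L (\<mu> s) (\<lambda>q. \<rho> q * vol_decay M f s q)"
proof -
  define R where "R x = \<rho> (param c x)" for x
  define Y where "Y i x = imm_dens (f s) c x * tvec f s c x $ i" for i x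
  have oc: "open (cod_of c)" by (rule smooth_atlasD(2)[OF M c])
  have R1: "C1_on (cod_of c) R" using \<rho>(1) c unfolding C1_fun_def R_def[abs_def] by blast
  have Y1: "C1_on (cod_of c) (Y i)" for i unfolding Y_def by (rule C1_tvec(1)[OF c s])
  have RY1: "C1_on (cod_of c) (\<lambda>x. R x * Y i x)" for i by (rule C1_on_mult[OF R1 Y1])
  have Kc: "K \<subseteq> cod_of c" using K(2) ab box_subset_cbox by blast
  have R0: "R x = 0" if x: "x \<in> cod_of c" "x \<notin> K" for x
    unfolding R_def
  proof (rule \<rho>(2), rule notI)
    assume "param c x \<in> param c ` K"
    then obtain y where y: "y \<in> K" "param c x = param c y" by blast
    then have "x = y" using smooth_atlasD(7)[OF M c] x(1) Kc by (metis subsetD)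
    then show False using y x(2) by blast
  qed
  have div: "((\<lambda>x. fd (\<lambda>x. R x * Y i x) x e) has_integral 0) (cbox a b)" for i e
  proof -
    \<comment> \<open>Extension by 0 to the whole space; it is C1 because the coordinate image and
      the complement of the compact \<open>K\<close> are open, cover everything and agree where they
      meet.\<close>
    define Z where "Z x = (if x \<in> cod_of c then R x * Y i x else 0)" for x
    have "C1_on (cod_of c \<union> - K) Z"
    proof (rule C1_on_Un)
      show "C1_on (cod_of c) Z" by (rule C1_on_cong_open[OF oc _ RY1[of i]]) (simp add: Z_def)
      show oK: "open (- K)" using compact_imp_closed[OF K(1)] by blast
      show "C1_on (- K) Z" by (rule C1_on_cong_open[OF oK _ C1_on_const[of _ 0]]) (simp add: Z_def R0)
    qed (rule oc)
    moreover have "cod_of c \<union> - K = UNIV" using Kc by blast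
    ultimately have "C1_on UNIV Z" by simp
    then have "integral (cbox a b) (\<lambda>x. fd Z x e) = 0"
      by (rule integral_derivative_compact_support[OF _ K]) (use R0 in \<open>auto simp: Z_def\<close>)
    moreover have "fd Z x e = fd (\<lambda>x. R x * Y i x) x e" if "x \<in> cbox a b" for x
      using fd_cong_open[OF oc, of x Z "\<lambda>x. R x * Y i x"] ab that by (auto simp: Z_def)
    ultimately have "integral (cbox a b) (\<lambda>x. fd (\<lambda>x. R x * Y i x) x e) = 0"
      using Henstock_Kurzweil_Integration.integral_cong[of "cbox a b" "\<lambda>x. fd Z x e" "\<lambda>x. fd (\<lambda>x. R x * Y i x) x e"] by simp
    moreover have "(\<lambda>x. fd (\<lambda>x. R x * Y i x) x e) integrable_on cbox a b"
      by (rule integrable_continuous[OF continuous_on_subset[OF C1_on_continuous_fd[OF RY1] ab]])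
    ultimately show ?thesis using integrable_integral by metis
  qed
  have hint: "((\<lambda>x. imm_dens (f s) c x * h (param c x)) has_integral integral\<^sup>L (\<mu> s) h) (cbox a b)"
    if h: "continuous_on UNIV h" "\<And>q. q \<notin> param c ` K \<Longrightarrow> h q = 0" for h
  proof -
    have "K \<subseteq> cbox a b" using K(2) box_subset_cbox by blast
    then have h0: "h q = 0" if "q \<notin> param c ` cbox a b" for q using h(2)[of q] that by blast
    have "continuous_on (cbox a b) (\<lambda>x. imm_dens (f s) c x * h (param c x))"
      by (intro continuous_on_mult continuous_on_subset[OF continuous_imm_dens[OF M c smooth_path_Imm[OF f s]] ab]
          continuous_on_compose2[OF h(1) continuous_on_subset[OF smooth_atlasD(4)[OF M c] ab]]) simp
    then have "(\<lambda>x. imm_dens (f s) c x * h (param c x)) integrable_on cbox a b" by (rule integrable_continuous)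
    moreover have "integral\<^sup>L (\<mu> s) h = integral (cbox a b) (\<lambda>x. imm_dens (f s) c x * h (param c x))"
      by (rule integral_\<mu>_cbox[OF s c h(1) h0 ab])
    ultimately show ?thesis using integrable_integral by metis
  qed
  have lie0: "lie \<rho> s q = 0" if "q \<notin> param c ` K" for q
  proof (rule lie_eq_0[OF s \<rho>(1)])
    have "compact (param c ` K)"
      by (rule compact_continuous_image[OF continuous_on_subset[OF smooth_atlasD(4)[OF M c] Kc] K(1)])
    then show "open (- param c ` K)" using compact_imp_closed by blast
  qed (use that \<rho>(2) in auto)
  have pt: "(\<Sum>i\<in>UNIV. fd (\<lambda>x. R x * Y i x) x (axis i 1)) - imm_dens (f s) c x * lie \<rho> s (param c x) -
      imm_dens (f s) c x * (\<rho> (param c x) * vol_decay M f s (param c x)) = dens_dt c s x * \<rho> (param c x)"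
    if "x \<in> cbox a b" for x
  proof -
    have x: "x \<in> cod_of c" using that ab by blast
    have "((\<lambda>x. R x * Y i x) has_derivative (\<lambda>v. R x * fd (Y i) x v + fd R x v * Y i x)) (at x)" for i
      by (rule has_derivative_mult[OF C1_on_fd[OF R1 x] C1_on_fd[OF Y1 x]])
    from fd_eqI[OF this] have 1: "fd (\<lambda>x. R x * Y i x) x v = R x * fd (Y i) x v + fd R x v * Y i x" for i v
      by simp
    have "fd R x (tvec f s c x) = (\<Sum>i\<in>UNIV. tvec f s c x $ i *\<^sub>R fd R x (axis i 1))"
      by (rule linear_vec_expand[OF linear_fd[OF C1_on_differentiable[OF R1 x]]])
    then have "(\<Sum>i\<in>UNIV. fd R x (axis i 1) * Y i x) = imm_dens (f s) c x * fd R x (tvec f s c x)"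
      by (simp add: Y_def sum_distrib_left mult_ac)
    moreover have "lie \<rho> s (param c x) = fd R x (tvec f s c x)"
      unfolding lie_param[OF s \<rho>(1) c x] R_def[abs_def] ..
    moreover have 2: "dens_dt c s x = (\<Sum>i\<in>UNIV. fd (Y i) x (axis i 1)) - imm_dens (f s) c x * vol_decay M f s (param c x)"
      unfolding dens_dt_divergence[OF c s x] Y_def[abs_def] ..
    ultimately show ?thesis
      unfolding 1 2 by (simp add: sum.distrib sum_distrib_left[symmetric] R_def[symmetric] algebra_simps)
  qed
  \<comment> \<open>The sum of zeros stands for the integrated divergence, one summand per
    coordinate, in the form in which \<open>has_integral_sum\<close> delivers it.\<close>
  have "((\<lambda>x. dens_dt c s x * \<rho> (param c x)) has_integral
      (\<Sum>i\<in>(UNIV::'m set). 0) - integral\<^sup>L (\<mu> s) (lie \<rho> s) - integral\<^sup>L (\<mu> s) (\<lambda>q. \<rho> q * vol_decay M f s q)) (cbox a b)"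
  proof (rule has_integral_eq[OF pt])
    show "((\<lambda>x. (\<Sum>i\<in>UNIV. fd (\<lambda>x. R x * Y i x) x (axis i 1)) - imm_dens (f s) c x * lie \<rho> s (param c x) -
        imm_dens (f s) c x * (\<rho> (param c x) * vol_decay M f s (param c x))) has_integral
      (\<Sum>i\<in>(UNIV::'m set). 0) - integral\<^sup>L (\<mu> s) (lie \<rho> s) - integral\<^sup>L (\<mu> s) (\<lambda>q. \<rho> q * vol_decay M f s q)) (cbox a b)"
      by (intro has_integral_diff has_integral_sum div hint continuous_lie[OF s \<rho>(1)] lie0 continuous_on_mult
          C1_fun_continuous[OF \<rho>(1)] continuous_at_time(2)[OF s]) (use \<rho>(2) in auto)
  qed
  from integral_unique[OF this] show ?thesis by simp
qed

lemma integral_\<mu>_partition: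
  assumes D: "partition_of_unity M D c a b K \<rho>" and s: "s \<in> {0..1}" and h: "continuous_on UNIV h"
  shows "integral\<^sup>L (\<mu> s) h =
    (\<Sum>i\<in>D. integral (cbox (a i) (b i)) (\<lambda>x. imm_dens (f s) (c i) x * (\<rho> i (param (c i) x) * h (param (c i) x))))"
proof -
  note D' = D[unfolded partition_of_unity_def]
  have \<rho>: "continuous_on UNIV (\<rho> i)" if "i \<in> D" for i
    by (rule C1_fun_continuous) (use D' that in \<open>unfold C1_fun_def, blast\<close>)
  have "integral\<^sup>L (\<mu> s) h = integral\<^sup>L (\<mu> s) (\<lambda>q. \<Sum>i\<in>D. \<rho> i q * h q)"
    using D' by (simp add: sum_distrib_right[symmetric])
  also have "\<dots> = (\<Sum>i\<in>D. integral\<^sup>L (\<mu> s) (\<lambda>q. \<rho> i q * h q))"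
    by (rule Bochner_Integration.integral_sum) (intro integrable_\<mu>[OF s] continuous_on_mult \<rho> h)
  also have "\<dots> = (\<Sum>i\<in>D. integral (cbox (a i) (b i)) (\<lambda>x. imm_dens (f s) (c i) x * (\<rho> i (param (c i) x) * h (param (c i) x))))"
  proof (rule sum.cong[OF refl])
    fix i assume i: "i \<in> D"
    then have Di: "c i \<in> M" "K i \<subseteq> box (a i) (b i)" "cbox (a i) (b i) \<subseteq> cod_of (c i)"
      "\<And>q. q \<notin> param (c i) ` K i \<Longrightarrow> \<rho> i q = 0" using D' by auto
    show "integral\<^sup>L (\<mu> s) (\<lambda>q. \<rho> i q * h q) =
      integral (cbox (a i) (b i)) (\<lambda>x. imm_dens (f s) (c i) x * (\<rho> i (param (c i) x) * h (param (c i) x)))"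
    proof (rule integral_\<mu>_cbox[OF s Di(1) _ _ Di(3)])
      fix q assume "q \<notin> param (c i) ` cbox (a i) (b i)"
      then have "q \<notin> param (c i) ` K i" using Di(2) box_subset_cbox by blast
      then show "\<rho> i q * h q = 0" using Di(4) by simp
    qed (intro continuous_on_mult \<rho> i h)
  qed
  finally show ?thesis .
qed

lemma continuous_on_joint_cbox:
  fixes h :: "real \<Rightarrow> real ^ 'm \<Rightarrow> real"
  assumes c: "c \<in> M" "cbox a b \<subseteq> cod_of c" and h: "continuous_on ({0..1} \<times> cod_of c) (\<lambda>(s, x). h s x)"
    and r: "continuous_on (cod_of c) r"
  shows "continuous_on ({0..1} \<times> cbox a b) (\<lambda>(s, x). h s x * r x)"
proof -
  have "continuous_on ({0..1} \<times> cbox a b) (\<lambda>(s, x). h s x)"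
    by (rule continuous_on_subset[OF h]) (use c in auto)
  moreover have "continuous_on ({0..1} \<times> cbox a b) (\<lambda>z. r (snd z))"
    by (rule continuous_on_compose2[OF r continuous_on_snd[OF continuous_on_id]]) (use c in auto)
  ultimately show ?thesis
    using continuous_on_mult[of "{0..1} \<times> cbox a b" "\<lambda>z. h (fst z) (snd z)" "\<lambda>z. r (snd z)"]
    by (simp add: case_prod_unfold)
qed

text \<open>A partition of unity that does not depend on time writes the volume as a finite sum of
  integrals over fixed boxes, each differentiable under the integral sign. Summing restores
  \<open>vol_decay\<close> and cancels the derivatives of the cutoffs.\<close>

lemma Vol_derivative:
  assumes s: "s \<in> {0..1}"
  shows "((\<lambda>\<sigma>. Vol M N g (f \<sigma>)) has_field_derivative - integral\<^sup>L (\<mu> s) (vol_decay M f s)) (at s within {0..1})"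
proof -
  obtain D :: "'a set" and c a b K \<rho> where D: "partition_of_unity M D c a b K \<rho>"
    using partition_of_unity_exists[OF M comp] by blast
  note D' = D[unfolded partition_of_unity_def]
  have \<rho>: "C1_fun (\<rho> i)" if "i \<in> D" for i using D' that unfolding C1_fun_def by blast
  have \<rho>c: "continuous_on (cod_of (c i)) (\<lambda>x. \<rho> i (param (c i) x))" if "i \<in> D" for i
    by (rule C1_on_continuous) (use D' that in blast)
  have Vol: "Vol M N g (f \<sigma>) = (\<Sum>i\<in>D. integral (cbox (a i) (b i)) (\<lambda>x. imm_dens (f \<sigma>) (c i) x * \<rho> i (param (c i) x)))"
    if \<sigma>: "\<sigma> \<in> {0..1}" for \<sigma>
  proof -
    have "space (\<mu> \<sigma>) = UNIV" using sets_eq_imp_space_eq[OF sets_\<mu>[OF \<sigma>]] by simp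
    then have "Vol M N g (f \<sigma>) = integral\<^sup>L (\<mu> \<sigma>) (\<lambda>q. 1)" by (simp add: Vol_def \<mu>_def)
    also have "\<dots> = (\<Sum>i\<in>D. integral (cbox (a i) (b i)) (\<lambda>x. imm_dens (f \<sigma>) (c i) x * \<rho> i (param (c i) x)))"
      using integral_\<mu>_partition[OF D \<sigma>, of "\<lambda>q. 1"] by simp
    finally show ?thesis .
  qed
  have der: "((\<lambda>\<sigma>. integral (cbox (a i) (b i)) (\<lambda>x. imm_dens (f \<sigma>) (c i) x * \<rho> i (param (c i) x))) has_field_derivative
      integral (cbox (a i) (b i)) (\<lambda>x. dens_dt (c i) s x * \<rho> i (param (c i) x))) (at s within {0..1})" if i: "i \<in> D" for i
  proof (rule leibniz_rule_field_derivative[OF _ _ _ s])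
    have ci: "c i \<in> M" "cbox (a i) (b i) \<subseteq> cod_of (c i)" using D' i by auto
    show "((\<lambda>\<sigma>. imm_dens (f \<sigma>) (c i) x * \<rho> i (param (c i) x)) has_field_derivative
        dens_dt (c i) \<sigma> x * \<rho> i (param (c i) x)) (at \<sigma> within {0..1})"
      if "\<sigma> \<in> {0..1}" "x \<in> cbox (a i) (b i)" for \<sigma> x
      by (rule DERIV_cmult_right[OF dens_dt[OF ci(1) that(1)]]) (use that(2) ci(2) in blast)
    show "(\<lambda>x. imm_dens (f \<sigma>) (c i) x * \<rho> i (param (c i) x)) integrable_on cbox (a i) (b i)" if "\<sigma> \<in> {0..1}" for \<sigma>
      by (intro integrable_continuous continuous_on_mult continuous_on_subset[OF \<rho>c[OF i] ci(2)]
          continuous_on_subset[OF continuous_imm_dens[OF M ci(1) smooth_path_Imm[OF f that]] ci(2)])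
    show "continuous_on ({0..1} \<times> cbox (a i) (b i)) (\<lambda>(\<sigma>, x). dens_dt (c i) \<sigma> x * \<rho> i (param (c i) x))"
      by (rule continuous_on_joint_cbox[OF ci continuous_joint(2)[OF ci(1)] \<rho>c[OF i]])
  qed simp
  have "((\<lambda>\<sigma>. \<Sum>i\<in>D. integral (cbox (a i) (b i)) (\<lambda>x. imm_dens (f \<sigma>) (c i) x * \<rho> i (param (c i) x))) has_field_derivative
      (\<Sum>i\<in>D. integral (cbox (a i) (b i)) (\<lambda>x. dens_dt (c i) s x * \<rho> i (param (c i) x)))) (at s within {0..1})"
    by (rule DERIV_sum[OF der])
  also have "(\<Sum>i\<in>D. integral (cbox (a i) (b i)) (\<lambda>x. dens_dt (c i) s x * \<rho> i (param (c i) x))) =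
      (\<Sum>i\<in>D. - integral\<^sup>L (\<mu> s) (lie (\<rho> i) s) - integral\<^sup>L (\<mu> s) (\<lambda>q. \<rho> i q * vol_decay M f s q))"
    by (rule sum.cong[OF refl], rule integral_dens_dt[OF s]) (use D' \<rho> in blast)+
  also have "\<dots> = - (\<Sum>i\<in>D. integral\<^sup>L (\<mu> s) (lie (\<rho> i) s)) - (\<Sum>i\<in>D. integral\<^sup>L (\<mu> s) (\<lambda>q. \<rho> i q * vol_decay M f s q))"
    by (simp add: sum_subtractf sum_negf)
  also have "(\<Sum>i\<in>D. integral\<^sup>L (\<mu> s) (lie (\<rho> i) s)) = (\<integral>q. (\<Sum>i\<in>D. lie (\<rho> i) s q) \<partial>\<mu> s)"
    by (rule Bochner_Integration.integral_sum[symmetric], rule integrable_\<mu>[OF s continuous_lie[OF s \<rho>]])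
  also have "\<dots> = 0"
    using sum_lie_partition[OF s, of D \<rho>] \<rho> D' by simp
  also have "(\<Sum>i\<in>D. integral\<^sup>L (\<mu> s) (\<lambda>q. \<rho> i q * vol_decay M f s q)) = (\<integral>q. (\<Sum>i\<in>D. \<rho> i q * vol_decay M f s q) \<partial>\<mu> s)"
    by (rule Bochner_Integration.integral_sum[symmetric])
      (intro integrable_\<mu>[OF s] continuous_on_mult C1_fun_continuous[OF \<rho>] continuous_at_time(2)[OF s])
  also have "\<dots> = integral\<^sup>L (\<mu> s) (vol_decay M f s)"
    using D' by (simp add: sum_distrib_right[symmetric])
  finally have "((\<lambda>\<sigma>. \<Sum>i\<in>D. integral (cbox (a i) (b i)) (\<lambda>x. imm_dens (f \<sigma>) (c i) x * \<rho> i (param (c i) x))) has_field_derivative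
      - integral\<^sup>L (\<mu> s) (vol_decay M f s)) (at s within {0..1})" by simp
  then show ?thesis
    by (rule has_field_derivative_transform_within[OF _ zero_less_one s]) (simp add: Vol)
qed

section \<open>Growth of the square root of the volume\<close>

definition total_energy :: "real \<Rightarrow> real" where "total_energy s = integral\<^sup>L (\<mu> s) (energy M A f s)"

lemma Lhor_eq: "Lhor M N g A f = integral {0..1} (\<lambda>s. sqrt (total_energy s))"
  unfolding Lhor_def GA_def total_energy_def \<mu>_def energy_def[abs_def] nvelocity_def ..

text \<open>\<open>integral\<close> returns 0 for a function that is not integrable, so
  \<open>Lhor\<close> bounds anything only once the speed is known to be integrable.\<close>

lemma continuous_total_energy: "continuous_on {0..1} total_energy"
proof -
  obtain D :: "'a set" and c a b K \<rho> where D: "partition_of_unity M D c a b K \<rho>"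
    using partition_of_unity_exists[OF M comp] by blast
  note D' = D[unfolded partition_of_unity_def]
  have "continuous_on {0..1} (\<lambda>s. \<Sum>i\<in>D. integral (cbox (a i) (b i))
      (\<lambda>x. imm_dens (f s) (c i) x * (\<rho> i (param (c i) x) * energy M A f s (param (c i) x))))"
  proof (intro continuous_on_sum integral_continuous_on_param)
    fix i assume i: "i \<in> D"
    have ci: "c i \<in> M" "cbox (a i) (b i) \<subseteq> cod_of (c i)" using D' i by auto
    have \<rho>c: "continuous_on (cod_of (c i)) (\<lambda>x. \<rho> i (param (c i) x))"
      by (rule C1_on_continuous) (use D' i in blast)
    have "continuous_on ({0..1} \<times> cbox (a i) (b i)) (\<lambda>(s, x). energy M A f s (param (c i) x))"
      by (rule continuous_on_subset[OF continuous_joint(3)[OF ci(1)]]) (use ci(2) in auto)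
    from continuous_on_mult[OF continuous_on_joint_cbox[OF ci continuous_joint(1)[OF ci(1)] \<rho>c] this]
    show "continuous_on ({0..1} \<times> cbox (a i) (b i))
        (\<lambda>(s, x). imm_dens (f s) (c i) x * (\<rho> i (param (c i) x) * energy M A f s (param (c i) x)))"
      by (simp add: case_prod_unfold mult.assoc)
  qed
  then show ?thesis
    by (rule continuous_on_eq)
      (simp add: total_energy_def integral_\<mu>_partition[OF D _ continuous_at_time(1)])
qed

lemma vol_decay_bound:
  assumes s: "s \<in> {0..1}"
  shows "A * (integral\<^sup>L (\<mu> s) (vol_decay M f s))\<^sup>2 \<le> Vol M N g (f s) * total_energy s" "0 \<le> total_energy s"
    "0 < Vol M N g (f s)"
proof -
  have sp: "space (\<mu> s) = UNIV" using sets_eq_imp_space_eq[OF sets_\<mu>[OF s]] by simp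
  have V: "measure (\<mu> s) (space (\<mu> s)) = Vol M N g (f s)" unfolding sp by (simp add: Vol_def \<mu>_def)
  show V0: "0 < Vol M N g (f s)" by (rule has_density_vol(3)[OF M comp smooth_path_Imm[OF f s]])
  show "0 \<le> total_energy s"
    unfolding total_energy_def by (rule Bochner_Integration.integral_nonneg) (rule vol_decay_energy(2)[OF M f s A])
  note k = continuous_at_time[OF s]
  have k2: "continuous_on UNIV (\<lambda>q. (vol_decay M f s q)\<^sup>2)" by (intro continuous_on_power k)
  have "(integral\<^sup>L (\<mu> s) (vol_decay M f s))\<^sup>2 \<le> Vol M N g (f s) * (\<integral>q. (vol_decay M f s q)\<^sup>2 \<partial>\<mu> s)"
    using finite_measure.integral_square_bound[OF finite_\<mu>[OF s] integrable_\<mu>[OF s k(2)] integrable_\<mu>[OF s k2]] V V0 by simp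
  then have "A * (integral\<^sup>L (\<mu> s) (vol_decay M f s))\<^sup>2 \<le> A * (Vol M N g (f s) * (\<integral>q. (vol_decay M f s q)\<^sup>2 \<partial>\<mu> s))"
    using A by (intro mult_left_mono) auto
  also have "\<dots> = Vol M N g (f s) * (\<integral>q. A * (vol_decay M f s q)\<^sup>2 \<partial>\<mu> s)" by (simp add: mult_ac)
  also have "\<dots> \<le> Vol M N g (f s) * total_energy s"
    unfolding total_energy_def
  proof (intro mult_left_mono integral_mono)
    show "integrable (\<mu> s) (\<lambda>q. A * (vol_decay M f s q)\<^sup>2)"
      by (intro integrable_\<mu>[OF s] continuous_on_mult continuous_on_const k2)
  qed (use V0 integrable_\<mu>[OF s k(1)] vol_decay_energy(1)[OF M f s A] in auto)
  finally show "A * (integral\<^sup>L (\<mu> s) (vol_decay M f s))\<^sup>2 \<le> Vol M N g (f s) * total_energy s" .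
qed

lemma sqrt_Vol_le_Lhor:
  "sqrt (Vol M N g (f 1)) - sqrt (Vol M N g (f 0)) \<le> 1 / (2 * sqrt A) * Lhor M N g A f"
proof -
  \<comment> \<open>The derivative of the square root of the volume by the chain rule; the volume is
    positive along the whole path, so the root is differentiable throughout, one-sidedly at the
    ends.\<close>
  define v where "v s = - integral\<^sup>L (\<mu> s) (vol_decay M f s) * (inverse (sqrt (Vol M N g (f s))) / 2)" for s
  have "((\<lambda>s. sqrt (Vol M N g (f s))) has_vector_derivative v s) (at s within {0..1})" if s: "s \<in> {0..1}" for s
  proof -
    have "((\<lambda>s. sqrt (Vol M N g (f s))) has_field_derivative v s) (at s within {0..1})"
      using DERIV_chain2[OF DERIV_real_sqrt[OF vol_decay_bound(3)[OF s]] Vol_derivative[OF s]]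
      by (simp add: v_def mult.commute)
    then show ?thesis by (simp add: has_real_derivative_iff_has_vector_derivative)
  qed
  then have 1: "(v has_integral (sqrt (Vol M N g (f 1)) - sqrt (Vol M N g (f 0)))) {0..1}"
    by (intro fundamental_theorem_of_calculus) auto
  have "(\<lambda>s. sqrt (total_energy s)) integrable_on {0..1}"
    by (intro integrable_continuous_real continuous_on_real_sqrt continuous_total_energy)
  then have "((\<lambda>s. sqrt (total_energy s)) has_integral Lhor M N g A f) {0..1}"
    unfolding Lhor_eq by (rule integrable_integral)
  from has_integral_mult_right[OF this, of "1 / (2 * sqrt A)"]
  have 2: "((\<lambda>s. 1 / (2 * sqrt A) * sqrt (total_energy s)) has_integral 1 / (2 * sqrt A) * Lhor M N g A f) {0..1}" .
  show ?thesis
  proof (rule has_integral_le[OF 1 2])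
    fix s :: real assume s: "s \<in> {0..1}"
    define I where "I = integral\<^sup>L (\<mu> s) (vol_decay M f s)"
    define V where "V = Vol M N g (f s)"
    note b = vol_decay_bound[OF s, folded I_def V_def]
    have "sqrt A * \<bar>I\<bar> = sqrt (A * I\<^sup>2)" by (simp add: real_sqrt_mult)
    also have "\<dots> \<le> sqrt (V * total_energy s)" using b(1) by (rule real_sqrt_le_mono)
    finally have le: "sqrt A * \<bar>I\<bar> \<le> sqrt V * sqrt (total_energy s)" by (simp add: real_sqrt_mult)
    have "v s = - I / (2 * sqrt V)" by (simp add: v_def I_def V_def field_simps)
    also have "\<dots> \<le> \<bar>I\<bar> / (2 * sqrt V)" using b(3) by (intro divide_right_mono) auto
    also have "\<dots> \<le> 1 / (2 * sqrt A) * sqrt (total_energy s)"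
      using le A b(3) by (simp add: field_simps)
    finally show "v s \<le> 1 / (2 * sqrt A) * sqrt (total_energy s)" .
  qed
qed

end

text \<open>\<open>the_elem\<close> is meaningful because the volume is constant on the orbit by
  diffeomorphism invariance, and the identity diffeomorphism shows that the orbit contains
  \<open>h\<close>.\<close>

lemma Vol_Bi_eq:
  fixes M :: "('a::t2_space, 'm::finite) atlas"
  assumes "target N g" and M: "smooth_atlas M" and comp: "compact (UNIV :: 'a set)" and h: "h \<in> Imm M N"
  shows "Vol_Bi M N g (Bi_proj M N h) = Vol M N g h"
proof -
  interpret target N g by fact
  have "Vol M N g ` Bi_proj M N h = {Vol M N g h}"
  proof
    show "Vol M N g ` Bi_proj M N h \<subseteq> {Vol M N g h}"
      using Vol_Diff_invariant[OF M comp h] by (auto simp: Bi_proj_def reparam_def)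
    have "h \<circ> (\<lambda>x. x) \<in> Bi_proj M N h"
      using h id_Diff[OF M] unfolding Bi_proj_def reparam_def by blast
    then show "{Vol M N g h} \<subseteq> Vol M N g ` Bi_proj M N h" by (auto simp: comp_def)
  qed
  then show ?thesis by (simp add: Vol_Bi_def)
qed

theorem mainTheorem4:
  fixes M :: "('a::{t2_space, second_countable_topology}, 'm::finite) atlas"
    and N :: "('b::{t2_space, second_countable_topology}, 'n::finite) atlas"
    and g :: "('b, 'n) tensor"
    and A :: real
    and F0 F1 :: "('a \<Rightarrow> 'b) set"
  assumes "smooth_atlas M" and "compact (UNIV :: 'a set)" and "connected (UNIV :: 'a set)"
    and "smooth_atlas N" and "connected (UNIV :: 'b set)"
    and "riemannian_metric N g"
    and "CARD('m) < CARD('n)"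
    and "A > 0"
    and "F0 \<in> Bi M N" and "F1 \<in> Bi M N"
  shows "ereal (sqrt (Vol_Bi M N g F1) - sqrt (Vol_Bi M N g F0))
           \<le> ereal (1 / (2 * sqrt A)) * dist_Bi M N g A F0 F1"
proof -
  define \<Delta> where "\<Delta> = sqrt (Vol_Bi M N g F1) - sqrt (Vol_Bi M N g F0)"
  define C where "C = 1 / (2 * sqrt A)"
  have C: "C > 0" using assms(8) by (simp add: C_def)
  have T: "target N g" by unfold_locales (fact assms)+
  \<comment> \<open>Dividing by the positive constant first reduces the claim to a lower bound for
    an infimum, checked path by path; if no path exists the infimum is infinite and the bound is
    vacuous.\<close>
  have "ereal (\<Delta> / C) \<le> dist_Bi M N g A F0 F1"
    unfolding dist_Bi_def
  proof (rule INF_greatest)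
    fix f assume "f \<in> {f. smooth_path M N f \<and> Bi_proj M N (f 0) = F0 \<and> Bi_proj M N (f 1) = F1}"
    then have f: "smooth_path M N f" and F: "F0 = Bi_proj M N (f 0)" "F1 = Bi_proj M N (f 1)" by auto
    interpret target N g by (rule T)
    interpret path_of_immersions N g M A f by unfold_locales (fact assms f)+
    have "Vol_Bi M N g F0 = Vol M N g (f 0)" "Vol_Bi M N g F1 = Vol M N g (f 1)"
      unfolding F by (rule Vol_Bi_eq[OF T assms(1,2) smooth_path_Imm[OF f]], simp)+
    then have "\<Delta> \<le> C * Lhor M N g A f" using sqrt_Vol_le_Lhor by (simp add: \<Delta>_def C_def)
    then show "ereal (\<Delta> / C) \<le> ereal (Lhor M N g A f)" using C by (simp add: field_simps)
  qed
  then have "ereal C * ereal (\<Delta> / C) \<le> ereal C * dist_Bi M N g A F0 F1"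
    using C by (intro ereal_mult_left_mono) auto
  then show ?thesis using C by (simp add: \<Delta>_def C_def)
qed

end
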